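(* Let $\xi^1,\xi^2\in L^2(\Omega,\mathcal{F}_T,P;\mathbf{R})$, let $f^1,f^2:\Omega\times[0,T]\times\mathbf{R}\times\mathbf{R}^d\to\mathbf{R}$ and $g:\Omega\times[0,T]\times\mathbf{R}\times\mathbf{R}^d\to\mathbf{R}^l$. Assume: (a) $f^1$ is jointly measurable, $f^1(\cdot,y,z)\in M^2(0,T;\mathbf{R})$ for all $(y,z)\in\mathbf{R}\times\mathbf{R}^d$, and there is a constant $C>0$ such that $|f^1(t,y_1,z_1)-f^1(t,y_2,z_2)|^2\le C(|y_1-y_2|^2+|z_1-z_2|^2)$ for all $t\in[0,T]$ and $(y_i,z_i)\in\mathbf{R}\times\mathbf{R}^d$, $i=1,2$; (b) $g$ is jointly measurable, $g(\cdot,y,z)\in M^2(0,T;\mathbf{R}^l)$ for all $(y,z)\in\mathbf{R}\times\mathbf{R}^d$, and there are constants $C>0$ and $0<\alpha<1$ such that $|g(t,y_1,z_1)-g(t,y_2,z_2)|^2\le C|y_1-y_2|^2+\alpha|z_1-z_2|^2$ for all $t\in[0,T]$ and $(y_i,z_i)\in\mathbf{R}\times\mathbf{R}^d$, $i=1,2$; (c) $f^2$ is jointly measurable with $f^2(t,y,z)$ $\mathcal{F}_t$-measurable for all $(t,y,z)$; for each fixed $(\omega,t)$ the map $f^2(\omega,t,\cdot,\cdot)$ is continuous; there is a constant $0<K<\infty$ such that $|f^2(\omega,t,y,z)|\le|f^2(\omega,t,0,0)|+K|y|+K|z|$ for all $(\omega,t,y,z)\in\Omega\times[0,T]\times\mathbf{R}\times\mathbf{R}^d$;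 and $\mathbf{E}\int_0^T|f^2(\omega,t,0,0)|^2\,dt<\infty$; (d) $\xi^1\ge\xi^2$ a.s., and $f^1(t,y,z)\ge f^2(t,y,z)$ a.s. for all $(t,y,z)\in[0,T]\times\mathbf{R}\times\mathbf{R}^d$. For $i=1,2$, let $(Y^i,Z^i)$ be a solution of $$Y^i_t=\xi^i+\int_t^T f^i(s,Y^i_s,Z^i_s)\,ds+\int_t^T g(s,Y^i_s,Z^i_s)\,dB_s-\int_t^T Z^i_s\,dW_s,\quad 0\le t\le T.$$ Then $P\{Y^1_t\ge Y^2_t\text{ for all }t\in[0,T]\}=1$.
   Context: $(\Omega,\mathcal{F},P)$ is a probability space, $T>0$ is fixed, and $\{W_t\}_{0\le t\le T}$, $\{B_t\}_{0\le t\le T}$ are mutually independent standard Brownian motions with values in $\mathbf{R}^d$ and $\mathbf{R}^l$. $\mathcal{N}$ is the class of $P$-null sets of $\mathcal{F}$. For a process $\eta$, $\mathcal{F}^\eta_{s,t}=\sigma\{\eta_r-\eta_s;\,s\le r\le t\}\vee\mathcal{N}$ and $\mathcal{F}^\eta_t=\mathcal{F}^\eta_{0,t}$; set $\mathcal{F}_t=\mathcal{F}^W_t\vee\mathcal{F}^B_{t,T}$ for $t\in[0,T]$ (this family is neither increasing nor decreasing in $t$). $M^2(0,T;\mathbf{R}^k)$ is the set of (classes of $dP\otimes dt$-a.e. equal) $k$-dimensional jointly measurable processes $\varphi$ with $\|\varphi\|_{M^2}^2=\mathbf{E}\int_0^T|\varphi_t|^2dt<\infty$ and $\varphi_t$ $\mathcal{F}_t$-measurable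 for every $t\in[0,T]$. $S^2([0,T];\mathbf{R}^k)$ is the set of $k$-dimensional continuous processes $\varphi$ with $\|\varphi\|_{S^2}^2=\mathbf{E}(\sup_{0\le t\le T}|\varphi_t|^2)<\infty$ and $\varphi_t$ $\mathcal{F}_t$-measurable for every $t$. $L^2(\Omega,\mathcal{F}_t,P;\mathbf{R}^k)$ is the set of $\mathcal{F}_t$-measurable square-integrable $k$-dimensional random variables. The $dW$ integral is a standard forward Itô integral; the $dB$ integral is a backward Itô integral, in which the integrand takes its values at the right end points of the subintervals in the Riemann-type sums. A solution of a backward doubly stochastic differential equation (BDSDE) of the displayed type is a pair $(Y,Z)\in S^2([0,T];\mathbf{R})\times M^2(0,T;\mathbf{R}^d)$ satisfying the equation. *)

theory Defs
  imports "HOL-Probability.Probability"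
begin

text \<open>Processes are written \<open>\<phi> t \<omega>\<close>; only their values for \<open>t \<in> {0..T}\<close> and
  \<open>\<omega> \<in> space M\<close> matter. Random fields (the coefficients) are written \<open>f \<omega> t y z\<close>.\<close>

section \<open>Brownian motion and the sigma-algebras\<close>

text \<open>The increment \<open>W t - W s\<close> is required to have law \<open>N(0, (t - s) I)\<close>, expressed by
  saying that its coordinates are independent with law \<open>N(0, t - s)\<close>.\<close>

definition std_brownian_motion ::
  "'a measure \<Rightarrow> real \<Rightarrow> (real \<Rightarrow> 'a \<Rightarrow> real ^ 'd) \<Rightarrow> bool" where
  "std_brownian_motion M T W \<longleftrightarrow>
     (\<forall>t\<in>{0..T}. W t \<in> borel_measurable M) \<and>
     (AE \<omega> in M. W 0 \<omega> = 0) \<and>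
     (AE \<omega> in M. continuous_on {0..T} (\<lambda>t. W t \<omega>)) \<and>
     (\<forall>n p. (\<forall>i\<le>n. p i \<in> {0..T}) \<and> (\<forall>i<n. p i \<le> p (Suc i)) \<longrightarrow>
        prob_space.indep_vars M (\<lambda>_::nat. borel) (\<lambda>i \<omega>. W (p (Suc i)) \<omega> - W (p i) \<omega>) {..<n}) \<and>
     (\<forall>s t. 0 \<le> s \<and> s < t \<and> t \<le> T \<longrightarrow>
        prob_space.indep_vars M (\<lambda>_. borel) (\<lambda>j \<omega>. (W t \<omega> - W s \<omega>) $ j) (UNIV :: 'd set) \<and>
        (\<forall>j. distributed M lborel (\<lambda>\<omega>. (W t \<omega> - W s \<omega>) $ j)
               (\<lambda>x. ennreal (normal_density 0 (sqrt (t - s)) x))))"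

text \<open>\<open>prob_space.indep_var\<close> would force both path-valued random variables to have the same type,
  hence independence of the generated sigma-algebras.\<close>

definition indep_processes ::
  "'a measure \<Rightarrow> real \<Rightarrow> (real \<Rightarrow> 'a \<Rightarrow> real ^ 'd) \<Rightarrow> (real \<Rightarrow> 'a \<Rightarrow> real ^ 'l) \<Rightarrow> bool" where
  "indep_processes M T W B \<longleftrightarrow>
     prob_space.indep_set M
       (sets (vimage_algebra (space M) (\<lambda>\<omega>. \<lambda>t\<in>{0..T}. W t \<omega>) (PiM {0..T} (\<lambda>_. borel))))
       (sets (vimage_algebra (space M) (\<lambda>\<omega>. \<lambda>t\<in>{0..T}. B t \<omega>) (PiM {0..T} (\<lambda>_. borel))))"

text \<open>\<open>incr_sigma M \<eta> s t\<close> is \<open>\<sigma>{\<eta> r - \<eta> s; s \<le> r \<le> t} \<or> N\<close>, with \<open>N\<close> the null sets of \<open>M\<close>.\<close>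

definition incr_sigma ::
  "'a measure \<Rightarrow> (real \<Rightarrow> 'a \<Rightarrow> 'v::euclidean_space) \<Rightarrow> real \<Rightarrow> real \<Rightarrow> 'a measure" where
  "incr_sigma M \<eta> s t = sigma (space M)
     ({(\<lambda>\<omega>. \<eta> r \<omega> - \<eta> s \<omega>) -` A \<inter> space M | r A. r \<in> {s..t} \<and> A \<in> sets borel} \<union> null_sets M)"

definition sigma_join :: "'a measure \<Rightarrow> 'a measure \<Rightarrow> 'a measure" where
  "sigma_join N1 N2 = sigma (space N1 \<union> space N2) (sets N1 \<union> sets N2)"

definition bd_sigma ::
  "'a measure \<Rightarrow> real \<Rightarrow> (real \<Rightarrow> 'a \<Rightarrow> real ^ 'd) \<Rightarrow> (real \<Rightarrow> 'a \<Rightarrow> real ^ 'l) \<Rightarrow> real \<Rightarrow> 'a measure" where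
  "bd_sigma M T W B t = sigma_join (incr_sigma M W 0 t) (incr_sigma M B t T)"

text \<open>\<open>bd_sigma\<close> is not monotone in \<open>t\<close>. The forward integral is taken in the increasing
  family \<open>F\<^sup>W\<^sub>t \<or> F\<^sup>B\<^sub>T\<close>, the backward one in the decreasing family \<open>F\<^sup>W\<^sub>T \<or> F\<^sup>B\<^bsub>t,T\<^esub>\<close>; both
  contain \<open>bd_sigma\<close>.\<close>

definition fwd_sigma ::
  "'a measure \<Rightarrow> real \<Rightarrow> (real \<Rightarrow> 'a \<Rightarrow> real ^ 'd) \<Rightarrow> (real \<Rightarrow> 'a \<Rightarrow> real ^ 'l) \<Rightarrow> real \<Rightarrow> 'a measure" where
  "fwd_sigma M T W B t = sigma_join (incr_sigma M W 0 t) (incr_sigma M B 0 T)"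

definition bwd_sigma ::
  "'a measure \<Rightarrow> real \<Rightarrow> (real \<Rightarrow> 'a \<Rightarrow> real ^ 'd) \<Rightarrow> (real \<Rightarrow> 'a \<Rightarrow> real ^ 'l) \<Rightarrow> real \<Rightarrow> 'a measure" where
  "bwd_sigma M T W B t = sigma_join (incr_sigma M W 0 T) (incr_sigma M B t T)"

section \<open>Spaces of random variables and processes\<close>

definition L2_space ::
  "'a measure \<Rightarrow> 'a measure \<Rightarrow> ('a \<Rightarrow> 'v::euclidean_space) set" where
  "L2_space M G = {\<xi>. \<xi> \<in> borel_measurable G \<and> (\<integral>\<^sup>+\<omega>. ennreal ((norm (\<xi> \<omega>))\<^sup>2) \<partial>M) < \<infinity>}"

text \<open>Elements of \<open>M2_space\<close> are representatives of the classes of a.e. equal processes.\<close>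

definition M2_space ::
  "'a measure \<Rightarrow> real \<Rightarrow> (real \<Rightarrow> 'a measure) \<Rightarrow> (real \<Rightarrow> 'a \<Rightarrow> 'v::euclidean_space) set" where
  "M2_space M T F = {\<phi>.
     (\<lambda>(\<omega>, t). \<phi> t \<omega>) \<in> borel_measurable (M \<Otimes>\<^sub>M restrict_space borel {0..T}) \<and>
     (\<forall>t\<in>{0..T}. \<phi> t \<in> borel_measurable (F t)) \<and>
     (\<integral>\<^sup>+\<omega>. (\<integral>\<^sup>+t\<in>{0..T}. ennreal ((norm (\<phi> t \<omega>))\<^sup>2) \<partial>lborel) \<partial>M) < \<infinity>}"

definition S2_space ::
  "'a measure \<Rightarrow> real \<Rightarrow> (real \<Rightarrow> 'a measure) \<Rightarrow> (real \<Rightarrow> 'a \<Rightarrow> 'v::euclidean_space) set" where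
  "S2_space M T F = {\<phi>.
     (AE \<omega> in M. continuous_on {0..T} (\<lambda>t. \<phi> t \<omega>)) \<and>
     (\<forall>t\<in>{0..T}. \<phi> t \<in> borel_measurable (F t)) \<and>
     (\<integral>\<^sup>+\<omega>. (SUP t\<in>{0..T}. ennreal ((norm (\<phi> t \<omega>))\<^sup>2)) \<partial>M) < \<infinity>}"

definition jointly_measurable_coeff ::
  "'a measure \<Rightarrow> real \<Rightarrow> ('a \<Rightarrow> real \<Rightarrow> real \<Rightarrow> real ^ 'd \<Rightarrow> 'v::euclidean_space) \<Rightarrow> bool" where
  "jointly_measurable_coeff M T f \<longleftrightarrow>
     (\<lambda>(\<omega>, t, y, z). f \<omega> t y z) \<in>
       borel_measurable (M \<Otimes>\<^sub>M restrict_space borel {0..T} \<Otimes>\<^sub>M borel \<Otimes>\<^sub>M borel)"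

section \<open>Forward and backward Ito integrals\<close>

definition strict_partition :: "real \<Rightarrow> real \<Rightarrow> nat \<Rightarrow> (nat \<Rightarrow> real) \<Rightarrow> bool" where
  "strict_partition a b n p \<longleftrightarrow> p 0 = a \<and> p n = b \<and> (\<forall>i<n. p i < p (Suc i))"

definition step_process ::
  "nat \<Rightarrow> (nat \<Rightarrow> real) \<Rightarrow> (nat \<Rightarrow> 'a \<Rightarrow> 'v::euclidean_space) \<Rightarrow> real \<Rightarrow> 'a \<Rightarrow> 'v" where
  "step_process n p \<zeta> s \<omega> = (\<Sum>i<n. indicator {p i<..p (Suc i)} s *\<^sub>R \<zeta> i \<omega>)"

definition step_integral ::
  "(real \<Rightarrow> 'a \<Rightarrow> 'v) \<Rightarrow> nat \<Rightarrow> (nat \<Rightarrow> real) \<Rightarrow> (nat \<Rightarrow> 'a \<Rightarrow> 'v::euclidean_space) \<Rightarrow> 'a \<Rightarrow> real" where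
  "step_integral X n p \<zeta> \<omega> = (\<Sum>i<n. \<zeta> i \<omega> \<bullet> (X (p (Suc i)) \<omega> - X (p i) \<omega>))"

definition bounded_rv :: "'a measure \<Rightarrow> 'a measure \<Rightarrow> ('a \<Rightarrow> 'v::euclidean_space) \<Rightarrow> bool" where
  "bounded_rv M G \<zeta> \<longleftrightarrow> \<zeta> \<in> borel_measurable G \<and> (\<exists>c. \<forall>\<omega>\<in>space M. norm (\<zeta> \<omega>) \<le> c)"

text \<open>\<open>I\<close> is (a version of) the integral of \<open>\<phi>\<close> over \<open>[a, b]\<close> if step processes converging to
  \<open>\<phi>\<close> in \<open>L\<^sup>2(dP \<otimes> dt)\<close> have elementary integrals converging to \<open>I\<close> in \<open>L\<^sup>2(P)\<close>.\<close>

definition L2_limit_of_step_integrals ::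
  "'a measure \<Rightarrow> (real \<Rightarrow> 'a \<Rightarrow> 'v::euclidean_space) \<Rightarrow> (real \<Rightarrow> 'a \<Rightarrow> 'v) \<Rightarrow> real \<Rightarrow> real \<Rightarrow>
   (nat \<Rightarrow> nat) \<Rightarrow> (nat \<Rightarrow> nat \<Rightarrow> real) \<Rightarrow> (nat \<Rightarrow> nat \<Rightarrow> 'a \<Rightarrow> 'v) \<Rightarrow> ('a \<Rightarrow> real) \<Rightarrow> bool" where
  "L2_limit_of_step_integrals M X \<phi> a b n p \<zeta> I \<longleftrightarrow>
     I \<in> borel_measurable M \<and>
     (\<lambda>k. \<integral>\<^sup>+\<omega>. (\<integral>\<^sup>+s\<in>{a..b}. ennreal ((norm (\<phi> s \<omega> - step_process (n k) (p k) (\<zeta> k) s \<omega>))\<^sup>2) \<partial>lborel) \<partial>M)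
        \<longlonglongrightarrow> 0 \<and>
     (\<lambda>k. \<integral>\<^sup>+\<omega>. ennreal ((I \<omega> - step_integral X (n k) (p k) (\<zeta> k) \<omega>)\<^sup>2) \<partial>M) \<longlonglongrightarrow> 0"

text \<open>On the subinterval \<open>[p i, p (i + 1)]\<close> the coefficient of a step process is measurable at
  the left end point in the forward case and at the right end point in the backward case.\<close>

definition has_forward_ito_integral ::
  "'a measure \<Rightarrow> (real \<Rightarrow> 'a measure) \<Rightarrow> (real \<Rightarrow> 'a \<Rightarrow> 'v::euclidean_space) \<Rightarrow>
   (real \<Rightarrow> 'a \<Rightarrow> 'v) \<Rightarrow> real \<Rightarrow> real \<Rightarrow> ('a \<Rightarrow> real) \<Rightarrow> bool" where
  "has_forward_ito_integral M G X \<phi> a b I \<longleftrightarrow>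
     (\<exists>n p \<zeta>. (\<forall>k. strict_partition a b (n k) (p k) \<and>
                   (\<forall>i<n k. bounded_rv M (G (p k i)) (\<zeta> k i))) \<and>
               L2_limit_of_step_integrals M X \<phi> a b n p \<zeta> I)"

definition has_backward_ito_integral ::
  "'a measure \<Rightarrow> (real \<Rightarrow> 'a measure) \<Rightarrow> (real \<Rightarrow> 'a \<Rightarrow> 'v::euclidean_space) \<Rightarrow>
   (real \<Rightarrow> 'a \<Rightarrow> 'v) \<Rightarrow> real \<Rightarrow> real \<Rightarrow> ('a \<Rightarrow> real) \<Rightarrow> bool" where
  "has_backward_ito_integral M H X \<phi> a b I \<longleftrightarrow>
     (\<exists>n p \<zeta>. (\<forall>k. strict_partition a b (n k) (p k) \<and>
                   (\<forall>i<n k. bounded_rv M (H (p k (Suc i))) (\<zeta> k i))) \<and>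
               L2_limit_of_step_integrals M X \<phi> a b n p \<zeta> I)"

section \<open>Solutions of the equation\<close>

text \<open>The stochastic integrals are determined up to null sets, so the equation is required almost
  surely for each \<open>t\<close>. As \<open>Y\<close> is continuous, this is the same as almost surely for all \<open>t\<close> with
  continuous versions of the integrals.\<close>

definition bdsde_solution ::
  "'a measure \<Rightarrow> real \<Rightarrow> (real \<Rightarrow> 'a \<Rightarrow> real ^ 'd) \<Rightarrow> (real \<Rightarrow> 'a \<Rightarrow> real ^ 'l) \<Rightarrow> ('a \<Rightarrow> real) \<Rightarrow>
   ('a \<Rightarrow> real \<Rightarrow> real \<Rightarrow> real ^ 'd \<Rightarrow> real) \<Rightarrow> ('a \<Rightarrow> real \<Rightarrow> real \<Rightarrow> real ^ 'd \<Rightarrow> real ^ 'l) \<Rightarrow>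
   (real \<Rightarrow> 'a \<Rightarrow> real) \<Rightarrow> (real \<Rightarrow> 'a \<Rightarrow> real ^ 'd) \<Rightarrow> bool" where
  "bdsde_solution M T W B \<xi> f g Y Z \<longleftrightarrow>
     Y \<in> S2_space M T (bd_sigma M T W B) \<and>
     Z \<in> M2_space M T (bd_sigma M T W B) \<and>
     (AE \<omega> in M. set_integrable lborel {0..T} (\<lambda>s. f \<omega> s (Y s \<omega>) (Z s \<omega>))) \<and>
     (\<forall>t\<in>{0..T}. \<exists>IB IW.
        has_backward_ito_integral M (bwd_sigma M T W B) B (\<lambda>s \<omega>. g \<omega> s (Y s \<omega>) (Z s \<omega>)) t T IB \<and>
        has_forward_ito_integral M (fwd_sigma M T W B) W Z t T IW \<and>
        (AE \<omega> in M. Y t \<omega> = \<xi> \<omega> + (LBINT s:{t..T}. f \<omega> s (Y s \<omega>) (Z s \<omega>)) + IB \<omega> - IW \<omega>))"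

end

theory Submission
  imports Defs
begin

text \<open>Let \<open>\<delta> = Y\<^sup>2 - Y\<^sup>1\<close> and let \<open>\<phi>\<close> be a \<open>C\<^sup>2\<close> variant of the squared positive part. Instead of an Ito formula,
  only an inequality for \<open>E \<phi> (\<delta> t)\<close> is needed. On a small interval \<open>[a, b]\<close> the equation reads
  \<open>\<delta> a + (\<integral> Z dW) = \<delta> b + (\<integral> F ds) + (\<integral> G dB)\<close>; expanding \<open>\<phi>\<close> of the left side around \<open>\<delta> a\<close> and of the right side
  around \<open>\<delta> b\<close>, the linear martingale terms vanish in expectation, the quadratic ones are computed by the
  conditional isometries, and there are no mixed terms between the forward and the backward integral.
  Summing over a partition and refining it gives the inequality. Then \<open>f\<^sup>2 \<le> f\<^sup>1\<close> and the Lipschitz bounds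
  (with \<open>\<alpha> < 1\<close> absorbing the \<open>Z\<close> terms) yield \<open>E \<phi> (\<delta> t) \<le> K \<integral> E \<phi> (\<delta> s) ds\<close> over \<open>[t, T]\<close>, so \<open>\<phi> (\<delta> t) = 0\<close>.\<close>

section \<open>Square integrable functions\<close>

text \<open>The sigma-algebras F_t form no filtration, so a value \<open>\<delta> t\<close> can be
  used as known information for the forward integral only inside the larger family that contains all
  of B, and for the backward integral only inside the one that contains all of W. This dictates the
  point of expansion: the left end for W, the right end for B. The second-order terms then carry
  opposite signs, -1/2 for Z and +1/2 for G, and this is why \<alpha> < 1 is the right condition.
  The squared positive part itself fails because its second derivative jumps at 0, so that the
  Taylor remainder near 0 is as large as h^2. Moreover the integrals are merely square integrable,
  so a cubic remainder has no finite expectation in general; it is truncated, and the integrals are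
  compared with simple ones, whose third moments over a cell are of order (length)^(3/2). Only f1 is
  Lipschitz: f2 is replaced by f1 at the arguments of the second solution, and continuity in (y, z)
  makes the comparison of f1 with f2 hold for all (y, z) at once.\<close>

definition sq_int :: "'a measure \<Rightarrow> ('a \<Rightarrow> 'v::euclidean_space) \<Rightarrow> bool" where
  "sq_int N f \<longleftrightarrow> f \<in> borel_measurable N \<and> integrable N (\<lambda>x. (norm (f x))\<^sup>2)"

lemma sq_int_measurable: "sq_int N f \<Longrightarrow> f \<in> borel_measurable N"
  by (simp add: sq_int_def)

lemma sq_int_integrable: "sq_int N f \<Longrightarrow> integrable N (\<lambda>x. (norm (f x))\<^sup>2)"
  by (simp add: sq_int_def)

lemma sq_int_nn:
  assumes "f \<in> borel_measurable N"
  shows "sq_int N f \<longleftrightarrow> (\<integral>\<^sup>+x. ennreal ((norm (f x))\<^sup>2) \<partial>N) < \<infinity>"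
  using assms by (auto simp: sq_int_def integrable_iff_bounded)

lemma sq_int_bound:
  assumes "sq_int N g" "f \<in> borel_measurable N" "AE x in N. norm (f x) \<le> norm (g x)"
  shows "sq_int N f"
  unfolding sq_int_def
proof
  show "integrable N (\<lambda>x. (norm (f x))\<^sup>2)"
    using assms by (intro Bochner_Integration.integrable_bound[OF sq_int_integrable[OF assms(1)]])
      (auto elim!: eventually_mono intro!: power_mono)
qed fact

lemma norm_sq_add_le: "(norm (a + b :: 'v::real_normed_vector))\<^sup>2 \<le> 2 * (norm a)\<^sup>2 + 2 * (norm b)\<^sup>2"
proof -
  have "(norm (a + b))\<^sup>2 \<le> (norm a + norm b)\<^sup>2" by (intro power_mono norm_triangle_ineq) auto
  also have "\<dots> \<le> 2 * (norm a)\<^sup>2 + 2 * (norm b)\<^sup>2"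
    using sum_squares_bound[of "norm a" "norm b"] by (simp add: power2_sum)
  finally show ?thesis .
qed

lemma sq_int_add:
  assumes "sq_int N f" "sq_int N g"
  shows "sq_int N (\<lambda>x. f x + g x)"
  unfolding sq_int_def
proof
  show m: "(\<lambda>x. f x + g x) \<in> borel_measurable N" using assms by (auto simp: sq_int_def)
  show "integrable N (\<lambda>x. (norm (f x + g x))\<^sup>2)"
  proof (rule Bochner_Integration.integrable_bound)
    show "integrable N (\<lambda>x. 2 * (norm (f x))\<^sup>2 + 2 * (norm (g x))\<^sup>2)"
      using assms by (auto simp: sq_int_def)
  qed (use m norm_sq_add_le in auto)
qed

lemma sq_int_scaleR: "sq_int N f \<Longrightarrow> sq_int N (\<lambda>x. c *\<^sub>R f x)"
  by (auto simp: sq_int_def power_mult_distrib)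

lemma sq_int_uminus: "sq_int N f \<Longrightarrow> sq_int N (\<lambda>x. - f x)"
  by (auto simp: sq_int_def)

lemma sq_int_diff: "sq_int N f \<Longrightarrow> sq_int N g \<Longrightarrow> sq_int N (\<lambda>x. f x - g x)"
  using sq_int_add[of N f "\<lambda>x. - g x"] sq_int_uminus[of N g] by simp

lemma sq_int_norm: "sq_int N f \<Longrightarrow> sq_int N (\<lambda>x. norm (f x))"
  by (auto simp: sq_int_def)

lemma sq_int_mult_bounded:
  assumes "sq_int N f" "X \<in> borel_measurable N" "\<And>x. x \<in> space N \<Longrightarrow> \<bar>X x\<bar> \<le> c"
  shows "sq_int N (\<lambda>x. X x *\<^sub>R f x)"
proof (rule sq_int_bound[OF sq_int_scaleR[OF assms(1), of c]])
  show "(\<lambda>x. X x *\<^sub>R f x) \<in> borel_measurable N"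
    using assms by (auto simp: sq_int_def)
  show "AE x in N. norm (X x *\<^sub>R f x) \<le> norm (c *\<^sub>R f x)"
    using assms(3) by (intro AE_I2) (fastforce intro!: mult_right_mono)
qed

lemma sq_int_inner:
  assumes "sq_int N f" "sq_int N g"
  shows "integrable N (\<lambda>x. f x \<bullet> g x)"
proof (rule Bochner_Integration.integrable_bound)
  show "integrable N (\<lambda>x. (norm (f x))\<^sup>2 + (norm (g x))\<^sup>2)"
    using assms by (auto simp: sq_int_def)
  have "\<bar>a \<bullet> b\<bar> \<le> (norm a)\<^sup>2 + (norm b)\<^sup>2" for a b :: 'b
    using Cauchy_Schwarz_ineq2[of a b] sum_squares_bound[of "norm a" "norm b"]
      mult_nonneg_nonneg[of "norm a" "norm b"] by simp
  then show "AE x in N. norm (f x \<bullet> g x) \<le> norm ((norm (f x))\<^sup>2 + (norm (g x))\<^sup>2)"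
    by (intro AE_I2) simp
qed (use assms in \<open>auto simp: sq_int_def\<close>)

lemma sq_int_mult:
  fixes f g :: "'a \<Rightarrow> real"
  assumes "sq_int N f" "sq_int N g"
  shows "integrable N (\<lambda>x. f x * g x)"
  using sq_int_inner[OF assms] by simp

lemma sq_int_mult_norm:
  assumes "sq_int N f" "sq_int N g"
  shows "integrable N (\<lambda>x. norm (f x) * norm (g x))"
  using sq_int_inner[OF sq_int_norm[OF assms(1)] sq_int_norm[OF assms(2)]] by simp

text \<open>The integral of \<open>(norm (f x + t *\<^sub>R g x))\<^sup>2\<close> is a nonnegative
  polynomial of degree at most 2 in t; the bound is its discriminant condition.\<close>

lemma sq_int_inner_cauchy_schwarz:
  assumes f: "sq_int N f" and g: "sq_int N g"
  shows "\<bar>\<integral>x. f x \<bullet> g x \<partial>N\<bar> \<le> sqrt (\<integral>x. (norm (f x))\<^sup>2 \<partial>N) * sqrt (\<integral>x. (norm (g x))\<^sup>2 \<partial>N)"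
proof -
  define a m b where "a = (\<integral>x. (norm (f x))\<^sup>2 \<partial>N)" and "m = (\<integral>x. f x \<bullet> g x \<partial>N)"
    and "b = (\<integral>x. (norm (g x))\<^sup>2 \<partial>N)"
  have q: "0 \<le> a + 2 * t * m + t\<^sup>2 * b" for t
  proof -
    have "0 \<le> (\<integral>x. (norm (f x + t *\<^sub>R g x))\<^sup>2 \<partial>N)" by simp
    also have "\<dots> = (\<integral>x. (norm (f x))\<^sup>2 + 2 * t * (f x \<bullet> g x) + t\<^sup>2 * (norm (g x))\<^sup>2 \<partial>N)"
      by (intro Bochner_Integration.integral_cong refl)
        (simp only: power2_norm_eq_inner inner_add inner_scaleR_left inner_scaleR_right, simp add: inner_commute algebra_simps power2_eq_square)
    also have "\<dots> = a + 2 * t * m + t\<^sup>2 * b"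
      unfolding a_def m_def b_def
      using sq_int_integrable[OF f] sq_int_integrable[OF g] sq_int_inner[OF f g]
      by (simp add: Bochner_Integration.integral_add Bochner_Integration.integrable_add)
    finally show ?thesis .
  qed
  have b0: "b \<ge> 0" "a \<ge> 0" by (auto simp: b_def a_def)
  have "m\<^sup>2 \<le> a * b"
  proof (cases "b = 0")
    case True
    have "m = 0"
    proof (rule ccontr)
      assume "m \<noteq> 0"
      \<comment> \<open>This t makes \<open>a + 2 * t * m\<close> equal to -1.\<close>
      with q[of "- (a + 1) / (2 * m)"] True show False by (simp add: field_simps)
    qed
    then show ?thesis using b0 by simp
  next
    case False
    \<comment> \<open>The minimiser of the quadratic polynomial.\<close>
    with q[of "- m / b"] have "0 \<le> a - m\<^sup>2 / b"
      by (simp add: power2_eq_square field_simps)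
    then show ?thesis using False b0 by (simp add: field_simps)
  qed
  then have "\<bar>m\<bar> \<le> sqrt (a * b)" by (metis real_sqrt_abs real_sqrt_le_iff)
  then show ?thesis unfolding a_def m_def b_def by (simp add: real_sqrt_mult)
qed

text \<open>Continuity of the L2 inner product, the device by which identities for simple processes
  reach their limits: with one factor constant it gives means, with both factors convergent it gives
  second moments.\<close>

lemma sq_int_inner_tendsto:
  assumes f: "sq_int N f" "\<And>k. sq_int N (u k)" "(\<lambda>k. \<integral>x. (norm (u k x - f x))\<^sup>2 \<partial>N) \<longlonglongrightarrow> 0"
    and g: "sq_int N g" "\<And>k. sq_int N (v k)" "(\<lambda>k. \<integral>x. (norm (v k x - g x))\<^sup>2 \<partial>N) \<longlonglongrightarrow> 0"
  shows "(\<lambda>k. \<integral>x. u k x \<bullet> v k x \<partial>N) \<longlonglongrightarrow> (\<integral>x. f x \<bullet> g x \<partial>N)"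
proof -
  define a b where "a k = sqrt (\<integral>x. (norm (u k x - f x))\<^sup>2 \<partial>N)"
    and "b k = sqrt (\<integral>x. (norm (v k x - g x))\<^sup>2 \<partial>N)" for k
  define A B where "A = sqrt (\<integral>x. (norm (f x))\<^sup>2 \<partial>N)" and "B = sqrt (\<integral>x. (norm (g x))\<^sup>2 \<partial>N)"
  have du: "sq_int N (\<lambda>x. u k x - f x)" and dv: "sq_int N (\<lambda>x. v k x - g x)" for k
    using f g by (auto intro!: sq_int_diff)
  have le: "\<bar>(\<integral>x. u k x \<bullet> v k x \<partial>N) - (\<integral>x. f x \<bullet> g x \<partial>N)\<bar> \<le> a k * b k + a k * B + A * b k" for k
  proof -
    have "(\<integral>x. u k x \<bullet> v k x \<partial>N) - (\<integral>x. f x \<bullet> g x \<partial>N) = (\<integral>x. u k x \<bullet> v k x - f x \<bullet> g x \<partial>N)"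
      using f g by (simp add: Bochner_Integration.integral_diff sq_int_inner)
    also have "\<dots> = (\<integral>x. (u k x - f x) \<bullet> (v k x - g x) + (u k x - f x) \<bullet> g x + f x \<bullet> (v k x - g x) \<partial>N)"
      by (intro Bochner_Integration.integral_cong refl) (simp add: inner_diff algebra_simps)
    also have "\<dots> = (\<integral>x. (u k x - f x) \<bullet> (v k x - g x) \<partial>N) + (\<integral>x. (u k x - f x) \<bullet> g x \<partial>N)
        + (\<integral>x. f x \<bullet> (v k x - g x) \<partial>N)"
      using sq_int_inner[OF du[of k] dv[of k]] sq_int_inner[OF du[of k] g(1)] sq_int_inner[OF f(1) dv[of k]]
      by (simp only: Bochner_Integration.integral_add Bochner_Integration.integrable_add)
    finally show ?thesis
      using sq_int_inner_cauchy_schwarz[OF du[of k] dv[of k]] sq_int_inner_cauchy_schwarz[OF du[of k] g(1)]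
        sq_int_inner_cauchy_schwarz[OF f(1) dv[of k]]
      unfolding a_def b_def A_def B_def by linarith
  qed
  have a0: "a \<longlonglongrightarrow> 0" and b0: "b \<longlonglongrightarrow> 0"
    using tendsto_real_sqrt[OF f(3)] tendsto_real_sqrt[OF g(3)] by (simp_all add: a_def[abs_def] b_def[abs_def])
  have "(\<lambda>k. a k * b k + a k * B + A * b k) \<longlonglongrightarrow> 0 * 0 + 0 * B + A * 0"
    by (intro tendsto_intros a0 b0)
  then have "(\<lambda>k. a k * b k + a k * B + A * b k) \<longlonglongrightarrow> 0" by simp
  then have "(\<lambda>k. (\<integral>x. u k x \<bullet> v k x \<partial>N) - (\<integral>x. f x \<bullet> g x \<partial>N)) \<longlonglongrightarrow> 0"
    by (rule Lim_null_comparison[rotated]) (use le in auto)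
  then show ?thesis by (rule LIM_zero_cancel)
qed

lemma sq_int_square_add:
  assumes "sq_int N f" "sq_int N g"
  shows "(\<integral>x. (norm (f x + g x))\<^sup>2 \<partial>N) \<le> 2 * (\<integral>x. (norm (f x))\<^sup>2 \<partial>N) + 2 * (\<integral>x. (norm (g x))\<^sup>2 \<partial>N)"
proof -
  have "(\<integral>x. (norm (f x + g x))\<^sup>2 \<partial>N) \<le> (\<integral>x. 2 * (norm (f x))\<^sup>2 + 2 * (norm (g x))\<^sup>2 \<partial>N)"
    using sq_int_integrable[OF sq_int_add[OF assms]] assms[THEN sq_int_integrable]
    by (intro integral_mono norm_sq_add_le) auto
  also have "\<dots> = 2 * (\<integral>x. (norm (f x))\<^sup>2 \<partial>N) + 2 * (\<integral>x. (norm (g x))\<^sup>2 \<partial>N)"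
    using assms[THEN sq_int_integrable] by simp
  finally show ?thesis .
qed

lemma sq_int_tendsto_diff:
  assumes f: "sq_int N f" "\<And>k. sq_int N (u k)" "(\<lambda>k. \<integral>x. (norm (u k x - f x))\<^sup>2 \<partial>N) \<longlonglongrightarrow> 0"
    and g: "sq_int N g" "\<And>k. sq_int N (v k)" "(\<lambda>k. \<integral>x. (norm (v k x - g x))\<^sup>2 \<partial>N) \<longlonglongrightarrow> 0"
  shows "(\<lambda>k. \<integral>x. (norm ((u k x - v k x) - (f x - g x)))\<^sup>2 \<partial>N) \<longlonglongrightarrow> 0"
proof (rule tendsto_sandwich[OF _ _ tendsto_const])
  show "(\<lambda>k. 2 * (\<integral>x. (norm (u k x - f x))\<^sup>2 \<partial>N) + 2 * (\<integral>x. (norm (v k x - g x))\<^sup>2 \<partial>N)) \<longlonglongrightarrow> 0"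
    using tendsto_add[OF tendsto_mult_left[OF f(3), of 2] tendsto_mult_left[OF g(3), of 2]] by simp
  have "(\<integral>x. (norm ((u k x - v k x) - (f x - g x)))\<^sup>2 \<partial>N)
      \<le> 2 * (\<integral>x. (norm (u k x - f x))\<^sup>2 \<partial>N) + 2 * (\<integral>x. (norm (v k x - g x))\<^sup>2 \<partial>N)" for k
    using sq_int_square_add[OF sq_int_diff[OF f(2)[of k] f(1)] sq_int_diff[OF g(1) g(2)[of k]]]
    by (simp add: algebra_simps norm_minus_commute)
  then show "\<forall>\<^sub>F k in sequentially. (\<integral>x. (norm ((u k x - v k x) - (f x - g x)))\<^sup>2 \<partial>N)
      \<le> 2 * (\<integral>x. (norm (u k x - f x))\<^sup>2 \<partial>N) + 2 * (\<integral>x. (norm (v k x - g x))\<^sup>2 \<partial>N)" by simp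
qed simp

section \<open>Independence of Brownian increments\<close>

lemma (in prob_space) indep_set_mono:
  "indep_set A B \<Longrightarrow> A' \<subseteq> A \<Longrightarrow> B' \<subseteq> B \<Longrightarrow> indep_set A' B'"
  by (rule indep_setI) (use indep_setD[of A B] indep_setD_ev1[of A B] indep_setD_ev2[of A B] in blast)+

lemma (in prob_space) indep_set_commute: "indep_set A B \<Longrightarrow> indep_set B A"
proof (rule indep_setI)
  fix a b assume "indep_set A B" "a \<in> B" "b \<in> A"
  then have "prob (b \<inter> a) = prob b * prob a" by (intro indep_setD)
  then show "prob (a \<inter> b) = prob a * prob b" by (simp add: Int_commute mult.commute)
qed (use indep_setD_ev1[of A B] indep_setD_ev2[of A B] in auto)

lemma indep_processes_commute: "prob_space M \<Longrightarrow> indep_processes M T W B \<Longrightarrow> indep_processes M T B W"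
  unfolding indep_processes_def by (rule prob_space.indep_set_commute)

section \<open>Events determined by increments at finitely many times\<close>

lemma path_increment_measurable:
  fixes X :: "real \<Rightarrow> 'a \<Rightarrow> 'v::euclidean_space"
  assumes "r \<in> I" "s \<in> I"
  shows "(\<lambda>\<omega>. X r \<omega> - X s \<omega>) \<in> borel_measurable (vimage_algebra \<Omega> (\<lambda>\<omega>. \<lambda>t\<in>I. X t \<omega>) (PiM I (\<lambda>_. borel)))"
proof -
  have m: "(\<lambda>\<omega>. \<lambda>t\<in>I. X t \<omega>) \<in> measurable (vimage_algebra \<Omega> (\<lambda>\<omega>. \<lambda>t\<in>I. X t \<omega>) (PiM I (\<lambda>_. borel))) (PiM I (\<lambda>_. borel))"
    by (intro measurable_vimage_algebra1) (auto simp: space_PiM)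
  have "(\<lambda>f. f r - f s) \<in> borel_measurable (PiM I (\<lambda>_. borel :: 'v measure))"
    using assms by measurable
  from measurable_compose[OF m this] assms show ?thesis by simp
qed

text \<open>All differences between times of R, with no fixed base point: the family then grows with
  R, and two finite time sets embed in their union.\<close>

definition increment_events :: "'a measure \<Rightarrow> (real \<Rightarrow> 'a \<Rightarrow> 'v::euclidean_space) \<Rightarrow> real set \<Rightarrow> 'a set set" where
  "increment_events M X R = sigma_sets (space M)
     {(\<lambda>\<omega>. X r \<omega> - X s \<omega>) -` A \<inter> space M | r s A. r \<in> R \<and> s \<in> R \<and> A \<in> sets borel}"

lemma increment_events_subset:
  assumes "space N = space M"
    and "\<And>r s. r \<in> R \<Longrightarrow> s \<in> R \<Longrightarrow> (\<lambda>\<omega>. X r \<omega> - X s \<omega>) \<in> borel_measurable N"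
  shows "increment_events M X R \<subseteq> sets N"
  unfolding increment_events_def assms(1)[symmetric]
  by (rule sets.sigma_sets_subset) (use assms(2) in \<open>auto intro!: measurable_sets\<close>)

text \<open>The independence clause of \<open>std_brownian_motion\<close> speaks of consecutive
  steps along one ordered sequence of times. Since R lies on one side of the gap, listing R, p and q
  in order makes (p, q] itself one of these steps, namely step k.\<close>

lemma finite_times_enum:
  fixes R :: "real set"
  assumes "finite R" "p < q" and side: "R \<subseteq> {..p} \<or> R \<subseteq> {q..}"
  obtains n t k where "\<forall>i\<le>n. t i \<in> R \<union> {p, q}" "\<forall>i<n. t i \<le> t (Suc i)" "k < n"
    "t k = p" "t (Suc k) = q"
    "\<And>r. r \<in> R \<Longrightarrow> \<exists>i\<le>n. r = t i \<and> (if R \<subseteq> {..p} then i \<le> k else Suc k \<le> i)"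
proof -
  define xs where "xs = sorted_list_of_set (R \<union> {p, q})"
  have set: "set xs = R \<union> {p, q}" and srt: "sorted_wrt (<) xs"
    unfolding xs_def using assms by (simp_all del: sorted_list_of_set_insert_remove)
  have lt: "xs ! i < xs ! j \<longleftrightarrow> i < j" if "i < length xs" "j < length xs" for i j
    using sorted_wrt_nth_less[OF srt] that by (metis linorder_less_linear order_less_asym)
  obtain k m where k: "k < length xs" "xs ! k = p" and m: "m < length xs" "xs ! m = q"
    using set by (metis UnI2 in_set_conv_nth insertCI)
  have km: "k < m" using lt[OF k(1) m(1)] k m assms by simp
  then have sk: "Suc k < length xs" using m by simp
  have "xs ! Suc k \<in> R \<union> {p, q}" using set sk nth_mem by blast
  moreover have "p < xs ! Suc k" using lt[OF k(1) sk] k by simp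
  moreover have "xs ! Suc k \<le> q" using lt[OF m(1) sk] m km by (simp add: not_less[symmetric])
  \<comment> \<open>By \<open>side\<close> no time of R lies strictly between p and q, so the
    successor of p in the list is q.\<close>
  ultimately have skq: "xs ! Suc k = q" using side by auto
  show thesis
  proof (rule that[of "length xs - 1" "(!) xs" k])
    show "\<forall>i\<le>length xs - 1. xs ! i \<in> R \<union> {p, q}"
    proof (intro allI impI)
      fix i assume "i \<le> length xs - 1"
      then have "i < length xs" using k(1) by simp
      then show "xs ! i \<in> R \<union> {p, q}" using set nth_mem by blast
    qed
    show "\<forall>i<length xs - 1. xs ! i \<le> xs ! Suc i"
      using lt by (simp add: less_imp_le)
    show "k < length xs - 1" using sk by simp
    show "xs ! k = p" "xs ! Suc k = q" by fact+
    fix r assume r: "r \<in> R"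
    then obtain i where i: "i < length xs" "xs ! i = r" using set by (metis UnI1 in_set_conv_nth)
    have "if R \<subseteq> {..p} then i \<le> k else Suc k \<le> i"
    proof (cases "R \<subseteq> {..p}")
      case True
      then have "\<not> xs ! k < xs ! i" using r i k by auto
      then show ?thesis using True lt[OF k(1) i(1)] by simp
    next
      case False
      then have "\<not> xs ! i < xs ! Suc k" using side r i skq by auto
      then show ?thesis using False lt[OF i(1) sk] by simp
    qed
    then show "\<exists>i\<le>length xs - 1. r = xs ! i \<and> (if R \<subseteq> {..p} then i \<le> k else Suc k \<le> i)"
      using i by (intro exI[of _ i]) auto
  qed
qed

text \<open>Every difference of times in R is, up to sign, a sum of steps other than step k, and
  step k is the increment over (p, q]; disjoint groups of independent variables are
  independent.\<close>

lemma (in prob_space) finite_increments_indep: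
  fixes X :: "real \<Rightarrow> 'a \<Rightarrow> real ^ 'd"
  assumes bm: "std_brownian_motion M T X" and R: "finite R" "R \<subseteq> {0..T}"
    and pq: "0 \<le> p" "p < q" "q \<le> T" and side: "R \<subseteq> {..p} \<or> R \<subseteq> {q..}"
  shows "indep_set (increment_events M X R)
    (sets (vimage_algebra (space M) (\<lambda>\<omega>. X q \<omega> - X p \<omega>) borel))"
proof -
  obtain n t k where t: "\<forall>i\<le>n. t i \<in> R \<union> {p, q}" "\<forall>i<n. t i \<le> t (Suc i)" "k < n"
    "t k = p" "t (Suc k) = q"
    and tR: "\<And>r. r \<in> R \<Longrightarrow> \<exists>i\<le>n. r = t i \<and> (if R \<subseteq> {..p} then i \<le> k else Suc k \<le> i)"
    by (rule finite_times_enum[OF R(1) pq(2) side]) (rule that, assumption+)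
  define D where "D i \<omega> = X (t (Suc i)) \<omega> - X (t i) \<omega>" for i \<omega>
  define A where "A = {..<n} - {k}"
  have "\<forall>i\<le>n. t i \<in> {0..T}" using t(1) R pq by fastforce
  then have ind: "indep_vars (\<lambda>_. borel) D {..<n}"
    using bm t(2) unfolding std_brownian_motion_def D_def[abs_def] by blast
  have "indep_var (PiM A (\<lambda>_. borel)) (\<lambda>\<omega>. restrict (\<lambda>i. D i \<omega>) A)
     (PiM {k} (\<lambda>_. borel)) (\<lambda>\<omega>. restrict (\<lambda>i. D i \<omega>) {k})"
    by (rule indep_var_restrict[OF ind]) (use t in \<open>auto simp: A_def\<close>)
  then have ind2: "indep_set
      (sets (vimage_algebra (space M) (\<lambda>\<omega>. restrict (\<lambda>i. D i \<omega>) A) (PiM A (\<lambda>_. borel))))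
      (sets (vimage_algebra (space M) (\<lambda>\<omega>. restrict (\<lambda>i. D i \<omega>) {k}) (PiM {k} (\<lambda>_. borel))))"
    by (simp add: indep_var_eq sets_vimage_algebra)
  let ?U = "\<lambda>K. vimage_algebra (space M) (\<lambda>\<omega>. restrict (\<lambda>i. D i \<omega>) K) (PiM K (\<lambda>_. borel :: (real^'d) measure))"
  have Dm: "D i \<in> borel_measurable (?U K)" if "i \<in> K" for i K
  proof -
    have m: "(\<lambda>\<omega>. restrict (\<lambda>i. D i \<omega>) K) \<in> measurable (?U K) (PiM K (\<lambda>_. borel))"
      by (intro measurable_vimage_algebra1) (auto simp: space_PiM)
    have "(\<lambda>f. f i) \<in> borel_measurable (PiM K (\<lambda>_. borel :: (real^'d) measure))"
      using that by measurable
    from measurable_compose[OF m this] that show ?thesis by simp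
  qed
  have tel: "X (t j) \<omega> - X (t i) \<omega> = (\<Sum>l\<in>{i..<j}. D l \<omega>)" if "i \<le> j" for i j \<omega>
    using that sum_Suc_diff'[of i j "\<lambda>l. X (t l) \<omega>"] by (simp add: D_def)
  have A: "increment_events M X R \<subseteq> sets (?U A)"
  proof (rule increment_events_subset)
    fix r s assume rs: "r \<in> R" "s \<in> R"
    obtain i j where ij: "i \<le> n" "r = t i" "if R \<subseteq> {..p} then i \<le> k else Suc k \<le> i"
      "j \<le> n" "s = t j" "if R \<subseteq> {..p} then j \<le> k else Suc k \<le> j"
      using tR[OF rs(1)] tR[OF rs(2)] by blast
    \<comment> \<open>Both indices lie on the same side of step k, so the telescoping range between
      them omits k.\<close>
    have sub: "{i..<j} \<subseteq> A" "{j..<i} \<subseteq> A" using ij by (auto simp: A_def split: if_splits)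
    show "(\<lambda>\<omega>. X r \<omega> - X s \<omega>) \<in> borel_measurable (?U A)"
    proof (cases "i \<le> j")
      case True
      have "(\<lambda>\<omega>. - (\<Sum>l\<in>{i..<j}. D l \<omega>)) \<in> borel_measurable (?U A)"
        using sub by (intro borel_measurable_uminus borel_measurable_sum Dm) auto
      also have "(\<lambda>\<omega>. - (\<Sum>l\<in>{i..<j}. D l \<omega>)) = (\<lambda>\<omega>. X r \<omega> - X s \<omega>)"
        using tel[OF True, symmetric] ij by (simp add: fun_eq_iff)
      finally show ?thesis .
    next
      case False
      then have "j \<le> i" by simp
      have "(\<lambda>\<omega>. (\<Sum>l\<in>{j..<i}. D l \<omega>)) \<in> borel_measurable (?U A)"
        using sub by (intro borel_measurable_sum Dm) auto
      also have "(\<lambda>\<omega>. (\<Sum>l\<in>{j..<i}. D l \<omega>)) = (\<lambda>\<omega>. X r \<omega> - X s \<omega>)"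
        using tel[OF \<open>j \<le> i\<close>, symmetric] ij by (simp add: fun_eq_iff)
      finally show ?thesis .
    qed
  qed simp
  have B: "sets (vimage_algebra (space M) (\<lambda>\<omega>. X q \<omega> - X p \<omega>) borel) \<subseteq> sets (?U {k})"
    using Dm[of k "{k}"] t by (intro sets_image_in_sets) (auto simp: D_def[abs_def])
  show ?thesis by (rule indep_set_mono[OF ind2 A B])
qed

text \<open>Two finite time sets merge into one, so both events lie in a common sigma-algebra.
  Stability under intersection is what the extension of independence to the generated sigma-algebra
  asks of its generator.\<close>

lemma Int_stable_increment_events:
  "Int_stable (\<Union>R\<in>{R. finite R \<and> R \<subseteq> I}. increment_events M X R)"
proof (rule Int_stableI)
  fix a b assume "a \<in> (\<Union>R\<in>{R. finite R \<and> R \<subseteq> I}. increment_events M X R)"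
    "b \<in> (\<Union>R\<in>{R. finite R \<and> R \<subseteq> I}. increment_events M X R)"
  then obtain R S where R: "finite R" "R \<subseteq> I" "a \<in> increment_events M X R"
    and S: "finite S" "S \<subseteq> I" "b \<in> increment_events M X S" by blast
  have mono: "increment_events M X R' \<subseteq> increment_events M X (R \<union> S)" if "R' \<subseteq> R \<union> S" for R'
    unfolding increment_events_def using that by (intro sigma_sets_subseteq) blast
  interpret s: sigma_algebra "space M" "increment_events M X (R \<union> S)"
    unfolding increment_events_def by (rule sigma_algebra_sigma_sets) auto
  have "a \<inter> b \<in> increment_events M X (R \<union> S)"
    using R S mono[of R] mono[of S] by (intro s.Int) auto
  then show "a \<inter> b \<in> (\<Union>R\<in>{R. finite R \<and> R \<subseteq> I}. increment_events M X R)"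
    using R S by (intro UN_I[of "R \<union> S"]) auto
qed

section \<open>The augmented sigma-algebras and their joins\<close>

lemma space_incr_sigma [simp]: "space (incr_sigma M X s t) = space M"
  by (simp add: incr_sigma_def space_measure_of_conv)

lemma sets_incr_sigma:
  "sets (incr_sigma M X s t) = sigma_sets (space M)
     ({(\<lambda>\<omega>. X r \<omega> - X s \<omega>) -` A \<inter> space M | r A. r \<in> {s..t} \<and> A \<in> sets borel} \<union> null_sets M)"
  unfolding incr_sigma_def by (rule sets_measure_of) (auto dest: null_setsD2 sets.sets_into_space)

lemma space_sigma_join [simp]: "space (sigma_join N1 N2) = space N1 \<union> space N2"
  by (simp add: sigma_join_def space_measure_of_conv)

lemma sets_sigma_join:
  assumes "space N1 = space N2"
  shows "sets (sigma_join N1 N2) = sigma_sets (space N2) (sets N1 \<union> sets N2)"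
  unfolding sigma_join_def using assms
  by (subst sets_measure_of) (auto dest: sets.sets_into_space)

lemma sets_sigma_join_le:
  assumes "space N1 = space N" "space N2 = space N" "sets N1 \<subseteq> sets N" "sets N2 \<subseteq> sets N"
  shows "sets (sigma_join N1 N2) \<subseteq> sets N"
proof -
  have "sigma_sets (space N) (sets N1 \<union> sets N2) \<subseteq> sets N"
    using assms(3,4) by (intro sets.sigma_sets_subset) auto
  then show ?thesis using assms(1,2) by (simp add: sets_sigma_join)
qed

lemma sets_sigma_join_ge:
  assumes "space N1 = space N2"
  shows "sets N1 \<subseteq> sets (sigma_join N1 N2)" "sets N2 \<subseteq> sets (sigma_join N1 N2)"
  using assms by (auto simp: sets_sigma_join)

lemma incr_sigma_increment:
  assumes "s \<le> p" "p \<le> q" "q \<le> t"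
  shows "(\<lambda>\<omega>. X q \<omega> - X p \<omega>) \<in> borel_measurable (incr_sigma M X s t)"
proof -
  have "(\<lambda>\<omega>. X r \<omega> - X s \<omega>) \<in> borel_measurable (incr_sigma M X s t)" if "r \<in> {s..t}" for r
    using that by (intro measurableI) (auto simp: sets_incr_sigma intro!: sigma_sets.Basic)
  from borel_measurable_diff[OF this[of q] this[of p]] show ?thesis using assms by simp
qed

lemma null_sets_incr_sigma: "null_sets M \<subseteq> sets (incr_sigma M X s t)"
  by (auto simp: sets_incr_sigma intro!: sigma_sets.Basic)

lemma sets_incr_sigma_le:
  assumes "space N = space M" "null_sets M \<subseteq> sets N"
    and "\<And>r. r \<in> {s..t} \<Longrightarrow> (\<lambda>\<omega>. X r \<omega> - X s \<omega>) \<in> borel_measurable N"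
  shows "sets (incr_sigma M X s t) \<subseteq> sets N"
  unfolding sets_incr_sigma assms(1)[symmetric]
  by (rule sets.sigma_sets_subset) (use assms(2,3) in \<open>auto intro!: measurable_sets\<close>)

lemma incr_sigma_mono:
  assumes "s' \<le> s" "t \<le> t'"
  shows "sets (incr_sigma M X s t) \<subseteq> sets (incr_sigma M X s' t')"
  using assms by (intro sets_incr_sigma_le null_sets_incr_sigma incr_sigma_increment) auto

text \<open>The other Brownian motion is known on all of [0, T], and the known stretch [s, t] of X
  may lie before or after (p, q], so the forward and the backward family are covered at once. The
  generators are intersections of an event from finitely many increments of X with an event of the
  path of X'.\<close>

lemma (in prob_space) increment_indep_join:
  fixes X :: "real \<Rightarrow> 'a \<Rightarrow> real ^ 'd" and X' :: "real \<Rightarrow> 'a \<Rightarrow> real ^ 'e"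
  assumes bm: "std_brownian_motion M T X" and ind: "indep_processes M T X X'"
    and pq: "0 \<le> p" "p < q" "q \<le> T" and st: "0 \<le> s" "s \<le> t" "t \<le> T" "t \<le> p \<or> q \<le> s"
  shows "indep_set (sets (sigma_join (incr_sigma M X s t) (incr_sigma M X' 0 T)))
    (sets (vimage_algebra (space M) (\<lambda>\<omega>. X q \<omega> - X p \<omega>) borel))"
proof -
  define V where "V = sets (vimage_algebra (space M) (\<lambda>\<omega>. X q \<omega> - X p \<omega>) borel)"
  define path where "path = vimage_algebra (space M) (\<lambda>\<omega>. \<lambda>t\<in>{0..T}. X t \<omega>) (PiM {0..T} (\<lambda>_. borel :: (real^'d) measure))"
  define path' where "path' = vimage_algebra (space M) (\<lambda>\<omega>. \<lambda>t\<in>{0..T}. X' t \<omega>) (PiM {0..T} (\<lambda>_. borel :: (real^'e) measure))"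
  have spaces: "space path = space M" "space path' = space M" by (auto simp: path_def path'_def)
  have ind': "indep_set (sets path) (sets path')"
    using ind by (simp add: indep_processes_def path_def path'_def)
  note ev = indep_setD_ev1[OF ind'] indep_setD_ev2[OF ind']
  define U where "U = (\<Union>R\<in>{R. finite R \<and> R \<subseteq> {s..t}}. increment_events M X R)"
  \<comment> \<open>The null sets are put among the generators because \<open>incr_sigma\<close>
    contains them; they meet any event in a null set and so do not spoil stability under
    intersection.\<close>
  define E where "E = {a \<inter> b | a b. a \<in> U \<and> b \<in> sets path'} \<union> null_sets M"
  have UV: "indep_set U V"
  proof -
    have "indep_set (increment_events M X R) V" if "finite R" "R \<subseteq> {s..t}" for R
      unfolding V_def using that st by (intro finite_increments_indep[OF bm that(1) _ pq]) auto
    note h = this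
    show ?thesis unfolding U_def
    proof (rule indep_setI)
      show "(\<Union>R\<in>{R. finite R \<and> R \<subseteq> {s..t}}. increment_events M X R) \<subseteq> events"
        using indep_setD_ev1[OF h] by blast
      show "V \<subseteq> events" using indep_setD_ev2[OF h[of "{}"]] by simp
    qed (use indep_setD[OF h] in blast)
  qed
  have Upath: "U \<subseteq> sets path"
  proof -
    have "increment_events M X R \<subseteq> sets path" if "R \<subseteq> {s..t}" for R
      using that st by (intro increment_events_subset[OF spaces(1)]) (auto simp: path_def intro!: path_increment_measurable)
    then show ?thesis unfolding U_def by blast
  qed
  have Vpath: "V \<subseteq> sets path"
    unfolding V_def using pq spaces
    by (intro sets_image_in_sets) (auto simp: path_def intro!: path_increment_measurable)
  have Vev: "V \<subseteq> events" by (rule indep_setD_ev2[OF UV])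
  have Uint: "Int_stable U" unfolding U_def by (rule Int_stable_increment_events)
  have Eint: "Int_stable E"
  proof (rule Int_stableI)
    fix a b assume a: "a \<in> E" and b: "b \<in> E"
    have Eev: "E \<subseteq> events" using Upath ev by (auto simp: E_def)
    show "a \<inter> b \<in> E"
    proof (cases "a \<in> null_sets M \<or> b \<in> null_sets M")
      case True
      then have "a \<inter> b \<in> null_sets M"
        using a b Eev null_set_Int2[of a M b] null_set_Int1[of b M a] by blast
      then show ?thesis by (simp add: E_def)
    next
      case False
      then obtain a1 a2 b1 b2 where eq: "a = a1 \<inter> a2" "b = b1 \<inter> b2" and
        "a1 \<in> U" "b1 \<in> U" "a2 \<in> sets path'" "b2 \<in> sets path'"
        using a b by (auto simp: E_def)
      moreover have "a \<inter> b = (a1 \<inter> b1) \<inter> (a2 \<inter> b2)" using eq by auto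
      moreover have "a1 \<inter> b1 \<in> U" using Uint \<open>a1 \<in> U\<close> \<open>b1 \<in> U\<close> by (auto simp: Int_stable_def)
      ultimately show ?thesis unfolding E_def by blast
    qed
  qed
  have "indep_set E V"
  proof (rule indep_setI)
    show "E \<subseteq> events" using Upath ev by (auto simp: E_def)
    show "V \<subseteq> events" by fact
    fix e c assume e: "e \<in> E" and c: "c \<in> V"
    show "prob (e \<inter> c) = prob e * prob c"
    proof (cases "e \<in> null_sets M")
      case True
      then have "e \<inter> c \<in> null_sets M" using c Vev by (meson null_set_Int2 subsetD)
      then show ?thesis using True by (simp add: measure_eq_0_null_sets)
    next
      case False
      then obtain a b where ab: "e = a \<inter> b" "a \<in> U" "b \<in> sets path'" using e by (auto simp: E_def)
      \<comment> \<open>First b is separated from the intersection of a and c, which is an event of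
        the path of X; then a is separated from c.\<close>
      have ac: "a \<inter> c \<in> sets path" using ab c Upath Vpath by auto
      have "prob (e \<inter> c) = prob ((a \<inter> c) \<inter> b)" using ab by (simp add: Int_ac)
      also have "\<dots> = prob (a \<inter> c) * prob b" by (rule indep_setD[OF ind' ac ab(3)])
      also have "\<dots> = prob a * prob c * prob b" using indep_setD[OF UV ab(2) c] by simp
      also have "\<dots> = prob e * prob c" using indep_setD[OF ind' _ ab(3), of a] ab(1,2) Upath by auto
      finally show ?thesis .
    qed
  qed
  then have *: "indep_set (sigma_sets (space M) E) (sigma_sets (space M) V)"
    by (rule indep_set_sigma_sets) (use Eint in \<open>auto simp: V_def Int_stable_def\<close>)
  define NE where "NE = sigma (space M) E"
  have "E \<subseteq> Pow (space M)" using indep_setD_ev1[OF \<open>indep_set E V\<close>] sets.space_closed by blast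
  then have NE: "space NE = space M" "sets NE = sigma_sets (space M) E"
    by (auto simp: NE_def)
  have nullE: "null_sets M \<subseteq> sets NE" by (auto simp: NE E_def)
  have 1: "sets (incr_sigma M X s t) \<subseteq> sets NE"
  proof (rule sets_incr_sigma_le[OF NE(1) nullE])
    fix r assume r: "r \<in> {s..t}"
    show "(\<lambda>\<omega>. X r \<omega> - X s \<omega>) \<in> borel_measurable NE"
    proof (rule measurableI)
      fix A :: "(real^'d) set" assume "A \<in> sets borel"
      then have "(\<lambda>\<omega>. X r \<omega> - X s \<omega>) -` A \<inter> space M \<in> increment_events M X {r, s}"
        unfolding increment_events_def by (intro sigma_sets.Basic) blast
      then have "(\<lambda>\<omega>. X r \<omega> - X s \<omega>) -` A \<inter> space M \<in> U"
        unfolding U_def using r by (intro UN_I[of "{r, s}"]) auto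
      moreover have "space M \<in> sets path'" by (metis spaces(2) sets.top)
      moreover have "(\<lambda>\<omega>. X r \<omega> - X s \<omega>) -` A \<inter> space M = ((\<lambda>\<omega>. X r \<omega> - X s \<omega>) -` A \<inter> space M) \<inter> space M" by auto
      ultimately have "(\<lambda>\<omega>. X r \<omega> - X s \<omega>) -` A \<inter> space M \<in> E" unfolding E_def by blast
      then show "(\<lambda>\<omega>. X r \<omega> - X s \<omega>) -` A \<inter> space NE \<in> sets NE" by (simp add: NE)
    qed simp
  qed
  have 2: "sets (incr_sigma M X' 0 T) \<subseteq> sets NE"
  proof (rule sets_incr_sigma_le[OF NE(1) nullE])
    fix r assume r: "r \<in> {0..T}"
    show "(\<lambda>\<omega>. X' r \<omega> - X' 0 \<omega>) \<in> borel_measurable NE"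
    proof (rule measurableI)
      fix A :: "(real^'e) set" assume "A \<in> sets borel"
      then have "(\<lambda>\<omega>. X' r \<omega> - X' 0 \<omega>) -` A \<inter> space path' \<in> sets path'"
        unfolding path'_def using r by (intro measurable_sets[OF path_increment_measurable]) auto
      moreover have "space M \<in> U"
        unfolding U_def by (rule UN_I[of "{}"]) (auto simp: increment_events_def intro: sigma_sets_top)
      moreover have "(\<lambda>\<omega>. X' r \<omega> - X' 0 \<omega>) -` A \<inter> space M = space M \<inter> ((\<lambda>\<omega>. X' r \<omega> - X' 0 \<omega>) -` A \<inter> space M)" by auto
      ultimately have "(\<lambda>\<omega>. X' r \<omega> - X' 0 \<omega>) -` A \<inter> space M \<in> E"
        unfolding E_def using spaces by (metis (mono_tags, lifting) UnI1 mem_Collect_eq)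
      then show "(\<lambda>\<omega>. X' r \<omega> - X' 0 \<omega>) -` A \<inter> space NE \<in> sets NE" by (simp add: NE)
    qed simp
  qed
  have "sets (sigma_join (incr_sigma M X s t) (incr_sigma M X' 0 T)) \<subseteq> sigma_sets (space M) E"
    using sets_sigma_join_le[OF _ _ 1 2] by (simp add: NE)
  then show ?thesis
    by (rule indep_set_mono[OF *]) (auto simp: V_def)
qed

section \<open>A smooth substitute for the squared positive part\<close>

text \<open>A replacement for \<open>(max 0 x)\<^sup>2\<close> that is \<open>C\<^sup>2\<close>, has quadratic growth, and still satisfies the three
  inequalities \<open>pos_cube'' x * x\<^sup>2 \<lesssim> pos_cube x\<close>, \<open>pos_cube' x * x \<lesssim> pos_cube x\<close> and
  \<open>(pos_cube' x)\<^sup>2 \<lesssim> pos_cube x * pos_cube'' x\<close> that close the Gronwall estimate.\<close>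

definition pos_cube :: "real \<Rightarrow> real" where
  "pos_cube x = (if x \<le> 0 then 0 else x ^ 3 / (1 + x))"

definition pos_cube' :: "real \<Rightarrow> real" where
  "pos_cube' x = (if x \<le> 0 then 0 else x\<^sup>2 * (2 * x + 3) / (1 + x)\<^sup>2)"

definition pos_cube'' :: "real \<Rightarrow> real" where
  "pos_cube'' x = (if x \<le> 0 then 0 else 2 - 2 / (1 + x) ^ 3)"

text \<open>The quadratic bound makes the difference quotient at 0 at most a multiple of
  \<bar>h\<bar>, so the two pieces fit together with derivative 0. It serves twice, for
  \<open>pos_cube\<close> and for \<open>pos_cube'\<close>.\<close>

lemma DERIV_pos_part:
  fixes f g :: "real \<Rightarrow> real"
  assumes "\<And>x. x > 0 \<Longrightarrow> (f has_real_derivative g x) (at x)" 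
    and "\<And>x. x > 0 \<Longrightarrow> \<bar>f x\<bar> \<le> C * x\<^sup>2"
  shows "((\<lambda>x. if x \<le> 0 then 0 else f x) has_real_derivative (if x \<le> 0 then 0 else g x)) (at x)"
proof -
  consider "x < 0" | "x = 0" | "x > 0" by linarith
  then show ?thesis
  proof cases
    case 1
    have "((\<lambda>x. 0) has_real_derivative 0) (at x)" by simp
    then have "((\<lambda>x. if x \<le> 0 then 0 else f x) has_real_derivative 0) (at x)"
      by (rule has_field_derivative_transform_within[where d="-x"]) (use 1 in \<open>auto simp: dist_real_def\<close>)
    then show ?thesis using 1 by simp
  next
    case 2
    have "((\<lambda>h. (if h \<le> 0 then 0 else f h) / h) \<longlongrightarrow> 0) (at 0)"
    proof (rule Lim_null_comparison)
      have "norm ((if h \<le> 0 then 0 else f h) / h) \<le> \<bar>C\<bar> * \<bar>h\<bar>" for h :: real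
      proof (cases "h > 0")
        case True
        have "\<bar>f h\<bar> \<le> \<bar>C\<bar> * h\<^sup>2"
          using assms(2)[OF True] by (meson abs_ge_self mult_right_mono order_trans zero_le_power2)
        then have "\<bar>f h\<bar> / h \<le> \<bar>C\<bar> * h"
          using True by (simp add: field_simps power2_eq_square)
        then show ?thesis using True by simp
      next
        case False
        then have "(if h \<le> 0 then 0 else f h) / h = 0" by simp
        then show ?thesis by (simp only: norm_zero) (intro mult_nonneg_nonneg abs_ge_zero)
      qed
      then show "\<forall>\<^sub>F h in at 0. norm ((if h \<le> 0 then 0 else f h) / h) \<le> \<bar>C\<bar> * \<bar>h\<bar>" by simp
      show "((\<lambda>h. \<bar>C\<bar> * \<bar>h\<bar>) \<longlongrightarrow> 0) (at (0::real))"
        by (auto intro!: tendsto_eq_intros)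
    qed
    then show ?thesis using 2 by (simp only: DERIV_def add_0) simp
  next
    case 3
    have "(f has_real_derivative g x) (at x)" using assms(1) 3 .
    then have "((\<lambda>x. if x \<le> 0 then 0 else f x) has_real_derivative g x) (at x)"
      by (rule has_field_derivative_transform_within[where d=x]) (use 3 in \<open>auto simp: dist_real_def\<close>)
    then show ?thesis using 3 by simp
  qed
qed

lemma pos_cube_deriv: "(pos_cube has_real_derivative pos_cube' x) (at x)"
  unfolding pos_cube_def[abs_def] pos_cube'_def
proof (rule DERIV_pos_part[where C=1])
  fix x :: real assume x: "x > 0"
  then show "((\<lambda>x. x ^ 3 / (1 + x)) has_real_derivative x\<^sup>2 * (2 * x + 3) / (1 + x)\<^sup>2) (at x)"
    by (auto intro!: derivative_eq_intros) (simp add: divide_simps, simp add: power2_eq_square power3_eq_cube algebra_simps)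
  show "\<bar>x ^ 3 / (1 + x)\<bar> \<le> 1 * x\<^sup>2"
    using x by (simp add: divide_simps) (simp add: power2_eq_square power3_eq_cube algebra_simps)
qed

lemma pos_cube'_deriv: "(pos_cube' has_real_derivative pos_cube'' x) (at x)"
  unfolding pos_cube'_def[abs_def] pos_cube''_def
proof (rule DERIV_pos_part[where C=3])
  fix x :: real assume x: "x > 0"
  \<comment> \<open>The partial fraction form of \<open>pos_cube'\<close>, which can be
    differentiated term by term.\<close>
  have "((\<lambda>x. 2 * x - 1 + 1 / (1 + x)\<^sup>2) has_real_derivative 2 - 2 / (1 + x) ^ 3) (at x)"
    using x by (auto intro!: derivative_eq_intros) (simp add: divide_simps, simp add: eval_nat_numeral algebra_simps)
  moreover have "2 * y - 1 + 1 / (1 + y)\<^sup>2 = y\<^sup>2 * (2 * y + 3) / (1 + y)\<^sup>2" if "y > 0" for y :: real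
    using that by (simp add: divide_simps) (simp add: power2_eq_square algebra_simps)
  ultimately show "((\<lambda>x. x\<^sup>2 * (2 * x + 3) / (1 + x)\<^sup>2) has_real_derivative 2 - 2 / (1 + x) ^ 3) (at x)"
    using x by (elim has_field_derivative_transform_within[where d=x]) (auto simp: dist_real_def)
  have "x\<^sup>2 * (2 * x + 3) \<le> x\<^sup>2 * (3 * (1 + x)\<^sup>2)"
    using x by (intro mult_left_mono) (auto simp: power2_eq_square algebra_simps)
  then show "\<bar>x\<^sup>2 * (2 * x + 3) / (1 + x)\<^sup>2\<bar> \<le> 3 * x\<^sup>2"
    using x by (simp add: divide_simps)
qed

lemma pos_cube''_bounds: "0 \<le> pos_cube'' x" "pos_cube'' x \<le> 2"
proof -
  have "x > 0 \<Longrightarrow> 1 \<le> (1 + x) ^ 3" by (simp add: one_le_power)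
  then show "0 \<le> pos_cube'' x" "pos_cube'' x \<le> 2" by (auto simp: pos_cube''_def divide_simps)
qed

text \<open>This is the property that the squared positive part lacks. The constant 6 is the factor
  2 in \<open>pos_cube''\<close> times the bound 3 for
  \<open>u\<^sup>2 + u * v + v\<^sup>2\<close>.\<close>

lemma pos_cube''_lipschitz: "\<bar>pos_cube'' x - pos_cube'' y\<bar> \<le> 6 * \<bar>x - y\<bar>"
proof -
  have *: "\<bar>pos_cube'' x - pos_cube'' y\<bar> \<le> 6 * (y - x)" if "x \<le> y" for x y
  proof -
    define a b where "a = max 0 x" and "b = max 0 y"
    have ab: "0 \<le> a" "a \<le> b" "b - a \<le> y - x" using that by (auto simp: a_def b_def)
    have e: "pos_cube'' z = 2 - 2 / (1 + max 0 z) ^ 3" for z by (auto simp: pos_cube''_def max_def)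
    define u v where "u = 1 / (1 + a)" and "v = 1 / (1 + b)"
    have uv: "0 \<le> v" "v \<le> u" "u \<le> 1" "u - v \<le> b - a"
    proof -
      have "u - v = (b - a) * (u * v)" using ab unfolding u_def v_def by (simp add: divide_simps)
      moreover have "u * v \<le> 1" using ab unfolding u_def v_def by (intro mult_le_one) auto
      ultimately show "u - v \<le> b - a" using ab by (simp add: mult_left_le)
    qed (use ab in \<open>auto simp: u_def v_def divide_simps\<close>)
    have "u ^ 3 - v ^ 3 = (u - v) * (u\<^sup>2 + u * v + v\<^sup>2)" by (simp add: algebra_simps power2_eq_square power3_eq_cube)
    also have "\<dots> \<le> (u - v) * 3"
    proof (rule mult_left_mono)
      have "u\<^sup>2 \<le> 1" "v\<^sup>2 \<le> 1" "u * v \<le> 1" using uv by (auto simp: power_le_one mult_le_one)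
      then show "u\<^sup>2 + u * v + v\<^sup>2 \<le> 3" by simp
    qed (use uv in auto)
    also have "\<dots> \<le> (y - x) * 3" using uv(4) ab(3) by simp
    finally have "u ^ 3 - v ^ 3 \<le> 3 * (y - x)" by simp
    moreover have "v ^ 3 \<le> u ^ 3" using uv by (intro power_mono) auto
    moreover have "pos_cube'' x - pos_cube'' y = 2 * v ^ 3 - 2 * u ^ 3"
      unfolding e a_def[symmetric] b_def[symmetric] by (simp add: u_def v_def power_one_over)
    ultimately show ?thesis by linarith
  qed
  show ?thesis using *[of x y] *[of y x] by (cases "x \<le> y") auto
qed

text \<open>The Taylor remainder is measured by \<open>min h\<^sup>2 \<bar>h\<bar>\<^sup>3\<close>: square integrable increments suffice for its
  integrability, and it is negligible when summed over fine partitions.\<close>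

definition min_square_cube :: "real \<Rightarrow> real" where
  "min_square_cube h = h\<^sup>2 * min 1 \<bar>h\<bar>"

lemma min_square_cube_nonneg: "0 \<le> min_square_cube h"
  by (simp add: min_square_cube_def)

lemma min_square_cube_le: "min_square_cube h \<le> h\<^sup>2" "min_square_cube h \<le> \<bar>h\<bar> ^ 3"
proof -
  show "min_square_cube h \<le> h\<^sup>2" by (simp add: min_square_cube_def mult_left_le)
  have "h\<^sup>2 * min 1 \<bar>h\<bar> \<le> h\<^sup>2 * \<bar>h\<bar>" by (intro mult_left_mono) auto
  also have "h\<^sup>2 * \<bar>h\<bar> = \<bar>h\<bar>\<^sup>2 * \<bar>h\<bar>" by simp
  also have "\<dots> = \<bar>h\<bar> ^ 3" by (simp only: power2_eq_square power3_eq_cube)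
  finally show "min_square_cube h \<le> \<bar>h\<bar> ^ 3" by (simp add: min_square_cube_def)
qed

text \<open>Deliberately asymmetric: a keeps its cubic smallness while b is charged quadratically.
  The part of b is played by the drift, and by the error made in replacing an integral by a simple
  one.\<close>

lemma min_square_cube_add: "min_square_cube (a + b) \<le> 8 * min_square_cube a + 4 * b\<^sup>2"
proof (cases "\<bar>b\<bar> \<le> \<bar>a\<bar>")
  case True
  then have "\<bar>a + b\<bar> \<le> 2 * \<bar>a\<bar>" by linarith
  then have "(a + b)\<^sup>2 \<le> 4 * a\<^sup>2" using power_mono[of "\<bar>a+b\<bar>" "2 * \<bar>a\<bar>" 2] by (simp add: power_mult_distrib)
  moreover have "min 1 \<bar>a + b\<bar> \<le> 2 * min 1 \<bar>a\<bar>" using \<open>\<bar>a + b\<bar> \<le> 2 * \<bar>a\<bar>\<close> by auto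
  ultimately have "(a + b)\<^sup>2 * min 1 \<bar>a + b\<bar> \<le> (4 * a\<^sup>2) * (2 * min 1 \<bar>a\<bar>)"
    by (intro mult_mono) auto
  also have "\<dots> \<le> (4 * a\<^sup>2) * (2 * min 1 \<bar>a\<bar>) + 4 * b\<^sup>2" by simp
  finally show ?thesis by (simp add: min_square_cube_def)
next
  case False
  then have "\<bar>a + b\<bar> \<le> 2 * \<bar>b\<bar>" by linarith
  then have "(a + b)\<^sup>2 \<le> 4 * b\<^sup>2" using power_mono[of "\<bar>a+b\<bar>" "2 * \<bar>b\<bar>" 2] by (simp add: power_mult_distrib)
  then show ?thesis using min_square_cube_le(1)[of "a + b"] min_square_cube_nonneg[of a] by linarith
qed

text \<open>As \<open>pos_cube''\<close> is only Lipschitz at 0, the mean value theorem is applied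
  twice in place of a third derivative.\<close>

lemma pos_cube_taylor:
  "\<bar>pos_cube (x + h) - pos_cube x - pos_cube' x * h - pos_cube'' x / 2 * h\<^sup>2\<bar> \<le> 6 * min_square_cube h"
proof -
  have mvt: "\<exists>z. \<bar>z\<bar> \<le> \<bar>k\<bar> \<and> f (x + k) - f x = k * f' (x + z)"
    if "\<And>y. (f has_real_derivative f' y) (at y)" for f f' :: "real \<Rightarrow> real" and k
  proof -
    consider "k = 0" | "k > 0" | "k < 0" by linarith
    then show ?thesis
    proof cases
      case 2
      from MVT2[of x "x + k" f f'] that 2 obtain z where "x < z" "z < x + k" "f (x + k) - f x = k * f' z" by auto
      then show ?thesis by (intro exI[of _ "z - x"]) auto
    next
      case 3
      from MVT2[of "x + k" x f f'] that 3 obtain z where "x + k < z" "z < x" "f x - f (x + k) = - k * f' z" by auto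
      then show ?thesis by (intro exI[of _ "z - x"]) (auto simp: algebra_simps)
    qed auto
  qed
  have r': "\<bar>pos_cube' (x + k) - pos_cube' x - pos_cube'' x * k\<bar> \<le> 6 * \<bar>k\<bar> * min 1 \<bar>k\<bar>" for k
  proof -
    obtain z where z: "\<bar>z\<bar> \<le> \<bar>k\<bar>" "pos_cube' (x + k) - pos_cube' x = k * pos_cube'' (x + z)"
      using mvt[of pos_cube' pos_cube'' k] pos_cube'_deriv by auto
    \<comment> \<open>The Lipschitz bound serves for small k; for large k both values lie in [0, 2],
      so they differ by at most 2.\<close>
    have "\<bar>pos_cube'' (x + z) - pos_cube'' x\<bar> \<le> 6 * min 1 \<bar>k\<bar>"
      using pos_cube''_lipschitz[of "x + z" x] pos_cube''_bounds[of x] pos_cube''_bounds[of "x+z"] z(1) by auto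
    then have "\<bar>k\<bar> * \<bar>pos_cube'' (x + z) - pos_cube'' x\<bar> \<le> \<bar>k\<bar> * (6 * min 1 \<bar>k\<bar>)"
      by (intro mult_left_mono) auto
    then show ?thesis unfolding z(2) by (simp add: abs_mult[symmetric] algebra_simps)
  qed
  define f f' where "f y = pos_cube y - pos_cube' x * (y - x) - pos_cube'' x / 2 * (y - x)\<^sup>2"
    and "f' y = pos_cube' y - pos_cube' x - pos_cube'' x * (y - x)" for y
  have "(f has_real_derivative f' y) (at y)" for y
    unfolding f_def[abs_def] f'_def
    by (auto intro!: derivative_eq_intros pos_cube_deriv)
  then obtain z where z: "\<bar>z\<bar> \<le> \<bar>h\<bar>" "f (x + h) - f x = h * f' (x + z)"
    using mvt[of f f' h] by blast
  have "\<bar>f' (x + z)\<bar> \<le> 6 * \<bar>z\<bar> * min 1 \<bar>z\<bar>" using r'[of z] by (simp add: f'_def)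
  also have "\<dots> \<le> 6 * \<bar>h\<bar> * min 1 \<bar>h\<bar>" using z(1) by (intro mult_mono) auto
  finally have "\<bar>h\<bar> * \<bar>f' (x + z)\<bar> \<le> \<bar>h\<bar> * (6 * \<bar>h\<bar> * min 1 \<bar>h\<bar>)" by (intro mult_left_mono) auto
  then have "\<bar>f (x + h) - f x\<bar> \<le> 6 * min_square_cube h"
    unfolding z(2) abs_mult min_square_cube_def power2_abs[of h, symmetric] unfolding power2_eq_square
    by (simp only: mult_ac)
  then show ?thesis by (simp add: f_def algebra_simps)
qed

section \<open>Growth and absorption inequalities for the smooth substitute\<close>

lemma pos_cube_nonneg: "0 \<le> pos_cube x" by (simp add: pos_cube_def)

lemma pos_cube'_nonneg: "0 \<le> pos_cube' x" by (simp add: pos_cube'_def)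

lemma pos_cube_eq_0: "pos_cube x = 0 \<longleftrightarrow> x \<le> 0" by (simp add: pos_cube_def)

lemma pos_cube_le_square: "pos_cube x \<le> x\<^sup>2"
  by (simp add: pos_cube_def divide_simps) (simp add: power2_eq_square power3_eq_cube algebra_simps)

lemma pos_cube'_le: "pos_cube' x \<le> 2 * \<bar>x\<bar>"
proof (cases "x > 0")
  case True
  have "x\<^sup>2 * (2 * x + 3) \<le> 2 * x * (1 + x)\<^sup>2"
    using True by (simp add: power2_eq_square algebra_simps)
  then show ?thesis using True by (simp add: pos_cube'_def divide_simps)
qed (simp add: pos_cube'_def)

lemma pos_cube''_square: "pos_cube'' x * x\<^sup>2 \<le> 6 * pos_cube x"
proof (cases "x > 0")
  case True
  have "2 * ((1 + x) ^ 3 - 1) \<le> 6 * x * (1 + x)\<^sup>2"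
    using True by (simp add: power2_eq_square power3_eq_cube algebra_simps)
  then have "2 - 2 / (1 + x) ^ 3 \<le> 6 * x / (1 + x)"
    using True by (simp add: divide_simps) (simp add: power2_eq_square power3_eq_cube algebra_simps)
  then have "(2 - 2 / (1 + x) ^ 3) * x\<^sup>2 \<le> 6 * x / (1 + x) * x\<^sup>2" by (intro mult_right_mono) auto
  then show ?thesis using True by (simp add: pos_cube_def pos_cube''_def power2_eq_square power3_eq_cube mult_ac)
qed (simp add: pos_cube_def pos_cube''_def)

lemma pos_cube'_times: "pos_cube' x * \<bar>x\<bar> \<le> 3 * pos_cube x"
proof (cases "x > 0")
  case True
  have "x ^ 3 * (2 * x + 3) \<le> x ^ 3 * (3 * (1 + x))" using True by (intro mult_left_mono) auto
  then show ?thesis using True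
    by (simp add: pos_cube_def pos_cube'_def divide_simps) (simp add: power2_eq_square power3_eq_cube algebra_simps)
qed (simp add: pos_cube_def pos_cube'_def)

text \<open>Through Young's inequality this splits the cross term between \<open>pos_cube' x\<close>
  and the norm of z into a multiple of \<open>pos_cube x\<close> and a small multiple of
  \<open>pos_cube'' x * z\<^sup>2\<close>. Near 0 the two sides behave like 9 x^4 and 12 x^4; at
  infinity both are asymptotic to 4 x^2, so the constant 2 cannot be lowered.\<close>

lemma pos_cube'_square: "(pos_cube' x)\<^sup>2 \<le> 2 * pos_cube x * pos_cube'' x"
proof (cases "x > 0")
  case True
  have e: "2 - 2 / (1 + x) ^ 3 = 2 * x * (3 + 3 * x + x\<^sup>2) / (1 + x) ^ 3"
    using True by (simp add: divide_simps) (simp add: power2_eq_square power3_eq_cube algebra_simps)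
  have "(2 * x + 3)\<^sup>2 \<le> 4 * (3 + 3 * x + x\<^sup>2)" by (simp add: power2_eq_square algebra_simps)
  then have "x ^ 4 * (2 * x + 3)\<^sup>2 / (1 + x) ^ 4 \<le> x ^ 4 * (4 * (3 + 3 * x + x\<^sup>2)) / (1 + x) ^ 4"
    using True by (intro divide_right_mono mult_left_mono) auto
  moreover have "(pos_cube' x)\<^sup>2 = x ^ 4 * (2 * x + 3)\<^sup>2 / (1 + x) ^ 4"
    using True by (simp add: pos_cube'_def power_mult_distrib power_divide flip: power_mult)
  moreover have "2 * pos_cube x * pos_cube'' x = x ^ 4 * (4 * (3 + 3 * x + x\<^sup>2)) / (1 + x) ^ 4"
    using True by (simp add: pos_cube_def pos_cube''_def e) (simp add: eval_nat_numeral mult_ac)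
  ultimately show ?thesis by simp
qed (simp add: pos_cube_def pos_cube'_def)

lemma continuous_pos_cube: "continuous_on A pos_cube" "continuous_on A pos_cube'" "continuous_on A pos_cube''"
proof -
  show "continuous_on A pos_cube" "continuous_on A pos_cube'"
    using DERIV_isCont[OF pos_cube_deriv] DERIV_isCont[OF pos_cube'_deriv]
    by (simp_all add: continuous_at_imp_continuous_on)
  show "continuous_on A pos_cube''"
    by (rule lipschitz_on_continuous_on[of 6], rule lipschitz_onI)
      (use pos_cube''_lipschitz in \<open>auto simp: dist_real_def\<close>)
qed

lemma pos_cube_measurable [measurable]:
  "pos_cube \<in> borel_measurable borel" "pos_cube' \<in> borel_measurable borel" "pos_cube'' \<in> borel_measurable borel"
  using continuous_pos_cube by (auto intro: borel_measurable_continuous_onI)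

section \<open>Elementary stochastic integrals, forward and backward\<close>

lemma (in pair_sigma_finite) has_bochner_integral_pair_mult:
  fixes f :: "'a \<Rightarrow> real" and g :: "'b \<Rightarrow> real"
  assumes f: "integrable M1 f" and g: "integrable M2 g"
  shows "has_bochner_integral (M1 \<Otimes>\<^sub>M M2) (\<lambda>x. f (fst x) * g (snd x))
    ((\<integral>x. f x \<partial>M1) * (\<integral>x. g x \<partial>M2))"
proof -
  have m: "f \<in> borel_measurable M1" "g \<in> borel_measurable M2" using f g by auto
  then have "(\<lambda>x. f (fst x) * g (snd x)) \<in> borel_measurable (M1 \<Otimes>\<^sub>M M2)" by measurable
  then have i: "integrable (M1 \<Otimes>\<^sub>M M2) (\<lambda>x. f (fst x) * g (snd x))"
    using f g by (intro Fubini_integrable) (auto simp: abs_mult)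
  from integral_fst'[OF i] show ?thesis using i by (simp add: has_bochner_integral_iff)
qed

lemma measurable_sub_sigma:
  assumes f: "f \<in> measurable N L" and "sets N \<subseteq> sets N'" "space N = space N'"
  shows "f \<in> measurable N' L"
  by (rule measurableI) (use measurable_space[OF f] measurable_sets[OF f] assms(2,3) in auto)

text \<open>\<open>K p q\<close> is the sigma-algebra of admissible coefficients on \<open>(p, q]\<close>: information up to \<open>p\<close> for a forward
  integral, information from \<open>q\<close> on for a backward one. \<open>K_order\<close> covers both directions: of two disjoint
  intervals, one is known when the coefficient on the other is chosen.\<close>

locale ito_noise = prob_space M for M :: "'a measure" +
  fixes T :: real and X :: "real \<Rightarrow> 'a \<Rightarrow> real ^ 'd" and K :: "real \<Rightarrow> real \<Rightarrow> 'a measure"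
  assumes X_meas: "t \<in> {0..T} \<Longrightarrow> X t \<in> borel_measurable M"
    and K_space: "space (K p q) = space M"
    and K_events: "0 \<le> p \<Longrightarrow> p \<le> q \<Longrightarrow> q \<le> T \<Longrightarrow> sets (K p q) \<subseteq> sets M"
    and K_mono: "0 \<le> p \<Longrightarrow> p \<le> p' \<Longrightarrow> p' \<le> q' \<Longrightarrow> q' \<le> q \<Longrightarrow> q \<le> T \<Longrightarrow> sets (K p q) \<subseteq> sets (K p' q')"
    and K_order: "0 \<le> p \<Longrightarrow> p < q \<Longrightarrow> q \<le> p' \<Longrightarrow> p' < q' \<Longrightarrow> q' \<le> T \<Longrightarrow>
      (sets (K p q) \<subseteq> sets (K p' q') \<and> (\<lambda>\<omega>. X q \<omega> - X p \<omega>) \<in> borel_measurable (K p' q')) \<or>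
      (sets (K p' q') \<subseteq> sets (K p q) \<and> (\<lambda>\<omega>. X q' \<omega> - X p' \<omega>) \<in> borel_measurable (K p q))"
    and incr_indep: "0 \<le> p \<Longrightarrow> p < q \<Longrightarrow> q \<le> T \<Longrightarrow>
      indep_set (sets (K p q)) (sets (vimage_algebra (space M) (\<lambda>\<omega>. X q \<omega> - X p \<omega>) borel))"
    and incr_mean: "0 \<le> p \<Longrightarrow> p < q \<Longrightarrow> q \<le> T \<Longrightarrow>
      has_bochner_integral M (\<lambda>\<omega>. (X q \<omega> - X p \<omega>) $ j) 0"
    and incr_cov: "0 \<le> p \<Longrightarrow> p < q \<Longrightarrow> q \<le> T \<Longrightarrow>
      has_bochner_integral M (\<lambda>\<omega>. (X q \<omega> - X p \<omega>) $ i * (X q \<omega> - X p \<omega>) $ j) (if i = j then q - p else 0)"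
    and incr_cube: "0 \<le> p \<Longrightarrow> p < q \<Longrightarrow> q \<le> T \<Longrightarrow> integrable M (\<lambda>\<omega>. \<bar>(X q \<omega> - X p \<omega>) $ j\<bar> ^ 3)"
      "0 \<le> p \<Longrightarrow> p < q \<Longrightarrow> q \<le> T \<Longrightarrow> (\<integral>\<omega>. \<bar>(X q \<omega> - X p \<omega>) $ j\<bar> ^ 3 \<partial>M) \<le> 2 * sqrt (q - p) ^ 3"
begin

sublocale P: pair_sigma_finite M lborel ..

abbreviation PL :: "('a \<times> real) measure" where "PL \<equiv> M \<Otimes>\<^sub>M lborel"

definition coef :: "real \<Rightarrow> real \<Rightarrow> ('a \<Rightarrow> 'b::euclidean_space) \<Rightarrow> bool" where
  "coef p q \<zeta> \<longleftrightarrow> \<zeta> \<in> borel_measurable (K p q) \<and> (\<exists>c. \<forall>\<omega>\<in>space M. norm (\<zeta> \<omega>) \<le> c)"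

lemma measurable_K_mono:
  assumes "sets (K p q) \<subseteq> sets (K p' q')" "f \<in> borel_measurable (K p q)"
  shows "f \<in> borel_measurable (K p' q')"
  by (rule measurable_sub_sigma[OF assms(2,1)]) (simp add: K_space)

lemma measurable_K:
  assumes "f \<in> borel_measurable (K p q)" "0 \<le> p" "p \<le> q" "q \<le> T"
  shows "f \<in> borel_measurable M"
  by (rule measurable_sub_sigma[OF assms(1) K_events[OF assms(2-4)]]) (simp add: K_space)

text \<open>The shorter the interval of the increment, the more is known to its coefficient, in both
  directions of time. Hence a step may be cut anywhere and its coefficient kept on each
  piece.\<close>

lemma coef_mono:
  assumes \<zeta>: "coef p q \<zeta>" and pq: "0 \<le> p" "p \<le> p'" "p' \<le> q'" "q' \<le> q" "q \<le> T"
  shows "coef p' q' \<zeta>"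
proof -
  have "\<zeta> \<in> borel_measurable (K p' q')"
    by (rule measurable_K_mono[OF K_mono[OF pq]]) (use \<zeta> in \<open>simp add: coef_def\<close>)
  then show ?thesis using \<zeta> by (simp add: coef_def)
qed

lemma incr_measurable:
  "0 \<le> p \<Longrightarrow> p \<le> q \<Longrightarrow> q \<le> T \<Longrightarrow> (\<lambda>\<omega>. X q \<omega> - X p \<omega>) \<in> borel_measurable M"
  by (intro borel_measurable_diff X_meas) auto

text \<open>Takes the place of conditional expectations: a factor known on (p, q] and a function of
  the increment over (p, q] separate under the expectation.\<close>

lemma incr_indep_mult:
  fixes U :: "'a \<Rightarrow> real" and h :: "real ^ 'd \<Rightarrow> real"
  assumes pq: "0 \<le> p" "p < q" "q \<le> T" and U: "U \<in> borel_measurable (K p q)" "integrable M U"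
    and h: "h \<in> borel_measurable borel" "has_bochner_integral M (\<lambda>\<omega>. h (X q \<omega> - X p \<omega>)) v"
  shows "has_bochner_integral M (\<lambda>\<omega>. U \<omega> * h (X q \<omega> - X p \<omega>)) ((\<integral>\<omega>. U \<omega> \<partial>M) * v)"
proof -
  let ?V = "vimage_algebra (space M) (\<lambda>\<omega>. X q \<omega> - X p \<omega>) (borel :: (real^'d) measure)"
  have hV: "(\<lambda>\<omega>. h (X q \<omega> - X p \<omega>)) \<in> borel_measurable ?V"
    by (rule measurable_compose[OF measurable_vimage_algebra1 h(1)]) auto
  have "indep_set (sigma_sets (space M) {U -` A \<inter> space M | A. A \<in> sets borel})
     (sigma_sets (space M) {(\<lambda>\<omega>. h (X q \<omega> - X p \<omega>)) -` A \<inter> space M | A. A \<in> sets borel})"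
  proof (rule indep_set_mono[OF incr_indep[OF pq]])
    show "sigma_sets (space M) {U -` A \<inter> space M | A. A \<in> sets borel} \<subseteq> sets (K p q)"
      using sets_image_in_sets[OF K_space U(1)] by (simp add: sets_vimage_algebra)
    show "sigma_sets (space M) {(\<lambda>\<omega>. h (X q \<omega> - X p \<omega>)) -` A \<inter> space M | A. A \<in> sets borel} \<subseteq> sets ?V"
      using sets_image_in_sets[OF space_vimage_algebra hV] by (simp add: sets_vimage_algebra)
  qed
  then have "indep_var borel U borel (\<lambda>\<omega>. h (X q \<omega> - X p \<omega>))"
    unfolding indep_var_eq using U(2) h(2) by (auto simp: has_bochner_integral_iff)
  then show ?thesis
    using indep_var_lebesgue_integral[OF _ U(2)] indep_var_integrable[OF _ U(2)] h(2)
    by (auto simp: has_bochner_integral_iff)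
qed

section \<open>Moments of products of two elementary increments\<close>

abbreviation incr_int :: "real \<Rightarrow> real \<Rightarrow> ('a \<Rightarrow> real ^ 'd) \<Rightarrow> 'a \<Rightarrow> real" where
  "incr_int p q \<zeta> \<omega> \<equiv> \<zeta> \<omega> \<bullet> (X q \<omega> - X p \<omega>)"

lemma integrable_coef_mult:
  assumes "coef p q (A :: 'a \<Rightarrow> real)" "0 \<le> p" "p \<le> q" "q \<le> T" "integrable M f"
  shows "integrable M (\<lambda>\<omega>. A \<omega> * f \<omega>)"
proof -
  obtain c where c: "\<forall>\<omega>\<in>space M. norm (A \<omega>) \<le> c" using assms(1) by (auto simp: coef_def)
  have m: "A \<in> borel_measurable M" using assms measurable_K by (auto simp: coef_def)
  show ?thesis
  proof (rule Bochner_Integration.integrable_bound)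
    show "integrable M (\<lambda>\<omega>. c * f \<omega>)" using assms by simp
    show "(\<lambda>\<omega>. A \<omega> * f \<omega>) \<in> borel_measurable M" using m assms by auto
    show "AE \<omega> in M. norm (A \<omega> * f \<omega>) \<le> norm (c * f \<omega>)"
    proof (rule AE_I2)
      fix \<omega> assume "\<omega> \<in> space M"
      then have "\<bar>A \<omega>\<bar> \<le> \<bar>c\<bar>" using c by fastforce
      then show "norm (A \<omega> * f \<omega>) \<le> norm (c * f \<omega>)" by (simp add: abs_mult mult_right_mono)
    qed
  qed
qed

lemma coef_component: "coef p q (\<zeta> :: 'a \<Rightarrow> real ^ 'd) \<Longrightarrow> coef p q (\<lambda>\<omega>. \<zeta> \<omega> $ j)"
proof -
  assume \<zeta>: "coef p q \<zeta>"
  then obtain c where c: "\<forall>\<omega>\<in>space M. norm (\<zeta> \<omega>) \<le> c" by (auto simp: coef_def)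
  have "\<forall>\<omega>\<in>space M. norm (\<zeta> \<omega> $ j) \<le> c"
  proof
    fix \<omega> assume "\<omega> \<in> space M"
    then show "norm (\<zeta> \<omega> $ j) \<le> c" using c component_le_norm_cart[of "\<zeta> \<omega>" j] by fastforce
  qed
  moreover have "(\<lambda>\<omega>. \<zeta> \<omega> $ j) \<in> borel_measurable (K p q)"
    using \<zeta> measurable_compose[OF _ borel_measurable_nth, of \<zeta> "K p q" j] by (simp add: coef_def)
  ultimately show "coef p q (\<lambda>\<omega>. \<zeta> \<omega> $ j)" by (auto simp: coef_def)
qed

lemma coef_mult:
  assumes "coef p q (A :: 'a \<Rightarrow> real)" "coef p q (B :: 'a \<Rightarrow> real)"
  shows "coef p q (\<lambda>\<omega>. A \<omega> * B \<omega>)"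
proof -
  obtain c d where "\<forall>\<omega>\<in>space M. norm (A \<omega>) \<le> c" "\<forall>\<omega>\<in>space M. norm (B \<omega>) \<le> d"
    using assms by (auto simp: coef_def)
  then have "\<forall>\<omega>\<in>space M. norm (A \<omega> * B \<omega>) \<le> \<bar>c\<bar> * \<bar>d\<bar>"
    by (auto simp: abs_mult intro!: mult_mono intro: order_trans[OF _ abs_ge_self])
  then show ?thesis using assms by (auto simp: coef_def)
qed

lemma coef_integrable:
  assumes "coef p q (A :: 'a \<Rightarrow> real)" "0 \<le> p" "p \<le> q" "q \<le> T"
  shows "integrable M A"
proof -
  have "integrable M (\<lambda>\<omega>. A \<omega> * 1)" by (rule integrable_coef_mult[OF assms]) simp
  then show ?thesis by simp
qed

text \<open>V is allowed to be unbounded because for disjoint steps it will contain another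
  increment.\<close>

lemma incr_int_mean:
  assumes pq: "0 \<le> p" "p < q" "q \<le> T" and \<zeta>: "coef p q \<zeta>"
    and V: "V \<in> borel_measurable (K p q)" "integrable M V"
  shows "has_bochner_integral M (\<lambda>\<omega>. V \<omega> * incr_int p q \<zeta> \<omega>) 0"
proof -
  have "has_bochner_integral M (\<lambda>\<omega>. (V \<omega> * \<zeta> \<omega> $ j) * (X q \<omega> - X p \<omega>) $ j) ((\<integral>\<omega>. V \<omega> * \<zeta> \<omega> $ j \<partial>M) * 0)" for j
  proof (rule incr_indep_mult[OF pq, where h = "\<lambda>x. x $ j"])
    have "coef p q (\<lambda>\<omega>. \<zeta> \<omega> $ j)" using \<zeta> by (rule coef_component)
    then show "(\<lambda>\<omega>. V \<omega> * \<zeta> \<omega> $ j) \<in> borel_measurable (K p q)" "integrable M (\<lambda>\<omega>. V \<omega> * \<zeta> \<omega> $ j)"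
      using V(1) integrable_coef_mult[of p q "\<lambda>\<omega>. \<zeta> \<omega> $ j" V] pq V(2)
      by (auto simp: coef_def mult.commute)
  qed (use incr_mean[OF pq] in auto)
  then have "has_bochner_integral M (\<lambda>\<omega>. \<Sum>j\<in>UNIV. (V \<omega> * \<zeta> \<omega> $ j) * (X q \<omega> - X p \<omega>) $ j) (\<Sum>j\<in>(UNIV::'d set). 0)"
    by (intro has_bochner_integral_sum) simp
  then show ?thesis by (simp add: inner_vec_def sum_distrib_left mult.assoc)
qed

lemma incr_int_integrable:
  assumes pq: "0 \<le> p" "p < q" "q \<le> T" and \<zeta>: "coef p q \<zeta>"
  shows "integrable M (incr_int p q \<zeta>)"
proof -
  have "has_bochner_integral M (\<lambda>\<omega>. 1 * incr_int p q \<zeta> \<omega>) 0"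
    by (rule incr_int_mean[OF pq \<zeta>]) auto
  then show ?thesis by (simp add: has_bochner_integral_iff)
qed

text \<open>Of two disjoint steps, \<open>K_order\<close> names one that is known when the
  coefficient on the other is chosen; together with A it forms the known factor V of
  \<open>incr_int_mean\<close>.\<close>

lemma incr_int_disjoint:
  assumes ab: "0 \<le> a" "b \<le> T" and A: "coef a b (A :: 'a \<Rightarrow> real)"
    and pq: "a \<le> p" "p < q" "q \<le> p'" "p' < q'" "q' \<le> b" and \<zeta>: "coef p q \<zeta>" "coef p' q' \<zeta>'"
  shows "has_bochner_integral M (\<lambda>\<omega>. A \<omega> * incr_int p q \<zeta> \<omega> * incr_int p' q' \<zeta>' \<omega>) 0"
proof -
  have p0: "0 \<le> p" "q' \<le> T" "0 \<le> p'" "q \<le> T" using ab pq by auto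
  have A1: "coef p q A" "coef p' q' A" using pq ab by (auto intro: coef_mono[OF A])
  have i: "integrable M (\<lambda>\<omega>. A \<omega> * incr_int p q \<zeta> \<omega>)"
    using pq p0 by (intro integrable_coef_mult[OF A1(1)] incr_int_integrable \<zeta>) auto
  have i': "integrable M (\<lambda>\<omega>. A \<omega> * incr_int p' q' \<zeta>' \<omega>)"
    using pq p0 by (intro integrable_coef_mult[OF A1(2)] incr_int_integrable \<zeta>) auto
  show ?thesis
    using K_order[OF p0(1) pq(2,3,4) p0(2)]
  proof
    assume o: "sets (K p q) \<subseteq> sets (K p' q') \<and> (\<lambda>\<omega>. X q \<omega> - X p \<omega>) \<in> borel_measurable (K p' q')"
    then have "A \<in> borel_measurable (K p' q')" "\<zeta> \<in> borel_measurable (K p' q')"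
      using A1 \<zeta> measurable_K_mono unfolding coef_def by blast+
    then have "(\<lambda>\<omega>. A \<omega> * incr_int p q \<zeta> \<omega>) \<in> borel_measurable (K p' q')"
      using o by auto
    from incr_int_mean[OF p0(3) pq(4) p0(2) \<zeta>(2) this i] show ?thesis .
  next
    assume o: "sets (K p' q') \<subseteq> sets (K p q) \<and> (\<lambda>\<omega>. X q' \<omega> - X p' \<omega>) \<in> borel_measurable (K p q)"
    then have "A \<in> borel_measurable (K p q)" "\<zeta>' \<in> borel_measurable (K p q)"
      using A1 \<zeta> measurable_K_mono unfolding coef_def by blast+
    then have "(\<lambda>\<omega>. A \<omega> * incr_int p' q' \<zeta>' \<omega>) \<in> borel_measurable (K p q)"
      using o by auto
    from incr_int_mean[OF p0(1) pq(2) p0(4) \<zeta>(1) this i'] show ?thesis by (simp add: mult_ac)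
  qed
qed

lemma incr_int_same:
  assumes pq: "0 \<le> p" "p < q" "q \<le> T" and A: "coef p q (A :: 'a \<Rightarrow> real)" and \<zeta>: "coef p q \<zeta>" "coef p q \<zeta>'"
  shows "has_bochner_integral M (\<lambda>\<omega>. A \<omega> * incr_int p q \<zeta> \<omega> * incr_int p q \<zeta>' \<omega>)
    ((\<integral>\<omega>. A \<omega> * (\<zeta> \<omega> \<bullet> \<zeta>' \<omega>) \<partial>M) * (q - p))"
proof -
  have c: "coef p q (\<lambda>\<omega>. A \<omega> * \<zeta> \<omega> $ i * \<zeta>' \<omega> $ j)" for i j
    by (intro coef_mult A coef_component \<zeta>)
  have ci: "integrable M (\<lambda>\<omega>. A \<omega> * \<zeta> \<omega> $ i * \<zeta>' \<omega> $ j)" for i j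
    using coef_integrable[OF c] pq by auto
  have "has_bochner_integral M
      (\<lambda>\<omega>. (A \<omega> * \<zeta> \<omega> $ i * \<zeta>' \<omega> $ j) * ((X q \<omega> - X p \<omega>) $ i * (X q \<omega> - X p \<omega>) $ j))
      ((\<integral>\<omega>. A \<omega> * \<zeta> \<omega> $ i * \<zeta>' \<omega> $ j \<partial>M) * (if i = j then q - p else 0))" for i j
    by (rule incr_indep_mult[OF pq, where h = "\<lambda>x. x $ i * x $ j"])
      (use c ci incr_cov[OF pq] in \<open>auto simp: coef_def\<close>)
  then have "has_bochner_integral M
      (\<lambda>\<omega>. \<Sum>i\<in>UNIV. \<Sum>j\<in>UNIV. (A \<omega> * \<zeta> \<omega> $ i * \<zeta>' \<omega> $ j) * ((X q \<omega> - X p \<omega>) $ i * (X q \<omega> - X p \<omega>) $ j))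
      (\<Sum>i\<in>(UNIV::'d set). \<Sum>j\<in>UNIV. (\<integral>\<omega>. A \<omega> * \<zeta> \<omega> $ i * \<zeta>' \<omega> $ j \<partial>M) * (if i = j then q - p else 0))"
    by (intro has_bochner_integral_sum) simp
  moreover have "(\<Sum>i\<in>(UNIV::'d set). \<Sum>j\<in>UNIV. (\<integral>\<omega>. A \<omega> * \<zeta> \<omega> $ i * \<zeta>' \<omega> $ j \<partial>M) * (if i = j then q - p else 0))
     = (\<integral>\<omega>. A \<omega> * (\<zeta> \<omega> \<bullet> \<zeta>' \<omega>) \<partial>M) * (q - p)"
  proof -
    have "(\<Sum>i\<in>(UNIV::'d set). \<Sum>j\<in>UNIV. (\<integral>\<omega>. A \<omega> * \<zeta> \<omega> $ i * \<zeta>' \<omega> $ j \<partial>M) * (if i = j then q - p else 0))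
      = (\<Sum>i\<in>(UNIV::'d set). (\<integral>\<omega>. A \<omega> * \<zeta> \<omega> $ i * \<zeta>' \<omega> $ i \<partial>M)) * (q - p)"
      by (simp add: sum_distrib_right if_distrib[of "(*) _"] cong: if_cong)
    also have "(\<Sum>i\<in>(UNIV::'d set). (\<integral>\<omega>. A \<omega> * \<zeta> \<omega> $ i * \<zeta>' \<omega> $ i \<partial>M)) = (\<integral>\<omega>. (\<Sum>i\<in>UNIV. A \<omega> * \<zeta> \<omega> $ i * \<zeta>' \<omega> $ i) \<partial>M)"
      using ci by (simp add: Bochner_Integration.integral_sum)
    finally show ?thesis by (simp add: inner_vec_def sum_distrib_left mult.assoc)
  qed
  moreover have "(\<Sum>i\<in>UNIV. \<Sum>j\<in>UNIV. (A \<omega> * \<zeta> \<omega> $ i * \<zeta>' \<omega> $ j) * ((X q \<omega> - X p \<omega>) $ i * (X q \<omega> - X p \<omega>) $ j))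
     = A \<omega> * incr_int p q \<zeta> \<omega> * incr_int p q \<zeta>' \<omega>" for \<omega>
    by (simp add: inner_vec_def sum_product sum_distrib_left mult_ac)
  ultimately show ?thesis by simp
qed

lemma incr_int_split: "incr_int p r \<zeta> \<omega> = incr_int p q \<zeta> \<omega> + incr_int q r \<zeta> \<omega>"
  by (simp add: inner_diff_right)

text \<open>The longer step is cut where the shorter one ends; the remaining piece is disjoint from
  the shorter step and contributes nothing.\<close>

lemma incr_int_same_start:
  assumes ab: "0 \<le> a" "b \<le> T" and A: "coef a b (A :: 'a \<Rightarrow> real)"
    and pq: "a \<le> p" "p < q" "q \<le> b" "p < q'" "q' \<le> b" and \<zeta>: "coef p q \<zeta>" "coef p q' \<zeta>'"
  shows "has_bochner_integral M (\<lambda>\<omega>. A \<omega> * incr_int p q \<zeta> \<omega> * incr_int p q' \<zeta>' \<omega>)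
    ((\<integral>\<omega>. A \<omega> * (\<zeta> \<omega> \<bullet> \<zeta>' \<omega>) \<partial>M) * (min q q' - p))"
proof -
  have *: "has_bochner_integral M (\<lambda>\<omega>. A \<omega> * incr_int p q \<zeta> \<omega> * incr_int p q' \<zeta>' \<omega>)
      ((\<integral>\<omega>. A \<omega> * (\<zeta> \<omega> \<bullet> \<zeta>' \<omega>) \<partial>M) * (q - p))"
    if le: "q \<le> q'" and pq: "a \<le> p" "p < q" "q \<le> b" "p < q'" "q' \<le> b" and \<zeta>: "coef p q \<zeta>" "coef p q' \<zeta>'"
    for q q' \<zeta> \<zeta>'
  proof -
    have \<zeta>1: "coef p q \<zeta>'" using \<zeta>(2) by (rule coef_mono) (use ab pq le in auto)
    have 1: "has_bochner_integral M (\<lambda>\<omega>. A \<omega> * incr_int p q \<zeta> \<omega> * incr_int p q \<zeta>' \<omega>)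
      ((\<integral>\<omega>. A \<omega> * (\<zeta> \<omega> \<bullet> \<zeta>' \<omega>) \<partial>M) * (q - p))"
      using ab pq by (intro incr_int_same coef_mono[OF A] \<zeta> \<zeta>1) auto
    show ?thesis
    proof (cases "q = q'")
      case False
      have 2: "has_bochner_integral M (\<lambda>\<omega>. A \<omega> * incr_int p q \<zeta> \<omega> * incr_int q q' \<zeta>' \<omega>) 0"
        using ab pq le False by (intro incr_int_disjoint[OF ab A] \<zeta> coef_mono[OF \<zeta>(2)]) auto
      show ?thesis
        using has_bochner_integral_add[OF 1 2] by (simp only: incr_int_split[where p=p and q=q and r=q'] distrib_left add_0_right)
    qed (use 1 in simp)
  qed
  show ?thesis
  proof (cases "q \<le> q'")
    case True
    from *[OF this pq \<zeta>] True show ?thesis by (simp add: min_def)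
  next
    case False
    then have "q' \<le> q" by simp
    from *[OF this pq(1,4,5,2,3) \<zeta>(2,1)] False show ?thesis by (simp add: min_def mult_ac inner_commute)
  qed
qed

text \<open>\<open>max 0 (min q q' - max p p')\<close> is the length of the overlap. The step that
  begins earlier is cut where the other begins, which leaves a disjoint piece and a pair with a
  common start. Admitting arbitrary overlaps spares simple processes any common refinement.\<close>

lemma incr_int_product:
  assumes ab: "0 \<le> a" "b \<le> T" and A: "coef a b (A :: 'a \<Rightarrow> real)"
    and pq: "a \<le> p" "p < q" "q \<le> b" and pq': "a \<le> p'" "p' < q'" "q' \<le> b"
    and \<zeta>: "coef p q \<zeta>" and \<zeta>': "coef p' q' \<zeta>'"
  shows "has_bochner_integral M (\<lambda>\<omega>. A \<omega> * incr_int p q \<zeta> \<omega> * incr_int p' q' \<zeta>' \<omega>)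
    ((\<integral>\<omega>. A \<omega> * (\<zeta> \<omega> \<bullet> \<zeta>' \<omega>) \<partial>M) * max 0 (min q q' - max p p'))"
proof -
  have *: "has_bochner_integral M (\<lambda>\<omega>. A \<omega> * incr_int p q \<zeta> \<omega> * incr_int p' q' \<zeta>' \<omega>)
    ((\<integral>\<omega>. A \<omega> * (\<zeta> \<omega> \<bullet> \<zeta>' \<omega>) \<partial>M) * max 0 (min q q' - p'))"
    if le: "p \<le> p'" and pq: "a \<le> p" "p < q" "q \<le> b" and pq': "a \<le> p'" "p' < q'" "q' \<le> b"
    and \<zeta>: "coef p q \<zeta>" and \<zeta>': "coef p' q' \<zeta>'" for p q \<zeta> p' q' \<zeta>'
  proof (cases "q \<le> p'")
    case True
    then have "max 0 (min q q' - p') = 0" using pq' by auto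
    moreover have "has_bochner_integral M (\<lambda>\<omega>. A \<omega> * incr_int p q \<zeta> \<omega> * incr_int p' q' \<zeta>' \<omega>) 0"
      using True pq pq' by (intro incr_int_disjoint[OF ab A] \<zeta> \<zeta>') auto
    ultimately show ?thesis by simp
  next
    case False
    then have 1: "has_bochner_integral M (\<lambda>\<omega>. A \<omega> * incr_int p' q \<zeta> \<omega> * incr_int p' q' \<zeta>' \<omega>)
      ((\<integral>\<omega>. A \<omega> * (\<zeta> \<omega> \<bullet> \<zeta>' \<omega>) \<partial>M) * (min q q' - p'))"
      using ab pq pq' le by (intro incr_int_same_start[OF ab A] \<zeta>' coef_mono[OF \<zeta>]) auto
    have m: "max 0 (min q q' - p') = min q q' - p'" using False pq' by auto
    show ?thesis
    proof (cases "p = p'")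
      case True
      then show ?thesis using 1 m by simp
    next
      case False2: False
      have 2: "has_bochner_integral M (\<lambda>\<omega>. A \<omega> * incr_int p p' \<zeta> \<omega> * incr_int p' q' \<zeta>' \<omega>) 0"
        using ab pq pq' le False False2 by (intro incr_int_disjoint[OF ab A] \<zeta>' coef_mono[OF \<zeta>]) auto
      show ?thesis
        using has_bochner_integral_add[OF 2 1] m
        by (simp only: incr_int_split[where p=p and q=p' and r=q] distrib_left distrib_right add_0_left)
    qed
  qed
  show ?thesis
  proof (cases "p \<le> p'")
    case True
    from *[OF this pq pq' \<zeta> \<zeta>'] True show ?thesis by (simp add: max_def)
  next
    case False
    then have "p' \<le> p" by simp
    from *[OF this pq' pq \<zeta>' \<zeta>] False show ?thesis by (simp add: max_def min.commute mult_ac inner_commute)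
  qed
qed

end

section \<open>Simple processes as lists of steps\<close>

lemma sum_indicator_partition:
  fixes p :: "nat \<Rightarrow> real"
  assumes "\<And>i. i < n \<Longrightarrow> p i \<le> p (Suc i)"
  shows "p 0 \<le> p n \<and> (\<Sum>i<n. indicator {p i<..p (Suc i)} s :: real) = indicator {p 0<..p n} s"
  using assms
proof (induction n)
  case (Suc n)
  then have IH: "p 0 \<le> p n" "(\<Sum>i<n. indicator {p i<..p (Suc i)} s :: real) = indicator {p 0<..p n} s" by auto
  moreover have "p n \<le> p (Suc n)" using Suc.prems by simp
  ultimately show ?case by (auto simp: indicator_def)
qed simp

text \<open>The intervals in the list may overlap, so the difference of two simple processes is a
  mere concatenation with \<open>neg_elems\<close>.\<close>

definition sproc :: "(real \<times> real \<times> ('a \<Rightarrow> 'v::euclidean_space)) list \<Rightarrow> 'a \<times> real \<Rightarrow> 'v" where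
  "sproc es x = (\<Sum>(p, q, \<zeta>)\<leftarrow>es. indicator {p<..q} (snd x) *\<^sub>R \<zeta> (fst x))"

lemma sproc_simps [simp]:
  "sproc [] x = 0"
  "sproc ((p, q, \<zeta>) # es) x = indicator {p<..q} (snd x) *\<^sub>R \<zeta> (fst x) + sproc es x"
  "sproc (es @ fs) x = sproc es x + sproc fs x"
  by (simp_all add: sproc_def)

definition neg_elems :: "(real \<times> real \<times> ('a \<Rightarrow> 'v::euclidean_space)) list \<Rightarrow> (real \<times> real \<times> ('a \<Rightarrow> 'v)) list" where
  "neg_elems = map (\<lambda>(p, q, \<zeta>). (p, q, \<lambda>\<omega>. - \<zeta> \<omega>))"

lemma neg_elems_simps [simp]:
  "neg_elems [] = []" "neg_elems ((p, q, \<zeta>) # es) = (p, q, \<lambda>\<omega>. - \<zeta> \<omega>) # neg_elems es"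
  by (simp_all add: neg_elems_def)

lemma sproc_neg [simp]: "sproc (neg_elems es) x = - sproc es x"
  by (induction es) (auto)

text \<open>Steps that miss (a, b] are dropped rather than kept empty, since the increments are only
  controlled for p < q.\<close>

definition restr_elems :: "real \<Rightarrow> real \<Rightarrow> (real \<times> real \<times> 'b) list \<Rightarrow> (real \<times> real \<times> 'b) list" where
  "restr_elems a b es = map (\<lambda>(p, q, \<zeta>). (max a p, min b q, \<zeta>)) (filter (\<lambda>(p, q, \<zeta>). max a p < min b q) es)"

lemma restr_elems_simps [simp]:
  "restr_elems a b [] = []"
  "restr_elems a b ((p, q, \<zeta>) # es) =
    (if max a p < min b q then (max a p, min b q, \<zeta>) # restr_elems a b es else restr_elems a b es)"
  by (simp_all add: restr_elems_def)

lemma sproc_restr: "sproc (restr_elems a b es) x = indicator {a<..b} (snd x) *\<^sub>R sproc es x"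
proof (induction es)
  case (Cons e es)
  obtain p q \<zeta> where e: "e = (p, q, \<zeta>)" by (metis prod_cases3)
  have "(indicator {a<..b} s * indicator {p<..q} s :: real) =
     (if max a p < min b q then indicator {max a p<..min b q} s else 0)" for s
    by (auto simp: indicator_def)
  with Cons show ?case unfolding e
    by (auto simp: scaleR_add_right)
qed simp

context ito_noise
begin

definition sint :: "(real \<times> real \<times> ('a \<Rightarrow> real ^ 'd)) list \<Rightarrow> 'a \<Rightarrow> real" where
  "sint es \<omega> = (\<Sum>(p, q, \<zeta>)\<leftarrow>es. incr_int p q \<zeta> \<omega>)"

lemma sint_simps [simp]:
  "sint [] \<omega> = 0"
  "sint ((p, q, \<zeta>) # es) \<omega> = incr_int p q \<zeta> \<omega> + sint es \<omega>"
  "sint (es @ fs) \<omega> = sint es \<omega> + sint fs \<omega>"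
  by (simp_all add: sint_def)

lemma sint_neg [simp]: "sint (neg_elems es) \<omega> = - sint es \<omega>"
  by (induction es) auto

definition simple :: "real \<Rightarrow> real \<Rightarrow> (real \<times> real \<times> ('a \<Rightarrow> real ^ 'd)) list \<Rightarrow> bool" where
  "simple a b es \<longleftrightarrow> (\<forall>(p, q, \<zeta>)\<in>set es. a \<le> p \<and> p < q \<and> q \<le> b \<and> coef p q \<zeta>)"

lemma simple_simps [simp]:
  "simple a b []"
  "simple a b ((p, q, \<zeta>) # es) \<longleftrightarrow> (a \<le> p \<and> p < q \<and> q \<le> b \<and> coef p q \<zeta>) \<and> simple a b es"
  "simple a b (es @ fs) \<longleftrightarrow> simple a b es \<and> simple a b fs"
  by (simp_all add: simple_def ball_Un)

lemma simple_mono: "simple a b es \<Longrightarrow> a' \<le> a \<Longrightarrow> b \<le> b' \<Longrightarrow> simple a' b' es"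
  unfolding simple_def by (rule ballI, drule (1) bspec) auto

lemma simple_neg [simp]: "simple a b es \<Longrightarrow> simple a b (neg_elems es)"
  by (induction es) (auto simp: coef_def)

lemma simple_restr:
  assumes "0 \<le> a" "b \<le> T" "simple 0 T es"
  shows "simple a b (restr_elems a b es)"
  using assms(3)
proof (induction es)
  case (Cons e es)
  obtain p q \<zeta> where e: "e = (p, q, \<zeta>)" by (metis prod_cases3)
  show ?case
  proof (cases "max a p < min b q")
    case True
    have pq: "coef p q \<zeta>" "0 \<le> p" "p < q" "q \<le> T" using Cons.prems e by auto
    have "coef (max a p) (min b q) \<zeta>"
      by (rule coef_mono[OF pq(1,2)]) (use True pq in auto)
    then show ?thesis using Cons True by (simp add: e)
  qed (use Cons e in auto)
qed simp

lemma coef_const: "coef a b (\<lambda>_. c)"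
  by (auto simp: coef_def)

lemma incr_int_measurable:
  assumes "0 \<le> p" "p < q" "q \<le> T" "coef p q \<zeta>"
  shows "incr_int p q \<zeta> \<in> borel_measurable M"
  using incr_int_integrable[OF assms] by auto

lemma sint_measurable: "0 \<le> a \<Longrightarrow> b \<le> T \<Longrightarrow> simple a b es \<Longrightarrow> sint es \<in> borel_measurable M"
proof (induction es)
  case (Cons e es)
  obtain p q \<zeta> where e: "e = (p, q, \<zeta>)" by (metis prod_cases3)
  have "incr_int p q \<zeta> \<in> borel_measurable M"
    using Cons.prems e by (intro incr_int_measurable) auto
  then have "(\<lambda>\<omega>. incr_int p q \<zeta> \<omega> + sint es \<omega>) \<in> borel_measurable M"
    using Cons e by (intro borel_measurable_add) auto
  also have "(\<lambda>\<omega>. incr_int p q \<zeta> \<omega> + sint es \<omega>) = sint (e # es)" by (auto simp: e)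
  finally show ?case .
next
  case Nil
  have "sint [] = (\<lambda>_. 0)" by auto
  then show ?case by simp
qed

lemma sproc_measurable: "0 \<le> a \<Longrightarrow> b \<le> T \<Longrightarrow> simple a b es \<Longrightarrow> sproc es \<in> borel_measurable PL"
proof (induction es)
  case (Cons e es)
  obtain p q \<zeta> where e: "e = (p, q, \<zeta>)" by (metis prod_cases3)
  have [measurable]: "\<zeta> \<in> borel_measurable M"
    using Cons.prems e by (intro measurable_K[of \<zeta> p q]) (auto simp: coef_def)
  have [measurable]: "sproc es \<in> borel_measurable PL" using Cons by (auto simp: e)
  have "(\<lambda>x. indicator {p<..q} (snd x) *\<^sub>R \<zeta> (fst x) + sproc es x) \<in> borel_measurable PL"
    by measurable
  also have "(\<lambda>x. indicator {p<..q} (snd x) *\<^sub>R \<zeta> (fst x) + sproc es x) = sproc (e # es)" by (auto simp: e)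
  finally show ?case .
next
  case Nil
  have "sproc [] = (\<lambda>_. 0 :: real^'d)" by auto
  then show ?case by simp
qed

lemma sint_mean:
  assumes ab: "0 \<le> a" "a \<le> b" "b \<le> T" and A: "coef a b (A :: 'a \<Rightarrow> real)" and es: "simple a b es"
  shows "has_bochner_integral M (\<lambda>\<omega>. A \<omega> * sint es \<omega>) 0"
  using es
proof (induction es)
  case (Cons e es)
  obtain p q \<zeta> where e: "e = (p, q, \<zeta>)" by (metis prod_cases3)
  have A': "coef p q A" using Cons.prems ab by (intro coef_mono[OF A]) (auto simp: e)
  have "has_bochner_integral M (\<lambda>\<omega>. A \<omega> * incr_int p q \<zeta> \<omega>) 0"
    using Cons.prems ab A' coef_integrable[OF A']
    by (intro incr_int_mean) (auto simp: e coef_def)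
  from has_bochner_integral_add[OF this Cons.IH] Cons.prems show ?case
    by (simp add: e distrib_left)
qed auto

lemma elem_product_PL:
  fixes \<zeta> \<zeta>' :: "'a \<Rightarrow> real ^ 'd"
  assumes "integrable M (\<lambda>\<omega>. A \<omega> * (\<zeta> \<omega> \<bullet> \<zeta>' \<omega>))"
  shows "has_bochner_integral PL
    (\<lambda>x. A (fst x) * ((indicator {p<..q} (snd x) *\<^sub>R \<zeta> (fst x)) \<bullet> (indicator {p'<..q'} (snd x) *\<^sub>R \<zeta>' (fst x))))
    ((\<integral>\<omega>. A \<omega> * (\<zeta> \<omega> \<bullet> \<zeta>' \<omega>) \<partial>M) * max 0 (min q q' - max p p'))"
proof -
  have "has_bochner_integral PL (\<lambda>x. (A (fst x) * (\<zeta> (fst x) \<bullet> \<zeta>' (fst x))) * indicator {max p p'<..min q q'} (snd x))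
    ((\<integral>\<omega>. A \<omega> * (\<zeta> \<omega> \<bullet> \<zeta>' \<omega>) \<partial>M) * (\<integral>s. indicator {max p p'<..min q q'} s \<partial>lborel))"
    by (rule P.has_bochner_integral_pair_mult[OF assms])
      (cases "max p p' \<le> min q q'", auto intro!: integrable_real_indicator)
  moreover have "(\<integral>s. indicator {max p p'<..min q q'} s \<partial>lborel) = max 0 (min q q' - max p p')"
    by (auto simp: max_def)
  moreover have "A w * ((indicator {p<..q} s *\<^sub>R \<zeta> w) \<bullet> (indicator {p'<..q'} s *\<^sub>R \<zeta>' w))
      = (A w * (\<zeta> w \<bullet> \<zeta>' w)) * indicator {max p p'<..min q q'} s" for w s
    by (auto simp: indicator_def)
  ultimately show ?thesis by (simp only:)
qed

text \<open>Both expressions are bilinear in the two lists, so a double induction reduces the claim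
  to a pair of steps, where the overlap length appears on either side. The common value v stays
  existential, which avoids a double sum and carries integrability along.\<close>

lemma sint_isometry_aux:
  assumes ab: "0 \<le> a" "a \<le> b" "b \<le> T" and A: "coef a b (A :: 'a \<Rightarrow> real)" and es: "simple a b es" "simple a b fs"
  shows "\<exists>v. has_bochner_integral M (\<lambda>\<omega>. A \<omega> * sint es \<omega> * sint fs \<omega>) v \<and>
    has_bochner_integral PL (\<lambda>x. A (fst x) * (sproc es x \<bullet> sproc fs x)) v"
proof -
  have 1: "\<exists>v. has_bochner_integral M (\<lambda>\<omega>. A \<omega> * incr_int p q \<zeta> \<omega> * sint fs \<omega>) v \<and>
    has_bochner_integral PL (\<lambda>x. A (fst x) * ((indicator {p<..q} (snd x) *\<^sub>R \<zeta> (fst x)) \<bullet> sproc fs x)) v"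
    if \<zeta>: "a \<le> p" "p < q" "q \<le> b" "coef p q \<zeta>" and "simple a b fs" for p q \<zeta> fs
    using that(5)
  proof (induction fs)
    case (Cons e fs)
    obtain p' q' \<zeta>' where e: "e = (p', q', \<zeta>')" by (metis prod_cases3)
    have \<zeta>': "a \<le> p'" "p' < q'" "q' \<le> b" "coef p' q' \<zeta>'" using Cons.prems by (auto simp: e)
    obtain v where v: "has_bochner_integral M (\<lambda>\<omega>. A \<omega> * incr_int p q \<zeta> \<omega> * sint fs \<omega>) v"
      "has_bochner_integral PL (\<lambda>x. A (fst x) * ((indicator {p<..q} (snd x) *\<^sub>R \<zeta> (fst x)) \<bullet> sproc fs x)) v"
      using Cons by (auto simp: e)
    have m: "\<zeta> \<in> borel_measurable M" "\<zeta>' \<in> borel_measurable M" "A \<in> borel_measurable M"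
      using \<zeta> \<zeta>' A ab by (auto simp: coef_def intro: measurable_K)
    have "integrable M (\<lambda>\<omega>. A \<omega> * (\<zeta> \<omega> \<bullet> \<zeta>' \<omega>))"
    proof (rule integrable_coef_mult[OF A ab])
      obtain c d where cd: "\<forall>\<omega>\<in>space M. norm (\<zeta> \<omega>) \<le> c" "\<forall>\<omega>\<in>space M. norm (\<zeta>' \<omega>) \<le> d"
        using \<zeta> \<zeta>' by (auto simp: coef_def)
      show "integrable M (\<lambda>\<omega>. \<zeta> \<omega> \<bullet> \<zeta>' \<omega>)"
      proof (rule integrable_const_bound[where B="c * d"], rule AE_I2)
        fix \<omega> assume \<omega>: "\<omega> \<in> space M"
        have "norm (\<zeta> \<omega> \<bullet> \<zeta>' \<omega>) \<le> norm (\<zeta> \<omega>) * norm (\<zeta>' \<omega>)"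
          using Cauchy_Schwarz_ineq2 by simp
        also have "\<dots> \<le> c * d" using cd \<omega> by (intro mult_mono) (auto intro: order_trans[OF norm_ge_zero])
        finally show "norm (\<zeta> \<omega> \<bullet> \<zeta>' \<omega>) \<le> c * d" .
      qed (use m in auto)
    qed
    note e1 = incr_int_product[OF ab(1,3) A \<zeta>(1-3) \<zeta>'(1-3) \<zeta>(4) \<zeta>'(4)]
      and e2 = elem_product_PL[OF this, of p q p' q']
    show ?case
      using has_bochner_integral_add[OF e1 v(1)] has_bochner_integral_add[OF e2 v(2)]
      unfolding e sint_simps sproc_simps distrib_left inner_add_right by blast
  next
    case Nil
    show ?case by (intro exI[of _ 0]) auto
  qed
  show ?thesis using es(1)
  proof (induction es)
    case (Cons e es)
    obtain p q \<zeta> where e: "e = (p, q, \<zeta>)" by (metis prod_cases3)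
    have \<zeta>: "a \<le> p" "p < q" "q \<le> b" "coef p q \<zeta>" using Cons.prems by (auto simp: e)
    obtain v where v: "has_bochner_integral M (\<lambda>\<omega>. A \<omega> * sint es \<omega> * sint fs \<omega>) v"
      "has_bochner_integral PL (\<lambda>x. A (fst x) * (sproc es x \<bullet> sproc fs x)) v"
      using Cons by (auto simp: e)
    obtain u where u: "has_bochner_integral M (\<lambda>\<omega>. A \<omega> * incr_int p q \<zeta> \<omega> * sint fs \<omega>) u"
      "has_bochner_integral PL (\<lambda>x. A (fst x) * ((indicator {p<..q} (snd x) *\<^sub>R \<zeta> (fst x)) \<bullet> sproc fs x)) u"
      using 1[OF \<zeta> es(2)] by blast
    show ?case
      using has_bochner_integral_add[OF u(1) v(1)] has_bochner_integral_add[OF u(2) v(2)]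
      unfolding e sint_simps sproc_simps distrib_left distrib_right inner_add_left by blast
  next
    case Nil
    show ?case by (intro exI[of _ 0]) auto
  qed
qed

text \<open>With A known on the whole of (a, b], this is the conditional isometry in integrated
  form.\<close>

lemma sint_isometry:
  assumes ab: "0 \<le> a" "a \<le> b" "b \<le> T" and A: "coef a b (A :: 'a \<Rightarrow> real)" and es: "simple a b es"
  shows "(\<integral>\<omega>. A \<omega> * (sint es \<omega>)\<^sup>2 \<partial>M) = (\<integral>x. A (fst x) * (norm (sproc es x))\<^sup>2 \<partial>PL)"
  using sint_isometry_aux[OF ab A es es]
  by (auto simp: has_bochner_integral_iff power2_norm_eq_inner power2_eq_square[of "sint es _"] mult.assoc)

lemma sq_int_simple:
  assumes ab: "0 \<le> a" "a \<le> b" "b \<le> T" and es: "simple a b es"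
  shows "sq_int M (sint es)" "sq_int PL (sproc es)"
proof -
  have "integrable M (\<lambda>\<omega>. 1 * sint es \<omega> * sint es \<omega>) \<and> integrable PL (\<lambda>x. 1 * (sproc es x \<bullet> sproc es x))"
    using sint_isometry_aux[OF ab coef_const[of _ _ 1] es es] by (auto simp: has_bochner_integral_iff)
  then show "sq_int M (sint es)" "sq_int PL (sproc es)"
    using sint_measurable[OF ab(1,3) es] sproc_measurable[OF ab(1,3) es]
    by (auto simp: sq_int_def power2_norm_eq_inner power2_eq_square[of "sint es _"])
qed

section \<open>Third absolute moments of simple integrals\<close>

lemma incr_int_cube:
  assumes pq: "0 \<le> p" "p < q" "q \<le> T" and \<zeta>: "\<zeta> \<in> borel_measurable M" "\<forall>\<omega>\<in>space M. norm (\<zeta> \<omega>) \<le> c"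
  shows "integrable M (\<lambda>\<omega>. \<bar>incr_int p q \<zeta> \<omega>\<bar> ^ 3)"
    "(\<integral>\<omega>. \<bar>incr_int p q \<zeta> \<omega>\<bar> ^ 3 \<partial>M) \<le> 2 * \<bar>c\<bar> ^ 3 * real CARD('d) ^ 4 * sqrt (q - p) ^ 3"
proof -
  define S where "S \<omega> = \<bar>c\<bar> ^ 3 * real CARD('d) ^ 3 * (\<Sum>j\<in>UNIV. \<bar>(X q \<omega> - X p \<omega>) $ j\<bar> ^ 3)" for \<omega>
  have le: "\<bar>incr_int p q \<zeta> \<omega>\<bar> ^ 3 \<le> S \<omega>" if \<omega>: "\<omega> \<in> space M" for \<omega>
  proof -
    define x where "x = X q \<omega> - X p \<omega>"
    \<comment> \<open>For the largest coordinate m in modulus, \<open>norm x\<close> is at most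
      \<open>CARD('d) * m\<close>, and \<open>m ^ 3\<close> is at most the sum of the cubed
      coordinates. This produces the third power of the dimension; summing the coordinate moments
      produces the fourth.\<close>
    define m where "m = (MAX j. \<bar>x $ j\<bar>)"
    have m: "\<bar>x $ j\<bar> \<le> m" for j by (auto simp: m_def)
    have "m \<in> range (\<lambda>j. \<bar>x $ j\<bar>)" unfolding m_def by (rule Max_in) auto
    then obtain j0 where j0: "m = \<bar>x $ j0\<bar>" by auto
    have "\<bar>incr_int p q \<zeta> \<omega>\<bar> \<le> norm (\<zeta> \<omega>) * norm x"
      unfolding x_def by (rule Cauchy_Schwarz_ineq2)
    also have "\<dots> \<le> \<bar>c\<bar> * norm x" using \<zeta>(2) \<omega> by (intro mult_right_mono) fastforce+
    also have "norm x \<le> (\<Sum>j\<in>UNIV. \<bar>x $ j\<bar>)" by (rule norm_le_l1_cart)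
    also have "(\<Sum>j\<in>UNIV. \<bar>x $ j\<bar>) \<le> (\<Sum>j\<in>(UNIV::'d set). m)" by (intro sum_mono m)
    finally have "\<bar>incr_int p q \<zeta> \<omega>\<bar> \<le> \<bar>c\<bar> * (real CARD('d) * m)" by (simp add: mult_left_mono)
    then have "\<bar>incr_int p q \<zeta> \<omega>\<bar> ^ 3 \<le> (\<bar>c\<bar> * (real CARD('d) * m)) ^ 3" by (intro power_mono) auto
    also have "\<dots> = \<bar>c\<bar> ^ 3 * real CARD('d) ^ 3 * m ^ 3" by (simp add: power_mult_distrib)
    also have "m ^ 3 \<le> (\<Sum>j\<in>UNIV. \<bar>x $ j\<bar> ^ 3)"
      unfolding j0 by (rule member_le_sum[of j0 UNIV "\<lambda>j. \<bar>x $ j\<bar> ^ 3"]) auto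
    finally show ?thesis by (simp add: S_def x_def mult_left_mono)
  qed
  have iS: "integrable M S"
    unfolding S_def using incr_cube(1)[OF pq] by auto
  have m: "(\<lambda>\<omega>. \<bar>incr_int p q \<zeta> \<omega>\<bar> ^ 3) \<in> borel_measurable M"
    using \<zeta>(1) incr_measurable[of p q] pq by auto
  show i: "integrable M (\<lambda>\<omega>. \<bar>incr_int p q \<zeta> \<omega>\<bar> ^ 3)"
  proof (rule Bochner_Integration.integrable_bound[OF iS m], rule AE_I2)
    fix \<omega> assume "\<omega> \<in> space M"
    from le[OF this] show "norm (\<bar>incr_int p q \<zeta> \<omega>\<bar> ^ 3) \<le> norm (S \<omega>)" by simp
  qed
  have "(\<integral>\<omega>. \<bar>incr_int p q \<zeta> \<omega>\<bar> ^ 3 \<partial>M) \<le> (\<integral>\<omega>. S \<omega> \<partial>M)"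
    by (rule integral_mono[OF i iS le])
  also have "\<dots> = \<bar>c\<bar> ^ 3 * real CARD('d) ^ 3 * (\<Sum>j\<in>UNIV. (\<integral>\<omega>. \<bar>(X q \<omega> - X p \<omega>) $ j\<bar> ^ 3 \<partial>M))"
    unfolding S_def using incr_cube(1)[OF pq] by (simp add: Bochner_Integration.integral_sum)
  also have "\<dots> \<le> \<bar>c\<bar> ^ 3 * real CARD('d) ^ 3 * (\<Sum>j\<in>(UNIV::'d set). 2 * sqrt (q - p) ^ 3)"
    using incr_cube(2)[OF pq] by (intro mult_left_mono sum_mono) auto
  also have "\<dots> = 2 * \<bar>c\<bar> ^ 3 * real CARD('d) ^ 4 * sqrt (q - p) ^ 3"
    by (simp add: eval_nat_numeral)
  finally show "(\<integral>\<omega>. \<bar>incr_int p q \<zeta> \<omega>\<bar> ^ 3 \<partial>M) \<le> 2 * \<bar>c\<bar> ^ 3 * real CARD('d) ^ 4 * sqrt (q - p) ^ 3" .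
qed

lemma abs_cube_add: "\<bar>x + y\<bar> ^ 3 \<le> 8 * \<bar>x\<bar> ^ 3 + 8 * \<bar>y :: real\<bar> ^ 3"
proof -
  have "\<bar>x + y\<bar> ^ 3 \<le> (2 * max \<bar>x\<bar> \<bar>y\<bar>) ^ 3" by (intro power_mono) auto
  also have "\<dots> \<le> 8 * \<bar>x\<bar> ^ 3 + 8 * \<bar>y\<bar> ^ 3" by (auto simp: power_mult_distrib max_def)
  finally show ?thesis .
qed

text \<open>C depends on the list but not on a and b. The rate (b - a)^(3/2) beats the number of
  cells: over n equal cells the total is of order n^(-1/2).\<close>

lemma sint_restr_cube:
  assumes "simple 0 T es"
  shows "\<exists>C\<ge>0. \<forall>a b. 0 \<le> a \<and> a < b \<and> b \<le> T \<longrightarrow> integrable M (\<lambda>\<omega>. \<bar>sint (restr_elems a b es) \<omega>\<bar> ^ 3) \<and>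
    (\<integral>\<omega>. \<bar>sint (restr_elems a b es) \<omega>\<bar> ^ 3 \<partial>M) \<le> C * sqrt (b - a) ^ 3"
  using assms
proof (induction es)
  case (Cons e es)
  obtain p q \<zeta> where e: "e = (p, q, \<zeta>)" by (metis prod_cases3)
  obtain C where C: "C \<ge> 0" "\<And>a b. 0 \<le> a \<Longrightarrow> a < b \<Longrightarrow> b \<le> T \<Longrightarrow> integrable M (\<lambda>\<omega>. \<bar>sint (restr_elems a b es) \<omega>\<bar> ^ 3)"
    "\<And>a b. 0 \<le> a \<Longrightarrow> a < b \<Longrightarrow> b \<le> T \<Longrightarrow> (\<integral>\<omega>. \<bar>sint (restr_elems a b es) \<omega>\<bar> ^ 3 \<partial>M) \<le> C * sqrt (b - a) ^ 3"
    using Cons by (auto simp: e)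
  have pq: "0 \<le> p" "p < q" "q \<le> T" "coef p q \<zeta>" using Cons.prems by (auto simp: e)
  then obtain c where c: "\<forall>\<omega>\<in>space M. norm (\<zeta> \<omega>) \<le> c" and m: "\<zeta> \<in> borel_measurable M"
    unfolding coef_def by (meson less_imp_le measurable_K)
  define D where "D = 2 * \<bar>c\<bar> ^ 3 * real CARD('d) ^ 4"
  have "integrable M (\<lambda>\<omega>. \<bar>sint (restr_elems a b (e # es)) \<omega>\<bar> ^ 3) \<and>
    (\<integral>\<omega>. \<bar>sint (restr_elems a b (e # es)) \<omega>\<bar> ^ 3 \<partial>M) \<le> (8 * D + 8 * C) * sqrt (b - a) ^ 3"
    if ab: "0 \<le> a" "a < b" "b \<le> T" for a b
  proof (cases "max a p < min b q")
    case True
    define I where "I = incr_int (max a p) (min b q) \<zeta>"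
    define J where "J = sint (restr_elems a b es)"
    have eq: "sint (restr_elems a b (e # es)) \<omega> = I \<omega> + J \<omega>" for \<omega>
      using True by (simp add: e I_def J_def)
    have "0 \<le> max a p" "min b q \<le> T" using ab by auto
    note ic = incr_int_cube[OF this(1) True this(2) m c]
    have "sqrt (min b q - max a p) ^ 3 \<le> sqrt (b - a) ^ 3" using True by (intro power_mono) auto
    then have "D * sqrt (min b q - max a p) ^ 3 \<le> D * sqrt (b - a) ^ 3"
      by (intro mult_left_mono) (auto simp: D_def)
    then have I: "integrable M (\<lambda>\<omega>. \<bar>I \<omega>\<bar> ^ 3)" "(\<integral>\<omega>. \<bar>I \<omega>\<bar> ^ 3 \<partial>M) \<le> D * sqrt (b - a) ^ 3"
      using ic by (auto simp: I_def D_def)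
    have J: "integrable M (\<lambda>\<omega>. \<bar>J \<omega>\<bar> ^ 3)" "(\<integral>\<omega>. \<bar>J \<omega>\<bar> ^ 3 \<partial>M) \<le> C * sqrt (b - a) ^ 3"
      using C ab by (auto simp: J_def)
    have m': "(\<lambda>\<omega>. \<bar>I \<omega> + J \<omega>\<bar> ^ 3) \<in> borel_measurable M"
    proof -
      have "sint (restr_elems a b (e # es)) \<in> borel_measurable M"
        using sint_measurable[OF ab(1,3) simple_restr[OF ab(1,3) Cons.prems]] .
      also have "sint (restr_elems a b (e # es)) = (\<lambda>\<omega>. I \<omega> + J \<omega>)" by (rule ext) (rule eq)
      finally show ?thesis by simp
    qed
    have i: "integrable M (\<lambda>\<omega>. 8 * \<bar>I \<omega>\<bar> ^ 3 + 8 * \<bar>J \<omega>\<bar> ^ 3)" using I J by simp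
    have i': "integrable M (\<lambda>\<omega>. \<bar>I \<omega> + J \<omega>\<bar> ^ 3)"
      by (rule Bochner_Integration.integrable_bound[OF i m']) (use abs_cube_add in auto)
    have "(\<integral>\<omega>. \<bar>I \<omega> + J \<omega>\<bar> ^ 3 \<partial>M) \<le> (\<integral>\<omega>. 8 * \<bar>I \<omega>\<bar> ^ 3 + 8 * \<bar>J \<omega>\<bar> ^ 3 \<partial>M)"
      by (rule integral_mono[OF i' i abs_cube_add])
    also have "\<dots> \<le> (8 * D + 8 * C) * sqrt (b - a) ^ 3"
      using I J by (simp add: distrib_right)
    finally show ?thesis using i' by (simp add: eq)
  next
    case False
    have "C * sqrt (b - a) ^ 3 \<le> (8 * D + 8 * C) * sqrt (b - a) ^ 3"
      using C(1) ab by (intro mult_right_mono) (auto simp: D_def)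
    then show ?thesis using C(2,3)[OF ab] False by (auto simp: e)
  qed
  moreover have "0 \<le> 8 * D + 8 * C" using C(1) by (simp add: D_def)
  ultimately show ?case by blast
next
  case Nil
  show ?case by (intro exI[of _ 0]) auto
qed

end

section \<open>Stochastic integrals as mean square limits\<close>

text \<open>There are \<open>Suc n\<close> cells, so every n, including 0, gives a genuine
  partition.\<close>

definition grid :: "real \<Rightarrow> real \<Rightarrow> nat \<Rightarrow> nat \<Rightarrow> real" where
  "grid t T n i = t + real i * (T - t) / real (Suc n)"

lemma grid_simps:
  assumes "t < T"
  shows "grid t T n 0 = t" "grid t T n (Suc n) = T"
    "grid t T n (Suc i) - grid t T n i = (T - t) / real (Suc n)"
    "grid t T n i < grid t T n (Suc i)"
    "t \<le> grid t T n i" "i \<le> Suc n \<Longrightarrow> grid t T n i \<le> T"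
proof -
  show "grid t T n 0 = t" "grid t T n (Suc n) = T" by (simp_all add: grid_def)
  show step: "grid t T n (Suc i) - grid t T n i = (T - t) / real (Suc n)"
    by (simp add: grid_def add_divide_distrib distrib_right)
  have "0 < (T - t) / real (Suc n)" using assms by simp
  then show "grid t T n i < grid t T n (Suc i)" using step by linarith
  show "t \<le> grid t T n i" using assms by (simp add: grid_def)
  assume "i \<le> Suc n"
  then have "real i * (T - t) \<le> real (Suc n) * (T - t)" using assms by (intro mult_right_mono) auto
  then have "real i * (T - t) / real (Suc n) \<le> T - t"
    by (subst pos_divide_le_eq) (simp_all only: of_nat_0_less_iff zero_less_Suc mult.commute)
  then show "grid t T n i \<le> T" by (simp add: grid_def)
qed

context ito_noise
begin

text \<open>No interval is attached: the integral over (a, b] is that of the process multiplied by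
  an indicator, and additivity over intervals becomes linearity.\<close>

definition ito :: "('a \<times> real \<Rightarrow> real ^ 'd) \<Rightarrow> ('a \<Rightarrow> real) \<Rightarrow> bool" where
  "ito \<Phi> J \<longleftrightarrow> sq_int PL \<Phi> \<and> sq_int M J \<and> (\<exists>es. (\<forall>k. simple 0 T (es k)) \<and>
     (\<lambda>k. \<integral>x. (norm (sproc (es k) x - \<Phi> x))\<^sup>2 \<partial>PL) \<longlonglongrightarrow> 0 \<and>
     (\<lambda>k::nat. \<integral>\<omega>. (norm (sint (es k) \<omega> - J \<omega>))\<^sup>2 \<partial>M) \<longlonglongrightarrow> 0)"

lemma ito_sq_int: "ito \<Phi> J \<Longrightarrow> sq_int PL \<Phi>" "ito \<Phi> J \<Longrightarrow> sq_int M J"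
  by (auto simp: ito_def)

lemma ito_simple:
  assumes "0 \<le> T" "simple 0 T es"
  shows "ito (sproc es) (sint es)"
  unfolding ito_def using assms
  by (intro conjI sq_int_simple[of 0 T] exI[of _ "\<lambda>_. es"]) auto

lemma ito_diff:
  assumes T: "0 \<le> T" and 1: "ito \<Phi> J" and 2: "ito \<Psi> L"
  shows "ito (\<lambda>x. \<Phi> x - \<Psi> x) (\<lambda>\<omega>. J \<omega> - L \<omega>)"
proof -
  note i = ito_sq_int[OF 1] ito_sq_int[OF 2]
  obtain es where es: "\<And>k. simple 0 T (es k)"
    "(\<lambda>k. \<integral>x. (norm (sproc (es k) x - \<Phi> x))\<^sup>2 \<partial>PL) \<longlonglongrightarrow> 0"
    "(\<lambda>k::nat. \<integral>\<omega>. (norm (sint (es k) \<omega> - J \<omega>))\<^sup>2 \<partial>M) \<longlonglongrightarrow> 0"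
    using 1 by (auto simp: ito_def)
  obtain fs where fs: "\<And>k. simple 0 T (fs k)"
    "(\<lambda>k. \<integral>x. (norm (sproc (fs k) x - \<Psi> x))\<^sup>2 \<partial>PL) \<longlonglongrightarrow> 0"
    "(\<lambda>k::nat. \<integral>\<omega>. (norm (sint (fs k) \<omega> - L \<omega>))\<^sup>2 \<partial>M) \<longlonglongrightarrow> 0"
    using 2 by (auto simp: ito_def)
  note s = sq_int_simple[OF order_refl T order_refl]
  show ?thesis unfolding ito_def
  proof (intro conjI exI[of _ "\<lambda>k. es k @ neg_elems (fs k)"] allI)
    show "(\<lambda>k. \<integral>x. (norm (sproc (es k @ neg_elems (fs k)) x - (\<Phi> x - \<Psi> x)))\<^sup>2 \<partial>PL) \<longlonglongrightarrow> 0"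
      using sq_int_tendsto_diff[OF i(1) s(2)[OF es(1)] es(2) i(3) s(2)[OF fs(1)] fs(2)] by simp
    show "(\<lambda>k. \<integral>\<omega>. (norm (sint (es k @ neg_elems (fs k)) \<omega> - (J \<omega> - L \<omega>)))\<^sup>2 \<partial>M) \<longlonglongrightarrow> 0"
      using sq_int_tendsto_diff[OF i(2) s(1)[OF es(1)] es(3) i(4) s(1)[OF fs(1)] fs(3)] by simp
  qed (use es fs i in \<open>auto intro: sq_int_diff\<close>)
qed

text \<open>Approximants of a process that lives on (a, b] may still charge the rest of [0, T].
  Cutting them down to (a, b] removes a part that sits where \<Phi> vanishes; its norm is therefore
  at most the approximation error, and by the isometry so is that of its integral.\<close>

lemma ito_localize:
  assumes ab: "0 \<le> a" "a < b" "b \<le> T" and ito: "ito \<Phi> J"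
    and supp: "\<And>x. snd x \<notin> {a<..b} \<Longrightarrow> \<Phi> x = 0"
  obtains fs where "\<And>k. simple a b (fs k)"
    "(\<lambda>k. \<integral>x. (norm (sproc (fs k) x - \<Phi> x))\<^sup>2 \<partial>PL) \<longlonglongrightarrow> 0"
    "(\<lambda>k::nat. \<integral>\<omega>. (norm (sint (fs k) \<omega> - J \<omega>))\<^sup>2 \<partial>M) \<longlonglongrightarrow> 0"
proof -
  have T: "0 \<le> T" using ab by simp
  note i = ito_sq_int[OF ito]
  obtain es where es: "\<And>k. simple 0 T (es k)"
    "(\<lambda>k. \<integral>x. (norm (sproc (es k) x - \<Phi> x))\<^sup>2 \<partial>PL) \<longlonglongrightarrow> 0"
    "(\<lambda>k::nat. \<integral>\<omega>. (norm (sint (es k) \<omega> - J \<omega>))\<^sup>2 \<partial>M) \<longlonglongrightarrow> 0"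
    using ito by (auto simp: ito_def)
  define fs where "fs k = restr_elems a b (es k)" for k
  have fs: "simple a b (fs k)" for k
    unfolding fs_def using ab es by (intro simple_restr) auto
  have fs0: "simple 0 T (fs k)" for k
    by (rule simple_mono[OF fs]) (use ab in auto)
  note s = sq_int_simple[OF order_refl T order_refl]
  have 1: "(\<integral>x. (norm (sproc (fs k) x - \<Phi> x))\<^sup>2 \<partial>PL) \<le> (\<integral>x. (norm (sproc (es k) x - \<Phi> x))\<^sup>2 \<partial>PL)" for k
  proof (rule integral_mono)
    show "integrable PL (\<lambda>x. (norm (sproc (fs k) x - \<Phi> x))\<^sup>2)"
      "integrable PL (\<lambda>x. (norm (sproc (es k) x - \<Phi> x))\<^sup>2)"
      using s(2)[OF fs0] s(2)[OF es(1)] i by (auto intro!: sq_int_integrable sq_int_diff)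
    fix x
    have eq: "sproc (fs k) x - \<Phi> x = indicator {a<..b} (snd x) *\<^sub>R (sproc (es k) x - \<Phi> x)"
      using supp[of x] by (cases "snd x \<in> {a<..b}") (simp_all add: fs_def sproc_restr)
    show "(norm (sproc (fs k) x - \<Phi> x))\<^sup>2 \<le> (norm (sproc (es k) x - \<Phi> x))\<^sup>2"
      unfolding eq by (cases "snd x \<in> {a<..b}") simp_all
  qed
  have 2: "(\<integral>\<omega>. (sint (es k) \<omega> - sint (fs k) \<omega>)\<^sup>2 \<partial>M) \<le> (\<integral>x. (norm (sproc (es k) x - \<Phi> x))\<^sup>2 \<partial>PL)" for k
  proof -
    let ?d = "es k @ neg_elems (fs k)"
    have d: "simple 0 T ?d" using es(1) fs0 by simp
    have "(\<integral>\<omega>. (sint (es k) \<omega> - sint (fs k) \<omega>)\<^sup>2 \<partial>M) = (\<integral>\<omega>. 1 * (sint ?d \<omega>)\<^sup>2 \<partial>M)" by simp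
    also have "\<dots> = (\<integral>x. 1 * (norm (sproc ?d x))\<^sup>2 \<partial>PL)"
      by (rule sint_isometry[OF order_refl T order_refl coef_const d])
    also have "\<dots> \<le> (\<integral>x. (norm (sproc (es k) x - \<Phi> x))\<^sup>2 \<partial>PL)"
    proof (rule integral_mono)
      show "integrable PL (\<lambda>x. 1 * (norm (sproc ?d x))\<^sup>2)"
        using sq_int_integrable[OF s(2)[OF d]] by (simp only: mult_1)
      show "integrable PL (\<lambda>x. (norm (sproc (es k) x - \<Phi> x))\<^sup>2)"
        using s(2)[OF es(1)] i by (auto intro!: sq_int_integrable sq_int_diff)
      fix x
      show "1 * (norm (sproc ?d x))\<^sup>2 \<le> (norm (sproc (es k) x - \<Phi> x))\<^sup>2"
        using supp[of x] by (cases "snd x \<in> {a<..b}") (auto simp: fs_def sproc_restr)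
    qed
    finally show ?thesis .
  qed
  show thesis
  proof (rule that[of fs, OF fs])
    show "(\<lambda>k. \<integral>x. (norm (sproc (fs k) x - \<Phi> x))\<^sup>2 \<partial>PL) \<longlonglongrightarrow> 0"
      by (rule tendsto_sandwich[OF _ _ tendsto_const es(2)]) (use 1 in auto)
    have 3: "(\<integral>\<omega>. (norm (sint (fs k) \<omega> - J \<omega>))\<^sup>2 \<partial>M)
      \<le> 2 * (\<integral>\<omega>. (norm (sint (es k) \<omega> - J \<omega>))\<^sup>2 \<partial>M) + 2 * (\<integral>x. (norm (sproc (es k) x - \<Phi> x))\<^sup>2 \<partial>PL)" for k
    proof -
      have "(\<integral>\<omega>. (norm (sint (fs k) \<omega> - J \<omega>))\<^sup>2 \<partial>M)
        = (\<integral>\<omega>. (norm ((sint (es k) \<omega> - J \<omega>) + (sint (fs k) \<omega> - sint (es k) \<omega>)))\<^sup>2 \<partial>M)" by simp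
      also have "\<dots> \<le> 2 * (\<integral>\<omega>. (norm (sint (es k) \<omega> - J \<omega>))\<^sup>2 \<partial>M) + 2 * (\<integral>\<omega>. (norm (sint (fs k) \<omega> - sint (es k) \<omega>))\<^sup>2 \<partial>M)"
        using s(1)[OF fs0] s(1)[OF es(1)] i by (intro sq_int_square_add sq_int_diff) auto
      finally show ?thesis using 2[of k] by (simp add: power2_commute[of "sint (fs k) _"])
    qed
    show "(\<lambda>k::nat. \<integral>\<omega>. (norm (sint (fs k) \<omega> - J \<omega>))\<^sup>2 \<partial>M) \<longlonglongrightarrow> 0"
    proof (rule tendsto_sandwich[OF _ _ tendsto_const])
      show "(\<lambda>k. 2 * (\<integral>\<omega>. (norm (sint (es k) \<omega> - J \<omega>))\<^sup>2 \<partial>M) + 2 * (\<integral>x. (norm (sproc (es k) x - \<Phi> x))\<^sup>2 \<partial>PL)) \<longlonglongrightarrow> 0"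
        using tendsto_add[OF tendsto_mult_left[OF es(3), of 2] tendsto_mult_left[OF es(2), of 2]] by simp
    qed (use 3 in auto)
  qed
qed

section \<open>Weighted mean and isometry of the limit integral\<close>

lemma coef_bound: "coef a b A \<Longrightarrow> \<exists>c. \<forall>\<omega>\<in>space M. \<bar>A \<omega> :: real\<bar> \<le> c"
  by (auto simp: coef_def)

text \<open>The weight is known on (a, b] only, so the weighted identities for simple processes
  apply to approximants confined to (a, b]; \<open>ito_localize\<close> supplies these.\<close>

lemma ito_weighted:
  assumes ab: "0 \<le> a" "a < b" "b \<le> T" and ito: "ito \<Phi> J"
    and supp: "\<And>x. snd x \<notin> {a<..b} \<Longrightarrow> \<Phi> x = 0" and A: "coef a b (A :: 'a \<Rightarrow> real)"
  shows "(\<integral>\<omega>. A \<omega> * J \<omega> \<partial>M) = 0"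
    "(\<integral>\<omega>. A \<omega> * (J \<omega>)\<^sup>2 \<partial>M) = (\<integral>x. A (fst x) * (norm (\<Phi> x))\<^sup>2 \<partial>PL)"
proof -
  note i = ito_sq_int[OF ito]
  obtain es where es: "\<And>k. simple a b (es k)"
    "(\<lambda>k. \<integral>x. (norm (sproc (es k) x - \<Phi> x))\<^sup>2 \<partial>PL) \<longlonglongrightarrow> 0"
    "(\<lambda>k::nat. \<integral>\<omega>. (norm (sint (es k) \<omega> - J \<omega>))\<^sup>2 \<partial>M) \<longlonglongrightarrow> 0"
    using ito_localize[OF ab ito supp] by blast
  have ab': "a \<le> b" using ab by simp
  note s = sq_int_simple[OF ab(1) ab' ab(3) es(1)]
  obtain c where c: "\<forall>\<omega>\<in>space M. \<bar>A \<omega>\<bar> \<le> c" using coef_bound[OF A] by blast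
  have Am: "A \<in> borel_measurable M" using A ab by (auto simp: coef_def intro: measurable_K)
  \<comment> \<open>Stated for a general measure, because the weighted limits are taken both on M
    and on its product with \<open>lborel\<close>.\<close>
  have weight: "sq_int N (\<lambda>x. A' x *\<^sub>R v x) \<and> (\<forall>k. sq_int N (\<lambda>x. A' x *\<^sub>R u k x)) \<and>
      (\<lambda>k. \<integral>x. (norm (A' x *\<^sub>R u k x - A' x *\<^sub>R v x))\<^sup>2 \<partial>N) \<longlonglongrightarrow> 0"
    if v: "sq_int N v" "\<And>k. sq_int N (u k)" and lim: "(\<lambda>k. \<integral>x. (norm (u k x - v x))\<^sup>2 \<partial>N) \<longlonglongrightarrow> 0"
      and A': "A' \<in> borel_measurable N" "\<And>x. x \<in> space N \<Longrightarrow> \<bar>A' x\<bar> \<le> c"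
    for N :: "'c measure" and A' and u :: "nat \<Rightarrow> 'c \<Rightarrow> 'e::euclidean_space" and v
  proof (intro conjI allI)
    show "sq_int N (\<lambda>x. A' x *\<^sub>R v x)" "sq_int N (\<lambda>x. A' x *\<^sub>R u k x)" for k
      using v by (auto intro: sq_int_mult_bounded[OF _ A'])
    then have i: "integrable N (\<lambda>x. (norm (A' x *\<^sub>R u k x - A' x *\<^sub>R v x))\<^sup>2)" for k
      by (intro sq_int_integrable sq_int_diff)
    show "(\<lambda>k. \<integral>x. (norm (A' x *\<^sub>R u k x - A' x *\<^sub>R v x))\<^sup>2 \<partial>N) \<longlonglongrightarrow> 0"
    proof (rule tendsto_sandwich[OF _ _ tendsto_const])
      show "(\<lambda>k. c\<^sup>2 * (\<integral>x. (norm (u k x - v x))\<^sup>2 \<partial>N)) \<longlonglongrightarrow> 0"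
        using tendsto_mult_left[OF lim, of "c\<^sup>2"] by simp
      have "(\<integral>x. (norm (A' x *\<^sub>R u k x - A' x *\<^sub>R v x))\<^sup>2 \<partial>N) \<le> (\<integral>x. c\<^sup>2 * (norm (u k x - v x))\<^sup>2 \<partial>N)" for k
      proof (rule integral_mono[OF i])
        show "integrable N (\<lambda>x. c\<^sup>2 * (norm (u k x - v x))\<^sup>2)"
          using v by (intro integrable_mult_right sq_int_integrable sq_int_diff)
        fix x assume "x \<in> space N"
        then have "\<bar>A' x\<bar>\<^sup>2 \<le> c\<^sup>2" using A'(2) by (intro power_mono) auto
        then show "(norm (A' x *\<^sub>R u k x - A' x *\<^sub>R v x))\<^sup>2 \<le> c\<^sup>2 * (norm (u k x - v x))\<^sup>2"
          by (simp add: power_mult_distrib mult_right_mono flip: scaleR_diff_right)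
      qed
      then show "\<forall>\<^sub>F k in sequentially. (\<integral>x. (norm (A' x *\<^sub>R u k x - A' x *\<^sub>R v x))\<^sup>2 \<partial>N)
          \<le> c\<^sup>2 * (\<integral>x. (norm (u k x - v x))\<^sup>2 \<partial>N)" by simp
    qed auto
  qed
  have wM: "sq_int M (\<lambda>\<omega>. A \<omega> *\<^sub>R J \<omega>) \<and> (\<forall>k. sq_int M (\<lambda>\<omega>. A \<omega> *\<^sub>R sint (es k) \<omega>)) \<and>
      (\<lambda>k. \<integral>\<omega>. (norm (A \<omega> *\<^sub>R sint (es k) \<omega> - A \<omega> *\<^sub>R J \<omega>))\<^sup>2 \<partial>M) \<longlonglongrightarrow> 0"
    by (rule weight[OF i(2) s(1) es(3) Am]) (use c in auto)
  have wP: "sq_int PL (\<lambda>x. A (fst x) *\<^sub>R \<Phi> x) \<and> (\<forall>k. sq_int PL (\<lambda>x. A (fst x) *\<^sub>R sproc (es k) x)) \<and>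
      (\<lambda>k. \<integral>x. (norm (A (fst x) *\<^sub>R sproc (es k) x - A (fst x) *\<^sub>R \<Phi> x))\<^sup>2 \<partial>PL) \<longlonglongrightarrow> 0"
    by (rule weight[OF i(1) s(2) es(2)]) (use c Am in \<open>auto simp: space_pair_measure\<close>)
  have one: "sq_int M (\<lambda>_. 1 :: real)" by (simp add: sq_int_def)
  have "(\<lambda>k. \<integral>\<omega>. (A \<omega> *\<^sub>R sint (es k) \<omega>) \<bullet> 1 \<partial>M) \<longlonglongrightarrow> (\<integral>\<omega>. (A \<omega> *\<^sub>R J \<omega>) \<bullet> 1 \<partial>M)"
    by (rule sq_int_inner_tendsto) (use wM one in auto)
  moreover have "(\<integral>\<omega>. (A \<omega> *\<^sub>R sint (es k) \<omega>) \<bullet> 1 \<partial>M) = 0" for k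
    using sint_mean[OF ab(1) ab' ab(3) A es(1)] by (simp add: has_bochner_integral_iff)
  ultimately show "(\<integral>\<omega>. A \<omega> * J \<omega> \<partial>M) = 0"
    by (simp add: LIMSEQ_const_iff)
  have 1: "(\<lambda>k. \<integral>\<omega>. (A \<omega> *\<^sub>R sint (es k) \<omega>) \<bullet> sint (es k) \<omega> \<partial>M) \<longlonglongrightarrow> (\<integral>\<omega>. (A \<omega> *\<^sub>R J \<omega>) \<bullet> J \<omega> \<partial>M)"
    by (rule sq_int_inner_tendsto) (use wM i s es in auto)
  have 2: "(\<lambda>k. \<integral>x. (A (fst x) *\<^sub>R sproc (es k) x) \<bullet> sproc (es k) x \<partial>PL) \<longlonglongrightarrow> (\<integral>x. (A (fst x) *\<^sub>R \<Phi> x) \<bullet> \<Phi> x \<partial>PL)"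
    by (rule sq_int_inner_tendsto) (use wP i s es in auto)
  have "(\<integral>\<omega>. (A \<omega> *\<^sub>R sint (es k) \<omega>) \<bullet> sint (es k) \<omega> \<partial>M) = (\<integral>x. (A (fst x) *\<^sub>R sproc (es k) x) \<bullet> sproc (es k) x \<partial>PL)" for k
    using sint_isometry[OF ab(1) ab' ab(3) A es(1), of k]
    by (simp add: power2_norm_eq_inner power2_eq_square[of "sint _ _"] mult.assoc)
  with 1 2 have "(\<integral>\<omega>. (A \<omega> *\<^sub>R J \<omega>) \<bullet> J \<omega> \<partial>M) = (\<integral>x. (A (fst x) *\<^sub>R \<Phi> x) \<bullet> \<Phi> x \<partial>PL)"
    using LIMSEQ_unique by simp
  then show "(\<integral>\<omega>. A \<omega> * (J \<omega>)\<^sup>2 \<partial>M) = (\<integral>x. A (fst x) * (norm (\<Phi> x))\<^sup>2 \<partial>PL)"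
    by (simp add: power2_norm_eq_inner power2_eq_square[of "J _"] mult.assoc)
qed

lemma ito_isometry:
  assumes "0 < T" "ito \<Phi> J" "\<And>x. snd x \<notin> {0<..T} \<Longrightarrow> \<Phi> x = 0"
  shows "(\<integral>\<omega>. (J \<omega>)\<^sup>2 \<partial>M) = (\<integral>x. (norm (\<Phi> x))\<^sup>2 \<partial>PL)"
  using ito_weighted(2)[OF order_refl assms(1) order_refl assms(2,3) coef_const[of _ _ 1]] by simp

text \<open>The weight will be \<open>pos_cube'\<close> of the difference of the solutions, which is
  square integrable but may be unbounded. Truncation at height n and dominated convergence reduce it
  to \<open>ito_weighted\<close>.\<close>

lemma ito_orthogonal:
  assumes ab: "0 \<le> a" "a < b" "b \<le> T" and ito: "ito \<Phi> J"
    and supp: "\<And>x. snd x \<notin> {a<..b} \<Longrightarrow> \<Phi> x = 0"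
    and A: "A \<in> borel_measurable (K a b)" "sq_int M (A :: 'a \<Rightarrow> real)"
  shows "(\<integral>\<omega>. A \<omega> * J \<omega> \<partial>M) = 0"
proof -
  define B where "B n \<omega> = max (- real n) (min (real n) (A \<omega>))" for n \<omega>
  have J: "sq_int M J" by (rule ito_sq_int[OF ito])
  have 0: "(\<integral>\<omega>. B n \<omega> * J \<omega> \<partial>M) = 0" for n
  proof (rule ito_weighted(1)[OF ab ito supp])
    show "coef a b (B n)" unfolding coef_def B_def[abs_def] using A(1)
      by (auto intro!: exI[of _ "real n"] borel_measurable_max borel_measurable_min)
  qed
  have "(\<lambda>n. \<integral>\<omega>. B n \<omega> * J \<omega> \<partial>M) \<longlonglongrightarrow> (\<integral>\<omega>. A \<omega> * J \<omega> \<partial>M)"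
  proof (rule integral_dominated_convergence[where w="\<lambda>\<omega>. norm (A \<omega>) * norm (J \<omega>)"])
    show "(\<lambda>\<omega>. A \<omega> * J \<omega>) \<in> borel_measurable M" "(\<lambda>\<omega>. B n \<omega> * J \<omega>) \<in> borel_measurable M" for n
      using J A(2) by (auto simp: B_def sq_int_def)
    show "integrable M (\<lambda>\<omega>. norm (A \<omega>) * norm (J \<omega>))"
      by (rule sq_int_mult_norm[OF A(2) J])
    show "AE \<omega> in M. norm (B n \<omega> * J \<omega>) \<le> norm (A \<omega>) * norm (J \<omega>)" for n
      by (intro AE_I2) (auto simp: B_def abs_mult intro!: mult_right_mono)
    show "AE \<omega> in M. (\<lambda>n. B n \<omega> * J \<omega>) \<longlonglongrightarrow> A \<omega> * J \<omega>"
    proof (rule AE_I2)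
      fix \<omega>
      have "\<forall>\<^sub>F n in sequentially. \<bar>A \<omega>\<bar> \<le> real n" by (rule eventually_sequentiallyI[of "nat \<lceil>\<bar>A \<omega>\<bar>\<rceil>"]) linarith
      then have "\<forall>\<^sub>F n in sequentially. B n \<omega> * J \<omega> = A \<omega> * J \<omega>"
        by eventually_elim (auto simp: B_def)
      then show "(\<lambda>n. B n \<omega> * J \<omega>) \<longlonglongrightarrow> A \<omega> * J \<omega>" by (rule tendsto_eventually)
    qed
  qed
  then show ?thesis by (simp add: 0 LIMSEQ_const_iff)
qed

text \<open>Third moments of these integrals may be infinite, so \<Phi> is compared with a simple
  process. By \<open>min_square_cube_add\<close> each cell costs the cube of a simple integral, with
  a total of order n^(-1/2), plus a squared error; the isometry turns the squared errors into
  integrals over disjoint cells, which add up to at most the global error \<epsilon>.\<close>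

lemma ito_remainder:
  assumes \<Phi>: "sq_int PL \<Phi>" and J: "\<And>a b. 0 \<le> a \<Longrightarrow> a < b \<Longrightarrow> b \<le> T \<Longrightarrow> ito (\<lambda>x. indicator {a<..b} (snd x) *\<^sub>R \<Phi> x) (J a b)"
    and t: "0 \<le> t" "t < T"
  defines "g \<equiv> grid t T"
  shows "(\<lambda>n. \<Sum>i<Suc n. \<integral>\<omega>. min_square_cube (J (g n i) (g n (Suc i)) \<omega>) \<partial>M) \<longlonglongrightarrow> 0"
proof -
  have T: "0 < T" "0 \<le> T" using t by auto
  have step: "g n (Suc i) - g n i = (T - t) / real (Suc n)" for n i
    unfolding g_def by (rule grid_simps(3)[OF t(2)])
  have g: "0 \<le> g n i" "g n i < g n (Suc i)" "g n (Suc i) \<le> T" if "i < Suc n" for n i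
    using grid_simps(4,5)[OF t(2), of n i] grid_simps(6)[OF t(2), of "Suc i" n] t that by (auto simp: g_def)
  have nn: "0 \<le> (\<Sum>i<Suc n. \<integral>\<omega>. min_square_cube (J (g n i) (g n (Suc i)) \<omega>) \<partial>M)" for n
    by (intro sum_nonneg) (auto intro: integral_nonneg_AE simp: min_square_cube_nonneg)
  have key: "\<exists>C\<ge>0. \<forall>n. (\<Sum>i<Suc n. \<integral>\<omega>. min_square_cube (J (g n i) (g n (Suc i)) \<omega>) \<partial>M)
     \<le> C / sqrt (real (Suc n)) + 4 * \<epsilon>" if \<epsilon>: "\<epsilon> > 0" for \<epsilon> :: real
  proof -
    define \<Psi> where "\<Psi> x = indicator {0<..T} (snd x) *\<^sub>R \<Phi> x" for x
    have \<Psi>: "ito \<Psi> (J 0 T)" unfolding \<Psi>_def[abs_def] by (rule J) (use T in auto)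
    then obtain es where es: "\<And>k. simple 0 T (es k)"
      "(\<lambda>k::nat. \<integral>x. (norm (sproc (es k) x - \<Psi> x))\<^sup>2 \<partial>PL) \<longlonglongrightarrow> 0"
      by (auto simp: ito_def)
    have "\<forall>\<^sub>F k in sequentially. (\<integral>x. (norm (sproc (es k) x - \<Psi> x))\<^sup>2 \<partial>PL) < \<epsilon>"
      by (rule order_tendstoD(2)[OF es(2) \<epsilon>])
    then obtain k where k: "(\<integral>x. (norm (sproc (es k) x - \<Psi> x))\<^sup>2 \<partial>PL) < \<epsilon>"
      using eventually_happens'[OF sequentially_bot] by blast
    define fs where "fs = es k"
    have fs: "simple 0 T fs" using es(1) by (simp add: fs_def)
    obtain C where C: "C \<ge> 0" "\<And>a b. 0 \<le> a \<Longrightarrow> a < b \<Longrightarrow> b \<le> T \<Longrightarrow> integrable M (\<lambda>\<omega>. \<bar>sint (restr_elems a b fs) \<omega>\<bar> ^ 3)"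
      "\<And>a b. 0 \<le> a \<Longrightarrow> a < b \<Longrightarrow> b \<le> T \<Longrightarrow> (\<integral>\<omega>. \<bar>sint (restr_elems a b fs) \<omega>\<bar> ^ 3 \<partial>M) \<le> C * sqrt (b - a) ^ 3"
      using sint_restr_cube[OF fs] by blast
    define e where "e x = (norm (sproc fs x - \<Psi> x))\<^sup>2" for x
    have ie: "integrable PL e"
      unfolding e_def[abs_def] fs_def
      using sq_int_simple(2)[OF order_refl T(2) order_refl es(1)] ito_sq_int(1)[OF \<Psi>]
      by (intro sq_int_integrable sq_int_diff)
    have iie: "integrable PL (\<lambda>x. indicator {a<..b} (snd x) * e x)" for a b
    proof (rule Bochner_Integration.integrable_bound[OF ie])
      have [measurable]: "e \<in> borel_measurable PL" using ie by simp
      show "(\<lambda>x. indicator {a<..b} (snd x) * e x) \<in> borel_measurable PL" by measurable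
    qed (auto simp: indicator_def)
    have one: "(\<integral>\<omega>. min_square_cube (J a b \<omega>) \<partial>M) \<le> 8 * (C * sqrt (b - a) ^ 3)
        + 4 * (\<integral>x. indicator {a<..b} (snd x) * e x \<partial>PL)" if ab: "0 \<le> a" "a < b" "b \<le> T" for a b
    proof -
      define S where "S = sint (restr_elems a b fs)"
      have sr: "simple a b (restr_elems a b fs)" by (rule simple_restr[OF ab(1,3) fs])
      then have sr0: "simple 0 T (restr_elems a b fs)" using ab by (auto intro: simple_mono)
      have it: "ito (\<lambda>x. indicator {a<..b} (snd x) *\<^sub>R \<Phi> x - sproc (restr_elems a b fs) x) (\<lambda>\<omega>. J a b \<omega> - S \<omega>)"
        unfolding S_def by (intro ito_diff[OF T(2)] J ab ito_simple T sr0)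
      have "(\<integral>\<omega>. (J a b \<omega> - S \<omega>)\<^sup>2 \<partial>M) = (\<integral>x. (norm (indicator {a<..b} (snd x) *\<^sub>R \<Phi> x - sproc (restr_elems a b fs) x))\<^sup>2 \<partial>PL)"
        by (rule ito_isometry[OF T(1) it]) (use ab in \<open>auto simp: sproc_restr\<close>)
      also have "\<dots> = (\<integral>x. indicator {a<..b} (snd x) * e x \<partial>PL)"
        by (intro Bochner_Integration.integral_cong refl)
          (use ab in \<open>auto simp: sproc_restr indicator_def e_def \<Psi>_def norm_minus_commute\<close>)
      finally have eq: "(\<integral>\<omega>. (J a b \<omega> - S \<omega>)\<^sup>2 \<partial>M) = (\<integral>x. indicator {a<..b} (snd x) * e x \<partial>PL)" .
      have iJS: "integrable M (\<lambda>\<omega>. (J a b \<omega> - S \<omega>)\<^sup>2)"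
        using sq_int_integrable[OF ito_sq_int(2)[OF it]] by simp
      have iS: "integrable M (\<lambda>\<omega>. \<bar>S \<omega>\<bar> ^ 3)" unfolding S_def by (rule C(2)[OF ab])
      have sJ: "sq_int M (J a b)" by (rule ito_sq_int(2)[OF J[OF ab]])
      have m: "(\<lambda>\<omega>. min_square_cube (J a b \<omega>)) \<in> borel_measurable M"
        using sJ unfolding min_square_cube_def by (auto simp: sq_int_def)
      have pt: "min_square_cube (J a b \<omega>) \<le> 8 * \<bar>S \<omega>\<bar> ^ 3 + 4 * (J a b \<omega> - S \<omega>)\<^sup>2" for \<omega>
        using min_square_cube_add[of "S \<omega>" "J a b \<omega> - S \<omega>"] min_square_cube_le(2)[of "S \<omega>"] by simp
      have "(\<integral>\<omega>. min_square_cube (J a b \<omega>) \<partial>M) \<le> (\<integral>\<omega>. 8 * \<bar>S \<omega>\<bar> ^ 3 + 4 * (J a b \<omega> - S \<omega>)\<^sup>2 \<partial>M)"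
      proof (rule integral_mono)
        show "integrable M (\<lambda>\<omega>. 8 * \<bar>S \<omega>\<bar> ^ 3 + 4 * (J a b \<omega> - S \<omega>)\<^sup>2)" using iJS iS by simp
        then show "integrable M (\<lambda>\<omega>. min_square_cube (J a b \<omega>))"
          by (rule Bochner_Integration.integrable_bound[OF _ m]) (use pt in \<open>auto simp: min_square_cube_nonneg intro!: AE_I2\<close>)
      qed (rule pt)
      also have "\<dots> = 8 * (\<integral>\<omega>. \<bar>S \<omega>\<bar> ^ 3 \<partial>M) + 4 * (\<integral>x. indicator {a<..b} (snd x) * e x \<partial>PL)"
        using iJS iS eq by simp
      also have "\<dots> \<le> 8 * (C * sqrt (b - a) ^ 3) + 4 * (\<integral>x. indicator {a<..b} (snd x) * e x \<partial>PL)"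
        using C(3)[OF ab] by (simp add: S_def)
      finally show ?thesis .
    qed
    define D where "D = 8 * C * sqrt (T - t) ^ 3"
    have "(\<Sum>i<Suc n. \<integral>\<omega>. min_square_cube (J (g n i) (g n (Suc i)) \<omega>) \<partial>M) \<le> D / sqrt (real (Suc n)) + 4 * \<epsilon>" for n
    proof -
      have "(\<Sum>i<Suc n. \<integral>\<omega>. min_square_cube (J (g n i) (g n (Suc i)) \<omega>) \<partial>M)
         \<le> (\<Sum>i<Suc n. 8 * (C * sqrt ((T - t) / real (Suc n)) ^ 3) + 4 * (\<integral>x. indicator {g n i<..g n (Suc i)} (snd x) * e x \<partial>PL))"
      proof (rule sum_mono)
        fix i assume "i \<in> {..<Suc n}"
        then have "i < Suc n" by simp
        from one[OF g[OF this]] show "(\<integral>\<omega>. min_square_cube (J (g n i) (g n (Suc i)) \<omega>) \<partial>M)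
          \<le> 8 * (C * sqrt ((T - t) / real (Suc n)) ^ 3) + 4 * (\<integral>x. indicator {g n i<..g n (Suc i)} (snd x) * e x \<partial>PL)"
          by (simp only: step)
      qed
      also have "\<dots> = real (Suc n) * (8 * (C * sqrt ((T - t) / real (Suc n)) ^ 3))
          + 4 * (\<integral>x. (\<Sum>i<Suc n. indicator {g n i<..g n (Suc i)} (snd x) * e x) \<partial>PL)"
        using iie by (simp only: sum.distrib sum_constant card_lessThan Bochner_Integration.integral_sum sum_distrib_left)
      \<comment> \<open>The number of cells times a cell contribution of order (mesh)^(3/2).\<close>
      also have "real (Suc n) * (8 * (C * sqrt ((T - t) / real (Suc n)) ^ 3)) = D / sqrt (real (Suc n))"
      proof -
        define s where "s = sqrt (real (Suc n))"
        have s: "s > 0" "real (Suc n) = s * s" by (auto simp: s_def)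
        show ?thesis unfolding real_sqrt_divide D_def s_def[symmetric] power_divide s(2)
          using s(1) by (simp add: power3_eq_cube)
      qed
      also have "(\<integral>x. (\<Sum>i<Suc n. indicator {g n i<..g n (Suc i)} (snd x) * e x) \<partial>PL) \<le> (\<integral>x. e x \<partial>PL)"
      proof (rule integral_mono[OF _ ie])
        show "integrable PL (\<lambda>x. \<Sum>i<Suc n. indicator {g n i<..g n (Suc i)} (snd x) * e x)"
          using iie by (intro Bochner_Integration.integrable_sum)
        fix x :: "'a \<times> real"
        have "(\<Sum>i<Suc n. indicator {g n i<..g n (Suc i)} (snd x) :: real) \<le> 1"
          using sum_indicator_partition[of "Suc n" "g n" "snd x"] g(2)[of _ n]
          by (simp add: less_imp_le indicator_def del: sum.lessThan_Suc)
        then have "(\<Sum>i<Suc n. indicator {g n i<..g n (Suc i)} (snd x)) * e x \<le> 1 * e x"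
          by (intro mult_right_mono) (auto simp: e_def)
        then show "(\<Sum>i<Suc n. indicator {g n i<..g n (Suc i)} (snd x) * e x) \<le> e x"
          by (simp only: sum_distrib_right mult_1)
      qed
      also have "(\<integral>x. e x \<partial>PL) \<le> \<epsilon>" using k by (simp add: e_def fs_def)
      finally show ?thesis by simp
    qed
    moreover have "D \<ge> 0" using C(1) t by (simp add: D_def)
    ultimately show ?thesis by blast
  qed
  show ?thesis
  proof (rule LIMSEQ_I)
    fix r :: real assume r: "0 < r"
    \<comment> \<open>The approximation error takes 4 * (r / 8), half of r; the other half is left
      to the term that vanishes with n.\<close>
    obtain C where C: "C \<ge> 0" "\<And>n. (\<Sum>i<Suc n. \<integral>\<omega>. min_square_cube (J (g n i) (g n (Suc i)) \<omega>) \<partial>M)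
     \<le> C / sqrt (real (Suc n)) + 4 * (r / 8)" using key[of "r / 8"] r by (meson divide_pos_pos zero_less_numeral)
    have "(\<lambda>n. C / sqrt (real (Suc n))) \<longlonglongrightarrow> 0"
      by (rule real_tendsto_divide_at_top[OF tendsto_const])
        (rule filterlim_compose[OF sqrt_at_top filterlim_compose[OF filterlim_real_sequentially filterlim_Suc]])
    then have "\<forall>\<^sub>F n in sequentially. C / sqrt (real (Suc n)) < r / 2"
      by (rule order_tendstoD) (use r in auto)
    then obtain N where "\<And>n. n \<ge> N \<Longrightarrow> C / sqrt (real (Suc n)) < r / 2"
      by (auto simp: eventually_sequentially)
    note N = this
    show "\<exists>no. \<forall>n\<ge>no. norm ((\<Sum>i<Suc n. \<integral>\<omega>. min_square_cube (J (g n i) (g n (Suc i)) \<omega>) \<partial>M) - 0) < r"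
    proof (intro exI[of _ N] allI impI)
      fix n assume "N \<le> n"
      have "(\<Sum>i<Suc n. \<integral>\<omega>. min_square_cube (J (g n i) (g n (Suc i)) \<omega>) \<partial>M) < r"
        using C(2)[of n] N[OF \<open>N \<le> n\<close>] by linarith
      then show "norm ((\<Sum>i<Suc n. \<integral>\<omega>. min_square_cube (J (g n i) (g n (Suc i)) \<omega>) \<partial>M) - 0) < r"
        using nn[of n] by (simp only: real_norm_def diff_zero abs_of_nonneg)
    qed
  qed
qed

end

section \<open>Brownian motion as forward and backward noise\<close>

lemma strict_partition_mono:
  assumes "strict_partition a b n p" "i \<le> j" "j \<le> n"
  shows "p i \<le> p j"
  using assms(2,3)
proof (induction j rule: dec_induct)
  case (step j)
  then have "p j < p (Suc j)" using assms(1) by (auto simp: strict_partition_def)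
  then show ?case using step by simp
qed simp

context ito_noise
begin

lemma nn_integral_PL_iterated:
  fixes \<Phi> :: "'a \<times> real \<Rightarrow> real ^ 'd"
  assumes "\<Phi> \<in> borel_measurable PL"
  shows "(\<integral>\<^sup>+x. ennreal ((norm (\<Phi> x))\<^sup>2) \<partial>PL) = (\<integral>\<^sup>+\<omega>. (\<integral>\<^sup>+s. ennreal ((norm (\<Phi> (\<omega>, s)))\<^sup>2) \<partial>lborel) \<partial>M)"
  by (rule lborel.nn_integral_fst[symmetric]) (use assms in measurable)

text \<open>Leads from the iterated integrals over the closed interval [t, T], in which the integral
  is defined, to the product measure and the half-open interval. That \<Phi> and I are square
  integrable is a conclusion: each is at finite L2 distance from some simple approximant.\<close>

lemma itoI:
  assumes t: "0 \<le> t" "t \<le> T"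
    and \<Phi>: "\<Phi> \<in> borel_measurable PL" "\<And>\<omega> s. \<omega> \<in> space M \<Longrightarrow> s \<in> {t<..T} \<Longrightarrow> \<Phi> (\<omega>, s) = \<phi> s \<omega>"
      "\<And>x. snd x \<notin> {t<..T} \<Longrightarrow> \<Phi> x = 0"
    and p: "\<And>k. strict_partition t T (n k) (p k)"
    and \<zeta>: "\<And>k i. i < n k \<Longrightarrow> coef (p k i) (p k (Suc i)) (\<zeta> k i)"
    and lim: "L2_limit_of_step_integrals M X \<phi> t T n p \<zeta> I"
  shows "ito \<Phi> I"
proof -
  have T: "0 \<le> T" using t by simp
  define es where "es k = map (\<lambda>i. (p k i, p k (Suc i), \<zeta> k i)) [0..<n k]" for k
  have range: "t \<le> p k i" "p k (Suc i) \<le> T" "p k i < p k (Suc i)" if "i < n k" for k i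
    using p[of k] strict_partition_mono[OF p[of k], of 0 i] strict_partition_mono[OF p[of k], of "Suc i" "n k"] that
    by (auto simp: strict_partition_def)
  have es: "simple 0 T (es k)" for k
  proof -
    have "0 \<le> p k i \<and> p k i < p k (Suc i) \<and> p k (Suc i) \<le> T \<and> coef (p k i) (p k (Suc i)) (\<zeta> k i)" if "i < n k" for i
      using range[OF that] t \<zeta>[OF that] by simp
    then show ?thesis by (auto simp: es_def simple_def)
  qed
  have sproc: "sproc (es k) x = step_process (n k) (p k) (\<zeta> k) (snd x) (fst x)" for k x
    by (simp add: es_def sproc_def step_process_def comp_def interv_sum_list_conv_sum_set_nat atLeast0LessThan)
  have sint: "sint (es k) \<omega> = step_integral X (n k) (p k) (\<zeta> k) \<omega>" for k \<omega>
    by (simp add: es_def sint_def step_integral_def comp_def interv_sum_list_conv_sum_set_nat atLeast0LessThan)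
  have supp: "sproc (es k) x = 0" if "snd x \<notin> {t<..T}" for k x
    unfolding sproc step_process_def
  proof (intro sum.neutral ballI)
    fix i assume "i \<in> {..<n k}"
    then have "snd x \<notin> {p k i<..p k (Suc i)}" using range[of i k] that by auto
    then show "indicator {p k i<..p k (Suc i)} (snd x) *\<^sub>R \<zeta> k i (fst x) = 0" by simp
  qed
  note s = sq_int_simple[OF order_refl T order_refl es]
  have nn: "(\<integral>\<^sup>+x. ennreal ((norm (\<Phi> x - sproc (es k) x))\<^sup>2) \<partial>PL)
    = (\<integral>\<^sup>+\<omega>. (\<integral>\<^sup>+s\<in>{t..T}. ennreal ((norm (\<phi> s \<omega> - step_process (n k) (p k) (\<zeta> k) s \<omega>))\<^sup>2) \<partial>lborel) \<partial>M)" for k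
  proof -
    have "(\<integral>\<^sup>+x. ennreal ((norm (\<Phi> x - sproc (es k) x))\<^sup>2) \<partial>PL)
      = (\<integral>\<^sup>+\<omega>. (\<integral>\<^sup>+s. ennreal ((norm (\<Phi> (\<omega>, s) - sproc (es k) (\<omega>, s)))\<^sup>2) \<partial>lborel) \<partial>M)"
      by (rule nn_integral_PL_iterated) (intro borel_measurable_diff \<Phi>(1) sq_int_measurable[OF s(2)])
    also have "\<dots> = (\<integral>\<^sup>+\<omega>. (\<integral>\<^sup>+s\<in>{t..T}. ennreal ((norm (\<phi> s \<omega> - step_process (n k) (p k) (\<zeta> k) s \<omega>))\<^sup>2) \<partial>lborel) \<partial>M)"
    proof (rule nn_integral_cong, rule nn_integral_cong_AE)
      fix \<omega> assume \<omega>: "\<omega> \<in> space M"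
      \<comment> \<open>The time t belongs to [t, T] but to no step interval; a single point is
        negligible.\<close>
      have "AE s in lborel. s \<noteq> t" by (rule AE_lborel_singleton)
      then show "AE s in lborel. ennreal ((norm (\<Phi> (\<omega>, s) - sproc (es k) (\<omega>, s)))\<^sup>2)
         = ennreal ((norm (\<phi> s \<omega> - step_process (n k) (p k) (\<zeta> k) s \<omega>))\<^sup>2) * indicator {t..T} s"
      proof eventually_elim
        case (elim s)
        show ?case
        proof (cases "s \<in> {t<..T}")
          case True
          then show ?thesis using \<Phi>(2)[OF \<omega>] by (auto simp: sproc)
        next
          case False
          then have "\<Phi> (\<omega>, s) = 0" "sproc (es k) (\<omega>, s) = 0" "s \<notin> {t..T}"
            using \<Phi>(3)[of "(\<omega>, s)"] supp[of "(\<omega>, s)"] elim by auto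
          then show ?thesis by simp
        qed
      qed
    qed
    finally show ?thesis .
  qed
  have lim1: "(\<lambda>k. \<integral>\<^sup>+x. ennreal ((norm (\<Phi> x - sproc (es k) x))\<^sup>2) \<partial>PL) \<longlonglongrightarrow> 0"
    using lim unfolding nn L2_limit_of_step_integrals_def by simp
  have lim2: "(\<lambda>k. \<integral>\<^sup>+\<omega>. ennreal ((norm (I \<omega> - sint (es k) \<omega>))\<^sup>2) \<partial>M) \<longlonglongrightarrow> 0"
    using lim unfolding sint L2_limit_of_step_integrals_def by simp
  have Im: "I \<in> borel_measurable M" using lim by (simp add: L2_limit_of_step_integrals_def)
  have conv: "sq_int N v \<and> (\<lambda>k. \<integral>x. (norm (u k x - v x))\<^sup>2 \<partial>N) \<longlonglongrightarrow> 0"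
    if v: "v \<in> borel_measurable N" and u: "\<And>k. sq_int N (u k)"
      and lim: "(\<lambda>k. \<integral>\<^sup>+x. ennreal ((norm (v x - u k x))\<^sup>2) \<partial>N) \<longlonglongrightarrow> 0"
    for N :: "'c measure" and v :: "'c \<Rightarrow> 'e::euclidean_space" and u
  proof -
    have "\<forall>\<^sub>F k in sequentially. (\<integral>\<^sup>+x. ennreal ((norm (v x - u k x))\<^sup>2) \<partial>N) < \<infinity>"
      by (rule order_tendstoD(2)[OF lim]) simp
    then obtain k where k: "(\<integral>\<^sup>+x. ennreal ((norm (v x - u k x))\<^sup>2) \<partial>N) < \<infinity>"
      using eventually_happens'[OF sequentially_bot] by blast
    have "sq_int N (\<lambda>x. v x - u k x)"
      using k v sq_int_measurable[OF u] by (subst sq_int_nn) auto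
    from sq_int_add[OF this u[of k]] have sv: "sq_int N v" by simp
    have "(\<integral>x. (norm (u k x - v x))\<^sup>2 \<partial>N) = enn2real (\<integral>\<^sup>+x. ennreal ((norm (v x - u k x))\<^sup>2) \<partial>N)" for k
      using v sq_int_measurable[OF u[of k]]
      by (subst integral_eq_nn_integral) (auto simp: norm_minus_commute)
    moreover have "(\<lambda>k. enn2real (\<integral>\<^sup>+x. ennreal ((norm (v x - u k x))\<^sup>2) \<partial>N)) \<longlonglongrightarrow> 0"
      by (rule tendsto_enn2real) (use lim in simp_all)
    ultimately show ?thesis using sv by simp
  qed
  show ?thesis unfolding ito_def
    using conv[OF \<Phi>(1) s(2) lim1] conv[OF Im s(1) lim2] es by blast
qed

end

section \<open>Gaussian moments of Brownian increments\<close>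

lemma (in prob_space) distributed_has_bochner_integral:
  assumes "distributed M lborel X (\<lambda>x. ennreal (f x))" "\<And>x. 0 \<le> f x" "g \<in> borel_measurable borel"
    and "has_bochner_integral lborel (\<lambda>x. f x * g x :: real) v"
  shows "has_bochner_integral M (\<lambda>\<omega>. g (X \<omega>)) v"
  using distributed_integrable[OF assms(1), of g] distributed_integral[OF assms(1), of g] assms(2-)
  by (auto simp: has_bochner_integral_iff)

lemma std_brownian_motion_distributed:
  assumes "std_brownian_motion M T X" "0 \<le> p" "p < q" "q \<le> T"
  shows "distributed M lborel (\<lambda>\<omega>. (X q \<omega> - X p \<omega>) $ j) (\<lambda>x. ennreal (normal_density 0 (sqrt (q - p)) x))"
    "prob_space.indep_vars M (\<lambda>_. borel) (\<lambda>j \<omega>. (X q \<omega> - X p \<omega>) $ j) UNIV"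
  using assms unfolding std_brownian_motion_def by blast+

lemma (in prob_space) brownian_moments:
  assumes bm: "std_brownian_motion M T X" and pq: "0 \<le> p" "p < q" "q \<le> T"
  shows "has_bochner_integral M (\<lambda>\<omega>. (X q \<omega> - X p \<omega>) $ j) 0" (is ?mean)
    and "has_bochner_integral M (\<lambda>\<omega>. (X q \<omega> - X p \<omega>) $ i * (X q \<omega> - X p \<omega>) $ j) (if i = j then q - p else 0)" (is ?cov)
    and "integrable M (\<lambda>\<omega>. \<bar>(X q \<omega> - X p \<omega>) $ j\<bar> ^ 3)" (is ?int)
    and "(\<integral>\<omega>. \<bar>(X q \<omega> - X p \<omega>) $ j\<bar> ^ 3 \<partial>M) \<le> 2 * sqrt (q - p) ^ 3" (is ?cube)
proof -
  define \<sigma> where "\<sigma> = sqrt (q - p)"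
  have \<sigma>: "\<sigma> > 0" "\<sigma>\<^sup>2 = q - p" using pq by (auto simp: \<sigma>_def)
  note d = std_brownian_motion_distributed(1)[OF bm pq, folded \<sigma>_def]
  note nn = normal_density_nonneg
  have mean: "has_bochner_integral M (\<lambda>\<omega>. (X q \<omega> - X p \<omega>) $ j) 0" for j
    by (rule distributed_has_bochner_integral[OF d nn, of "\<lambda>x. x"])
      (use normal_moment_odd[OF \<sigma>(1), of 0 0] in auto)
  then show ?mean .
  have "has_bochner_integral M (\<lambda>\<omega>. \<bar>(X q \<omega> - X p \<omega>) $ j\<bar> ^ 3) (2 * \<sigma> ^ 3 * sqrt (2 / pi))"
    by (rule distributed_has_bochner_integral[OF d nn, of "\<lambda>x. \<bar>x\<bar> ^ 3"])
      (use normal_moment_abs_odd[OF \<sigma>(1), of 0 1] in \<open>auto simp: eval_nat_numeral\<close>)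
  moreover have "2 * \<sigma> ^ 3 * sqrt (2 / pi) \<le> 2 * \<sigma> ^ 3"
  proof -
    have "sqrt (2 / pi) \<le> 1" using pi_gt3 by (simp add: real_sqrt_le_1_iff)
    then show ?thesis using \<sigma> by (simp add: mult_left_le)
  qed
  ultimately show ?int ?cube by (auto simp: has_bochner_integral_iff \<sigma>_def)
  show ?cov
  proof (cases "i = j")
    case True
    have "has_bochner_integral M (\<lambda>\<omega>. ((X q \<omega> - X p \<omega>) $ j)\<^sup>2) (q - p)"
      by (rule distributed_has_bochner_integral[OF d nn, of "\<lambda>x. x\<^sup>2"])
        (use normal_moment_even[OF \<sigma>(1), of 0 1] \<sigma> in \<open>auto simp: eval_nat_numeral\<close>)
    then show ?thesis using True by (simp add: power2_eq_square)
  next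
    case False
    have ind: "indep_vars (\<lambda>_. borel) (\<lambda>j \<omega>. (X q \<omega> - X p \<omega>) $ j) {i, j}"
      by (rule indep_vars_subset[OF std_brownian_motion_distributed(2)[OF bm pq]]) simp
    have int: "integrable M (\<lambda>\<omega>. (X q \<omega> - X p \<omega>) $ j)" for j
      using mean[of j] by (simp add: has_bochner_integral_iff)
    have fin: "finite {i, j}" by simp
    show ?thesis
      using indep_vars_lebesgue_integral[OF fin ind int] indep_vars_integrable[OF fin ind int] mean False
      by (simp add: has_bochner_integral_iff)
  qed
qed

section \<open>The two filtrations as instances of the noise locale\<close>

lemma sigma_join_commute: "sigma_join N1 N2 = sigma_join N2 N1"
  by (simp add: sigma_join_def Un_commute)

lemma sigma_join_mono:
  assumes "space N1 = space N2" "space N1' = space N2'" "space N1 = space N1'"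
    and "sets N1 \<subseteq> sets N1'" "sets N2 \<subseteq> sets N2'"
  shows "sets (sigma_join N1 N2) \<subseteq> sets (sigma_join N1' N2')"
proof (rule sets_sigma_join_le)
  show "sets N1 \<subseteq> sets (sigma_join N1' N2')" "sets N2 \<subseteq> sets (sigma_join N1' N2')"
    using sets_sigma_join_ge[OF assms(2)] assms(4,5) by auto
qed (use assms in auto)

lemma std_brownian_motion_measurable:
  "std_brownian_motion M T X \<Longrightarrow> t \<in> {0..T} \<Longrightarrow> X t \<in> borel_measurable M"
  by (simp add: std_brownian_motion_def)

lemma incr_sigma_events:
  assumes "std_brownian_motion M T X" "0 \<le> s" "t \<le> T"
  shows "sets (incr_sigma M X s t) \<subseteq> sets M"
proof (cases "s \<le> t")
  case True
  show ?thesis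
    by (rule sets_incr_sigma_le)
      (use assms True in \<open>auto intro!: borel_measurable_diff std_brownian_motion_measurable[OF assms(1)]\<close>)
next
  case False
  show ?thesis by (rule sets_incr_sigma_le) (use False in auto)
qed

text \<open>The functions l and u encode the direction of time: increments of X are known on [0, p],
  or on [q, T]. The whole path of X' may be handed over in either case, because the increment of X
  over (p, q] remains independent of the enlarged information.\<close>

lemma (in prob_space) brownian_noise:
  fixes X :: "real \<Rightarrow> 'a \<Rightarrow> real ^ 'd" and X' :: "real \<Rightarrow> 'a \<Rightarrow> real ^ 'e"
  assumes T: "0 < T" and bm: "std_brownian_motion M T X" "std_brownian_motion M T X'" and ind: "indep_processes M T X X'"
    and lu: "(\<forall>p q. l p q = 0 \<and> u p q = p) \<or> (\<forall>p q. l p q = q \<and> u p q = T)"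
  shows "ito_noise M T X (\<lambda>p q. sigma_join (incr_sigma M X (l p q) (u p q)) (incr_sigma M X' 0 T))"
proof unfold_locales
  fix p q p' q' :: real and i j
  let ?K = "\<lambda>p q. sigma_join (incr_sigma M X (l p q) (u p q)) (incr_sigma M X' 0 T)"
  show "space (?K p q) = space M" by simp
  show "X t \<in> borel_measurable M" if "t \<in> {0..T}" for t
    using that by (rule std_brownian_motion_measurable[OF bm(1)])
  show "sets (?K p q) \<subseteq> sets M" if "0 \<le> p" "p \<le> q" "q \<le> T"
  proof (rule sets_sigma_join_le)
    show "sets (incr_sigma M X (l p q) (u p q)) \<subseteq> sets M"
      by (rule incr_sigma_events[OF bm(1)]) (use that lu in auto)
    show "sets (incr_sigma M X' 0 T) \<subseteq> sets M"
      by (rule incr_sigma_events[OF bm(2)]) (use T in auto)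
  qed auto
  have mono: "sets (?K p q) \<subseteq> sets (?K p' q')" if "l p' q' \<le> l p q" "u p q \<le> u p' q'" for p q p' q'
    by (rule sigma_join_mono[OF _ _ _ incr_sigma_mono[OF that] order_refl]) auto
  show "sets (?K p q) \<subseteq> sets (?K p' q')" if "0 \<le> p" "p \<le> p'" "p' \<le> q'" "q' \<le> q" "q \<le> T"
    by (rule mono) (use lu that in auto)
  have incr: "(\<lambda>\<omega>. X q \<omega> - X p \<omega>) \<in> borel_measurable (?K p' q')" if "l p' q' \<le> p" "p \<le> q" "q \<le> u p' q'" for p q p' q'
    by (rule measurable_sub_sigma[OF incr_sigma_increment[OF that] sets_sigma_join_ge(1)]) auto
  show "sets (?K p q) \<subseteq> sets (?K p' q') \<and> (\<lambda>\<omega>. X q \<omega> - X p \<omega>) \<in> borel_measurable (?K p' q') \<or>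
      sets (?K p' q') \<subseteq> sets (?K p q) \<and> (\<lambda>\<omega>. X q' \<omega> - X p' \<omega>) \<in> borel_measurable (?K p q)"
    if "0 \<le> p" "p < q" "q \<le> p'" "p' < q'" "q' \<le> T"
    using lu
  proof
    assume "\<forall>p q. l p q = 0 \<and> u p q = p"
    then show ?thesis using that by (intro disjI1 conjI mono incr) auto
  next
    assume "\<forall>p q. l p q = q \<and> u p q = T"
    then show ?thesis using that by (intro disjI2 conjI mono incr) auto
  qed
  assume pq: "0 \<le> p" "p < q" "q \<le> T"
  show "indep_set (sets (?K p q)) (sets (vimage_algebra (space M) (\<lambda>\<omega>. X q \<omega> - X p \<omega>) borel))"
    by (rule increment_indep_join[OF bm(1) ind pq]) (use pq lu in auto)
  show "has_bochner_integral M (\<lambda>\<omega>. (X q \<omega> - X p \<omega>) $ j) 0"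
    "has_bochner_integral M (\<lambda>\<omega>. (X q \<omega> - X p \<omega>) $ i * (X q \<omega> - X p \<omega>) $ j) (if i = j then q - p else 0)"
    "integrable M (\<lambda>\<omega>. \<bar>(X q \<omega> - X p \<omega>) $ j\<bar> ^ 3)"
    "(\<integral>\<omega>. \<bar>(X q \<omega> - X p \<omega>) $ j\<bar> ^ 3 \<partial>M) \<le> 2 * sqrt (q - p) ^ 3"
    by (rule brownian_moments[OF bm(1) pq])+
qed

locale brownian_pair = prob_space M for M :: "'a measure" +
  fixes T :: real and W :: "real \<Rightarrow> 'a \<Rightarrow> real ^ 'd" and B :: "real \<Rightarrow> 'a \<Rightarrow> real ^ 'l"
  assumes T_pos: "0 < T" and W: "std_brownian_motion M T W" and B: "std_brownian_motion M T B"
    and indep: "indep_processes M T W B"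

sublocale brownian_pair \<subseteq> fwd: ito_noise M T W "\<lambda>p q. fwd_sigma M T W B p"
  using brownian_noise[OF T_pos W B indep, of "\<lambda>_ _. 0" "\<lambda>p q. p"] by (simp add: fwd_sigma_def)

text \<open>Backward in time the roles are exchanged: B drives, W is known entirely, and the
  coefficient on (p, q] sees increments of B from q on.\<close>

sublocale brownian_pair \<subseteq> bwd: ito_noise M T B "\<lambda>p q. bwd_sigma M T W B q"
  using brownian_noise[OF T_pos B W indep_processes_commute[OF prob_space_axioms indep], of "\<lambda>p q. q" "\<lambda>_ _. T"]
  by (simp add: bwd_sigma_def sigma_join_commute)

context brownian_pair
begin

text \<open>The bridge between the non-monotone family and the two filtrations: a value adapted at t
  counts as known in the forward sense when t is a left end point, and in the backward sense when t
  is a right end point.\<close>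

lemma bd_sigma_subset:
  assumes "0 \<le> t" "t \<le> T"
  shows "sets (bd_sigma M T W B t) \<subseteq> sets (fwd_sigma M T W B t)"
    "sets (bd_sigma M T W B t) \<subseteq> sets (bwd_sigma M T W B t)"
    "sets (bd_sigma M T W B t) \<subseteq> sets M"
  and space_sigmas: "space (bd_sigma M T W B t) = space M" "space (fwd_sigma M T W B t) = space M"
    "space (bwd_sigma M T W B t) = space M"
proof -
  show 1: "sets (bd_sigma M T W B t) \<subseteq> sets (fwd_sigma M T W B t)"
    unfolding bd_sigma_def fwd_sigma_def using assms
    by (intro sigma_join_mono incr_sigma_mono order_refl) auto
  show "sets (bd_sigma M T W B t) \<subseteq> sets (bwd_sigma M T W B t)"
    unfolding bd_sigma_def bwd_sigma_def using assms
    by (intro sigma_join_mono incr_sigma_mono) auto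
  show "sets (bd_sigma M T W B t) \<subseteq> sets M"
    using 1 fwd.K_events[of t t] assms by auto
qed (auto simp: bd_sigma_def fwd_sigma_def bwd_sigma_def)

end

section \<open>Uniform partitions and scalar estimates\<close>

lemma partition_point:
  fixes p :: "nat \<Rightarrow> real"
  assumes "\<And>i. i < n \<Longrightarrow> p i < p (Suc i)" "s \<in> {p 0<..p n}"
  shows "\<exists>i<n. \<forall>j<n. s \<in> {p j<..p (Suc j)} \<longleftrightarrow> j = i"
  using assms
proof (induction n)
  case (Suc n)
  have mono: "p j \<le> p k" if "j \<le> k" "k \<le> Suc n" for j k
    using that
  proof (induction k rule: dec_induct)
    case (step k)
    then show ?case using Suc.prems(1)[of k] by simp
  qed simp
  show ?case
  proof (cases "s \<le> p n")
    case True
    then obtain i where i: "i < n" "\<forall>j<n. s \<in> {p j<..p (Suc j)} \<longleftrightarrow> j = i" using Suc by auto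
    show ?thesis
    proof (intro exI[of _ i] conjI allI impI)
      show "i < Suc n" using i by simp
      fix j assume "j < Suc n"
      then consider "j < n" | "j = n" by linarith
      then show "s \<in> {p j<..p (Suc j)} \<longleftrightarrow> j = i" using i True by cases auto
    qed
  next
    case False
    show ?thesis
    proof (intro exI[of _ n] conjI allI impI)
      fix j assume "j < Suc n"
      then consider "j < n" | "j = n" by linarith
      then show "s \<in> {p j<..p (Suc j)} \<longleftrightarrow> j = n"
      proof cases
        case 1
        then have "p (Suc j) \<le> p n" by (intro mono) auto
        then show ?thesis using False 1 by auto
      next
        case 2
        then show ?thesis using False Suc.prems(2) by auto
      qed
    qed simp
  qed
qed simp

text \<open>\<theta> = 0 samples f at the left end of the cell that contains s, \<theta> = 1 at the
  right end. Both occur: the Z term is weighted at left ends, the drift and the G term at right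
  ends.\<close>

lemma grid_sum_tendsto:
  fixes f :: "real \<Rightarrow> real"
  assumes t: "0 \<le> t" "t < T" and f: "continuous_on {0..T} f" and \<theta>: "\<theta> \<le> Suc 0"
  shows "(\<lambda>n. \<Sum>i<Suc n. indicator {grid t T n i<..grid t T n (Suc i)} s * f (grid t T n (i + \<theta>))) \<longlonglongrightarrow>
    indicator {t<..T} s * f s"
proof (cases "s \<in> {t<..T}")
  case True
  have "\<exists>i<Suc n. \<forall>j<Suc n. s \<in> {grid t T n j<..grid t T n (Suc j)} \<longleftrightarrow> j = i" for n
    using grid_simps[OF t(2)] True by (intro partition_point) auto
  then obtain I where I: "\<And>n. I n < Suc n"
    "\<And>n j. j < Suc n \<Longrightarrow> s \<in> {grid t T n j<..grid t T n (Suc j)} \<longleftrightarrow> j = I n" by metis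
  have eq: "(\<Sum>i<Suc n. indicator {grid t T n i<..grid t T n (Suc i)} s * f (grid t T n (i + \<theta>)))
      = f (grid t T n (I n + \<theta>))" for n
  proof -
    have "(\<Sum>i<Suc n. indicator {grid t T n i<..grid t T n (Suc i)} s * f (grid t T n (i + \<theta>)))
      = (\<Sum>i<Suc n. if i = I n then f (grid t T n (i + \<theta>)) else 0)"
      using I(2)[of _ n] by (intro sum.cong) (auto simp: indicator_def)
    also have "\<dots> = f (grid t T n (I n + \<theta>))" using I(1)[of n] by (simp del: sum.lessThan_Suc)
    finally show ?thesis .
  qed
  have near: "\<bar>grid t T n (I n + \<theta>) - s\<bar> \<le> (T - t) / real (Suc n)" for n
  proof -
    have "s \<in> {grid t T n (I n)<..grid t T n (Suc (I n))}" using I by blast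
    moreover have "grid t T n (Suc (I n)) - grid t T n (I n) = (T - t) / real (Suc n)"
      by (rule grid_simps(3)[OF t(2)])
    moreover have "I n + \<theta> = I n \<or> I n + \<theta> = Suc (I n)" using \<theta> by linarith
    ultimately show ?thesis by auto
  qed
  have "(\<lambda>n. (T - t) / real (Suc n)) \<longlonglongrightarrow> 0"
    by (rule real_tendsto_divide_at_top[OF tendsto_const])
      (rule filterlim_compose[OF filterlim_real_sequentially filterlim_Suc])
  then have "(\<lambda>n. grid t T n (I n + \<theta>) - s) \<longlonglongrightarrow> 0"
    by (rule Lim_null_comparison[rotated]) (use near in auto)
  then have lim: "(\<lambda>n. grid t T n (I n + \<theta>)) \<longlonglongrightarrow> s" by (rule LIM_zero_cancel)
  have in_dom: "grid t T n (I n + \<theta>) \<in> {0..T}" for n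
    using grid_simps(5)[OF t(2), of n "I n + \<theta>"] grid_simps(6)[OF t(2), of "I n + \<theta>" n] I(1)[of n] \<theta> t by auto
  have "(\<lambda>n. f (grid t T n (I n + \<theta>))) \<longlonglongrightarrow> f s"
    by (rule continuous_on_tendsto_compose[OF f lim]) (use True t in_dom in auto)
  then show ?thesis unfolding eq using True by simp
next
  case False
  have "(\<Sum>i<Suc n. indicator {grid t T n i<..grid t T n (Suc i)} s * f (grid t T n (i + \<theta>))) = 0" for n
  proof (intro sum.neutral ballI)
    fix i assume i: "i \<in> {..<Suc n}"
    have "s \<notin> {grid t T n i<..grid t T n (Suc i)}"
      using False grid_simps(5)[OF t(2), of n i] grid_simps(6)[OF t(2), of "Suc i" n] i by auto
    then show "indicator {grid t T n i<..grid t T n (Suc i)} s * f (grid t T n (i + \<theta>)) = 0" by simp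
  qed
  then show ?thesis using False by simp
qed

text \<open>Clamping extends f continuously to the line, where the rationals are dense. The end
  point T, possibly irrational, is the clamped image of every larger rational.\<close>

lemma clamp_rational_bound:
  fixes f :: "real \<Rightarrow> real"
  assumes T: "0 \<le> T" and f: "continuous_on {0..T} f" and le: "\<And>q. q \<in> \<rat> \<Longrightarrow> f (max 0 (min T q)) \<le> c" and t: "t \<in> {0..T}"
  shows "f t \<le> c"
proof -
  have "continuous_on UNIV (\<lambda>q. f (max 0 (min T q)))"
    by (intro continuous_on_compose2[OF f] continuous_intros) (use T in auto)
  then have "f (max 0 (min T t)) \<le> c"
    using continuous_le_on_closure[of \<rat> "\<lambda>q. f (max 0 (min T q))" t c] le by (simp add: Rats_closure_real)
  then show ?thesis using t by simp
qed

text \<open>The pointwise inequality behind Gronwall. The G term consumes the fraction (1 + \<eta>)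
  \<alpha> of what the Z term gains; the surplus, \<kappa> times
  \<open>pos_cube'' x * z\<^sup>2\<close>, pays for the z-part of the drift. For x \<le> 0 all
  derivatives of \<open>pos_cube\<close> vanish.\<close>

lemma pos_cube_drift_bound:
  assumes "0 \<le> L" "0 \<le> C" "0 \<le> \<eta>" "0 < \<kappa>" and \<kappa>: "2 * \<kappa> = 1 - (1 + \<eta>) * \<alpha>"
    and f: "0 < x \<Longrightarrow> f \<le> L * (\<bar>x\<bar> + z)" and g: "0 < x \<Longrightarrow> g \<le> C * x\<^sup>2 + \<alpha> * z\<^sup>2"
  shows "pos_cube' x * f + (1 + \<eta>) / 2 * (pos_cube'' x * g) - 1 / 2 * (pos_cube'' x * z\<^sup>2)
    \<le> (3 * L + 3 * (1 + \<eta>) * C + L\<^sup>2 / (2 * \<kappa>)) * pos_cube x"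
proof (cases "0 < x")
  case True
  note nn = pos_cube_nonneg[of x] pos_cube'_nonneg[of x] pos_cube''_bounds(1)[of x]
  have 1: "pos_cube' x * f \<le> pos_cube' x * (L * (\<bar>x\<bar> + z))"
    using f[OF True] nn by (intro mult_left_mono)
  have 2: "pos_cube' x * (L * \<bar>x\<bar>) \<le> 3 * L * pos_cube x"
    using mult_left_mono[OF pos_cube'_times[of x] assms(1)] by (simp add: mult_ac)
  have 3: "pos_cube' x * (L * z) \<le> \<kappa> * (pos_cube'' x * z\<^sup>2) + L\<^sup>2 / (2 * \<kappa>) * pos_cube x"
  proof -
    \<comment> \<open>Balanced so that \<open>4 * a * b\<close> is exactly the bound that
      \<open>pos_cube'_square\<close> gives; the rest is the inequality between arithmetic and
      geometric means.\<close>
    define a b where "a = \<kappa> * (pos_cube'' x * z\<^sup>2)" and "b = L\<^sup>2 / (2 * \<kappa>) * pos_cube x"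
    have ab: "0 \<le> a" "0 \<le> b" using nn assms by (auto simp: a_def b_def)
    have "(pos_cube' x * (L * z))\<^sup>2 = (pos_cube' x)\<^sup>2 * (L\<^sup>2 * z\<^sup>2)" by (simp add: power_mult_distrib)
    also have "\<dots> \<le> (2 * pos_cube x * pos_cube'' x) * (L\<^sup>2 * z\<^sup>2)"
      by (intro mult_right_mono pos_cube'_square) auto
    also have "\<dots> = 4 * a * b" using assms(4) by (simp add: a_def b_def)
    also have "\<dots> \<le> (a + b)\<^sup>2" using sum_squares_bound[of a b] by (simp add: power2_sum)
    finally show ?thesis using ab power2_le_imp_le[of "pos_cube' x * (L * z)" "a + b"] by (simp add: a_def b_def)
  qed
  have 4: "(1 + \<eta>) / 2 * (pos_cube'' x * g) \<le> (1 + \<eta>) / 2 * (pos_cube'' x * (C * x\<^sup>2 + \<alpha> * z\<^sup>2))"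
    using g[OF True] nn assms(3) by (intro mult_left_mono) auto
  have 5: "(1 + \<eta>) / 2 * (pos_cube'' x * (C * x\<^sup>2)) \<le> 3 * (1 + \<eta>) * C * pos_cube x"
  proof -
    have "(1 + \<eta>) / 2 * C * (pos_cube'' x * x\<^sup>2) \<le> (1 + \<eta>) / 2 * C * (6 * pos_cube x)"
      using assms pos_cube''_square[of x] by (intro mult_left_mono) auto
    then show ?thesis by (simp add: mult_ac)
  qed
  have 6: "\<kappa> * (pos_cube'' x * z\<^sup>2) = 1 / 2 * (pos_cube'' x * z\<^sup>2) - (1 + \<eta>) / 2 * (pos_cube'' x * (\<alpha> * z\<^sup>2))"
  proof -
    have k: "\<kappa> = 1 / 2 - (1 + \<eta>) / 2 * \<alpha>" using \<kappa> by (simp add: field_simps)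
    show ?thesis unfolding k by (simp add: algebra_simps)
  qed
  have "pos_cube' x * (L * (\<bar>x\<bar> + z)) = pos_cube' x * (L * \<bar>x\<bar>) + pos_cube' x * (L * z)"
    "pos_cube'' x * (C * x\<^sup>2 + \<alpha> * z\<^sup>2) = pos_cube'' x * (C * x\<^sup>2) + pos_cube'' x * (\<alpha> * z\<^sup>2)"
    by (simp_all add: distrib_left)
  then have 7: "(1 + \<eta>) / 2 * (pos_cube'' x * (C * x\<^sup>2 + \<alpha> * z\<^sup>2)) =
     (1 + \<eta>) / 2 * (pos_cube'' x * (C * x\<^sup>2)) + (1 + \<eta>) / 2 * (pos_cube'' x * (\<alpha> * z\<^sup>2))"
    "pos_cube' x * (L * (\<bar>x\<bar> + z)) = pos_cube' x * (L * \<bar>x\<bar>) + pos_cube' x * (L * z)"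
    by (simp_all add: distrib_left)
  show ?thesis using 1 2 3 4 5 6 7 unfolding distrib_right by linarith
qed (simp add: pos_cube_def pos_cube'_def pos_cube''_def)

text \<open>Integrating the exponential divides it by r, up to a negative term; this division is the
  gain in each Gronwall iteration.\<close>

lemma exp_gronwall_integral:
  fixes T t r :: real
  assumes "0 < r" "t \<le> T"
  shows "has_bochner_integral lborel (\<lambda>s. indicator {t<..T} s * exp (r * (T - s))) ((exp (r * (T - t)) - 1) / r)"
proof -
  have "has_bochner_integral lborel (\<lambda>s. exp (r * (T - s)) * indicator {t..T} s)
      (- exp (r * (T - T)) / r - - exp (r * (T - t)) / r)"
    by (rule has_bochner_integral_FTC_Icc_real[where F="\<lambda>s. - exp (r * (T - s)) / r"])
      (use assms in \<open>auto intro!: derivative_eq_intros continuous_intros\<close>)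
  then have 1: "has_bochner_integral lborel (\<lambda>s. exp (r * (T - s)) * indicator {t..T} s) ((exp (r * (T - t)) - 1) / r)"
    by (simp add: diff_divide_distrib)
  have "AE s in lborel. exp (r * (T - s)) * indicator {t..T} s = indicator {t<..T} s * exp (r * (T - s))"
    using AE_lborel_singleton[of t] by eventually_elim (auto simp: indicator_def)
  moreover have "(\<lambda>s. exp (r * (T - s)) * indicator {t..T} s) \<in> borel_measurable lborel"
    "(\<lambda>s. indicator {t<..T} s * exp (r * (T - s))) \<in> borel_measurable lborel"
    by measurable
  ultimately show ?thesis using 1 has_bochner_integral_cong_AE by blast
qed

section \<open>The one-step inequality\<close>

text \<open>\<open>pos_cube (x + z)\<close> and \<open>pos_cube (y + (g + f))\<close> are the same
  number, bounded below by expansion around x and above by expansion around y. Young's inequality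
  splits the product of g and f at the expense of f, whose square is of higher order in the mesh.
  The constants are 25 + 1/\<eta> = (1 + 1/\<eta>) + 6 * 4 and 48 = 6 * 8, where 4 and 8 come from
  \<open>min_square_cube_add\<close>.\<close>

lemma pos_cube_step:
  assumes \<eta>: "0 < \<eta>" and x: "x = y + f + g - z"
  shows "pos_cube x \<le> pos_cube y + pos_cube' y * f + pos_cube' y * g + (1 + \<eta>) / 2 * (pos_cube'' y * g\<^sup>2)
    - pos_cube' x * z - 1 / 2 * (pos_cube'' x * z\<^sup>2) + (25 + 1 / \<eta>) * f\<^sup>2
    + 6 * min_square_cube z + 48 * min_square_cube g"
proof -
  have 1: "pos_cube x + pos_cube' x * z + pos_cube'' x / 2 * z\<^sup>2 - 6 * min_square_cube z \<le> pos_cube (x + z)"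
    using pos_cube_taylor[of x z] by linarith
  have "x + z = y + (g + f)" using x by simp
  then have 2: "pos_cube (x + z) \<le> pos_cube y + pos_cube' y * (g + f) + pos_cube'' y / 2 * (g + f)\<^sup>2 + 6 * min_square_cube (g + f)"
    using pos_cube_taylor[of y "g + f"] by simp
  have 3: "min_square_cube (g + f) \<le> 8 * min_square_cube g + 4 * f\<^sup>2" by (rule min_square_cube_add)
  have "0 \<le> (\<eta> * g - f)\<^sup>2 / \<eta>" using \<eta> by simp
  also have "(\<eta> * g - f)\<^sup>2 / \<eta> = \<eta> * g\<^sup>2 - 2 * g * f + f\<^sup>2 / \<eta>"
    using \<eta> by (simp add: power2_eq_square field_simps)
  finally have "(g + f)\<^sup>2 \<le> (1 + \<eta>) * g\<^sup>2 + (1 + 1 / \<eta>) * f\<^sup>2"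
    by (simp add: power2_eq_square algebra_simps)
  then have "pos_cube'' y / 2 * (g + f)\<^sup>2 \<le> pos_cube'' y / 2 * ((1 + \<eta>) * g\<^sup>2 + (1 + 1 / \<eta>) * f\<^sup>2)"
    using pos_cube''_bounds(1)[of y] by (intro mult_left_mono) auto
  also have "\<dots> = (1 + \<eta>) / 2 * (pos_cube'' y * g\<^sup>2) + pos_cube'' y / 2 * ((1 + 1 / \<eta>) * f\<^sup>2)"
    by (simp add: algebra_simps add_divide_distrib)
  also have "pos_cube'' y / 2 * ((1 + 1 / \<eta>) * f\<^sup>2) \<le> 1 * ((1 + 1 / \<eta>) * f\<^sup>2)"
    using pos_cube''_bounds(2)[of y] \<eta> by (intro mult_right_mono) auto
  finally have 4: "pos_cube'' y / 2 * (g + f)\<^sup>2 \<le> (1 + \<eta>) / 2 * (pos_cube'' y * g\<^sup>2) + (1 + 1 / \<eta>) * f\<^sup>2" by simp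
  have 5: "(25 + 1 / \<eta>) * f\<^sup>2 = (1 + 1 / \<eta>) * f\<^sup>2 + 24 * f\<^sup>2" by (simp add: algebra_simps)
  have 6: "pos_cube' y * (g + f) = pos_cube' y * f + pos_cube' y * g" by (simp add: algebra_simps)
  have 7: "pos_cube'' x / 2 * z\<^sup>2 = 1 / 2 * (pos_cube'' x * z\<^sup>2)" by simp
  show ?thesis using 1 2 3 4 unfolding 5 6 7 by linarith
qed

section \<open>Integrability of the terms of the expansion, and the drift integral\<close>

lemma min_square_cube_measurable [measurable]: "min_square_cube \<in> borel_measurable borel"
  unfolding min_square_cube_def[abs_def] by measurable

lemma sq_int_compose_le:
  fixes f :: "'a \<Rightarrow> real"
  assumes f: "sq_int N f" and h: "h \<in> borel_measurable borel" "\<And>y. 0 \<le> h y" "\<And>y. h y \<le> y\<^sup>2"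
  shows "integrable N (\<lambda>x. h (f x) :: real)"
proof (rule Bochner_Integration.integrable_bound[OF sq_int_integrable[OF f]])
  show "(\<lambda>x. h (f x)) \<in> borel_measurable N"
    using measurable_compose[OF sq_int_measurable[OF f] h(1)] .
qed (use h in auto)

context brownian_pair
begin

abbreviation PL :: "('a \<times> real) measure" where "PL \<equiv> M \<Otimes>\<^sub>M lborel"

definition drift_int :: "('a \<times> real \<Rightarrow> real) \<Rightarrow> real \<Rightarrow> real \<Rightarrow> 'a \<Rightarrow> real" where
  "drift_int F a b \<omega> = (\<integral>s. indicator {a<..b} s * F (\<omega>, s) \<partial>lborel)"

text \<open>Cauchy-Schwarz in the time variable yields the factor b - a, so the squared drifts of
  the cells of a partition add up to the order of the mesh.\<close>

lemma drift_int:
  assumes F: "sq_int PL F" and ab: "a \<le> b"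
  shows drift_int_sq_int: "sq_int M (drift_int F a b)"
    and drift_int_square: "(\<integral>\<omega>. (drift_int F a b \<omega>)\<^sup>2 \<partial>M) \<le> (b - a) * (\<integral>x. indicator {a<..b} (snd x) * (F x)\<^sup>2 \<partial>PL)"
    and drift_int_section: "AE \<omega> in M. integrable lborel (\<lambda>s. indicator {a<..b} s * F (\<omega>, s))"
proof -
  have [measurable]: "F \<in> borel_measurable PL" using F by (rule sq_int_measurable)
  have F2: "integrable PL (\<lambda>x. (F x)\<^sup>2)" using sq_int_integrable[OF F] by simp
  have i2: "integrable PL (\<lambda>x. indicator {a<..b} (snd x) * (F x)\<^sup>2)"
    by (rule Bochner_Integration.integrable_bound[OF F2]) (auto simp: indicator_def)
  define q where "q \<omega> = (\<integral>s. indicator {a<..b} s * (F (\<omega>, s))\<^sup>2 \<partial>lborel)" for \<omega>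
  have iq: "integrable M q" "(\<integral>\<omega>. q \<omega> \<partial>M) = (\<integral>x. indicator {a<..b} (snd x) * (F x)\<^sup>2 \<partial>PL)"
    using fwd.P.integrable_fst'[OF i2] fwd.P.integral_fst'[OF i2] by (simp_all add: q_def[abs_def])
  \<comment> \<open>Almost every section of F is square integrable on (a, b]; its integrability and
    the bound on its integral are obtained together on that set.\<close>
  have sec: "AE \<omega> in M. integrable lborel (\<lambda>s. indicator {a<..b} s * F (\<omega>, s)) \<and> (drift_int F a b \<omega>)\<^sup>2 \<le> (b - a) * q \<omega>"
    using fwd.P.AE_integrable_fst'[OF i2] AE_space
  proof eventually_elim
    case (elim \<omega>)
    then have [measurable]: "(\<lambda>s. F (\<omega>, s)) \<in> borel_measurable lborel" by simp
    have e: "(indicator {a<..b} s * F (\<omega>, s))\<^sup>2 = indicator {a<..b} s * (F (\<omega>, s))\<^sup>2" for s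
      by (simp add: power2_eq_square indicator_def)
    have s1: "sq_int lborel (\<lambda>s. indicator {a<..b} s * F (\<omega>, s))"
      using elim(1) by (simp add: sq_int_def e)
    have s2: "sq_int lborel (\<lambda>s. indicator {a<..b} s :: real)"
    proof -
      have "(\<lambda>s. (norm (indicator {a<..b} s :: real))\<^sup>2) = indicator {a<..b}" by (auto simp: indicator_def)
      then show ?thesis using ab by (simp add: sq_int_def integrable_real_indicator)
    qed
    have i: "indicator {a<..b} s * (indicator {a<..b} s * F (\<omega>, s)) = indicator {a<..b} s * F (\<omega>, s)" for s
      by (simp add: indicator_def)
    have "(\<integral>s. (norm (indicator {a<..b} s :: real))\<^sup>2 \<partial>lborel) = (\<integral>s. indicator {a<..b} s \<partial>lborel)"
      by (intro Bochner_Integration.integral_cong) (auto simp: indicator_def)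
    then have n: "(\<integral>s. (norm (indicator {a<..b} s :: real))\<^sup>2 \<partial>lborel) = b - a" using ab by simp
    have q0: "0 \<le> q \<omega>" unfolding q_def by (intro integral_nonneg_AE) auto
    have "\<bar>drift_int F a b \<omega>\<bar> \<le> sqrt (b - a) * sqrt (q \<omega>)"
      using sq_int_inner_cauchy_schwarz[OF s2 s1] n by (simp add: i e drift_int_def q_def)
    then have "\<bar>drift_int F a b \<omega>\<bar>\<^sup>2 \<le> (sqrt (b - a) * sqrt (q \<omega>))\<^sup>2" by (intro power_mono) auto
    then have "(drift_int F a b \<omega>)\<^sup>2 \<le> (b - a) * q \<omega>" using ab q0 by (simp add: power_mult_distrib)
    moreover have "integrable lborel (\<lambda>s. indicator {a<..b} s * F (\<omega>, s))"
      using sq_int_mult[OF s2 s1] by (simp add: i)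
    ultimately show ?case by simp
  qed
  then show "AE \<omega> in M. integrable lborel (\<lambda>s. indicator {a<..b} s * F (\<omega>, s))" by auto
  have m: "drift_int F a b \<in> borel_measurable M"
    unfolding drift_int_def[abs_def] by measurable
  have ib: "integrable M (\<lambda>\<omega>. (b - a) * q \<omega>)" using iq by simp
  have i: "integrable M (\<lambda>\<omega>. (drift_int F a b \<omega>)\<^sup>2)"
    by (rule Bochner_Integration.integrable_bound[OF ib]) (use m sec in auto)
  then show "sq_int M (drift_int F a b)" using m by (simp add: sq_int_def)
  have "(\<integral>\<omega>. (drift_int F a b \<omega>)\<^sup>2 \<partial>M) \<le> (\<integral>\<omega>. (b - a) * q \<omega> \<partial>M)"
    by (rule integral_mono_AE[OF i ib]) (use sec in auto)
  then show "(\<integral>\<omega>. (drift_int F a b \<omega>)\<^sup>2 \<partial>M) \<le> (b - a) * (\<integral>x. indicator {a<..b} (snd x) * (F x)\<^sup>2 \<partial>PL)"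
    using iq by simp
qed

lemma sq_int_PL_indicator:
  assumes "sq_int M (A :: 'a \<Rightarrow> real)" "a \<le> b"
  shows "sq_int PL (\<lambda>x. indicator {a<..b} (snd x) * A (fst x))"
proof -
  have [measurable]: "A \<in> borel_measurable M" using assms by (simp add: sq_int_def)
  have A2: "integrable M (\<lambda>\<omega>. (A \<omega>)\<^sup>2)" using sq_int_integrable[OF assms(1)] by simp
  have "integrable lborel (indicator {a<..b} :: real \<Rightarrow> real)" using assms(2) by (intro integrable_real_indicator) auto
  from fwd.P.has_bochner_integral_pair_mult[OF A2 this]
  have "integrable PL (\<lambda>x. (A (fst x))\<^sup>2 * indicator {a<..b} (snd x))" by (simp add: has_bochner_integral_iff)
  moreover have "(norm (indicator {a<..b} (snd x) * A (fst x)))\<^sup>2 = (A (fst x))\<^sup>2 * indicator {a<..b} (snd x)" for x :: "'a \<times> real"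
    by (simp add: indicator_def)
  ultimately show ?thesis by (simp add: sq_int_def)
qed

lemma drift_int_weighted:
  assumes F: "sq_int PL F" and A: "sq_int M A" and ab: "a \<le> b"
  shows "integrable PL (\<lambda>x. indicator {a<..b} (snd x) * (A (fst x) * F x))"
    "(\<integral>\<omega>. A \<omega> * drift_int F a b \<omega> \<partial>M) = (\<integral>x. indicator {a<..b} (snd x) * (A (fst x) * F x) \<partial>PL)"
proof -
  show i: "integrable PL (\<lambda>x. indicator {a<..b} (snd x) * (A (fst x) * F x))"
    using sq_int_mult[OF sq_int_PL_indicator[OF A ab] F] by (simp add: mult.assoc)
  have "(\<integral>x. indicator {a<..b} (snd x) * (A (fst x) * F x) \<partial>PL)
    = (\<integral>\<omega>. (\<integral>s. A \<omega> * (indicator {a<..b} s * F (\<omega>, s)) \<partial>lborel) \<partial>M)"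
    using fwd.P.integral_fst'[OF i] by (simp add: mult_ac)
  also have "\<dots> = (\<integral>\<omega>. A \<omega> * drift_int F a b \<omega> \<partial>M)"
    by (simp add: drift_int_def)
  finally show "(\<integral>\<omega>. A \<omega> * drift_int F a b \<omega> \<partial>M) = (\<integral>x. indicator {a<..b} (snd x) * (A (fst x) * F x) \<partial>PL)" ..
qed

lemma bd_measurable:
  assumes "X \<in> borel_measurable (bd_sigma M T W B t)" "0 \<le> t" "t \<le> T"
  shows "X \<in> borel_measurable M" "X \<in> borel_measurable (fwd_sigma M T W B t)" "X \<in> borel_measurable (bwd_sigma M T W B t)"
  using assms(1) bd_sigma_subset[OF assms(2,3)] space_sigmas[OF assms(2,3)]
  by (auto elim!: measurable_sub_sigma)

lemma sq_int_pos_cube':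
  assumes "sq_int N d"
  shows "sq_int N (\<lambda>x. pos_cube' (d x))"
proof (rule sq_int_bound[OF sq_int_scaleR[OF assms, of 2]])
  show "(\<lambda>x. pos_cube' (d x)) \<in> borel_measurable N"
    using sq_int_measurable[OF assms] by measurable
  show "AE x in N. norm (pos_cube' (d x)) \<le> norm (2 *\<^sub>R d x)"
    using pos_cube'_le pos_cube'_nonneg by (intro AE_I2) (simp add: abs_mult)
qed

lemma integrable_pos_cube''_mult:
  assumes [measurable]: "d \<in> borel_measurable N" and f: "integrable N (f :: _ \<Rightarrow> real)"
  shows "integrable N (\<lambda>x. pos_cube'' (d x) * f x)"
proof (rule Bochner_Integration.integrable_bound)
  show "integrable N (\<lambda>x. 2 * f x)" using f by simp
  have [measurable]: "f \<in> borel_measurable N" using f by simp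
  show "(\<lambda>x. pos_cube'' (d x) * f x) \<in> borel_measurable N" by measurable
  show "AE x in N. norm (pos_cube'' (d x) * f x) \<le> norm (2 * f x)"
    using pos_cube''_bounds by (intro AE_I2) (auto simp: abs_mult intro!: mult_right_mono)
qed

lemma integrable_indicator_snd:
  assumes "integrable PL (f :: _ \<Rightarrow> real)"
  shows "integrable PL (\<lambda>x. indicator {a<..b} (snd x) * f x)"
proof (rule Bochner_Integration.integrable_bound[OF assms])
  have [measurable]: "f \<in> borel_measurable PL" using assms by simp
  show "(\<lambda>x. indicator {a<..b} (snd x) * f x) \<in> borel_measurable PL" by measurable
qed (auto simp: indicator_def)

text \<open>Both sides of the step equation are expanded around its own known endpoint: \<open>\<delta>a + IZ = \<delta>b + F + IG\<close>,
  where \<open>IZ\<close> is orthogonal to functions of \<open>\<delta>a\<close> and \<open>IG\<close> to functions of \<open>\<delta>b\<close>. No cross terms appear.\<close>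

lemma one_step:
  assumes ab: "0 \<le> a" "a < b" "b \<le> T" and \<eta>: "0 < \<eta>"
    and da: "\<delta>a \<in> borel_measurable (bd_sigma M T W B a)" "sq_int M \<delta>a"
    and db: "\<delta>b \<in> borel_measurable (bd_sigma M T W B b)" "sq_int M \<delta>b"
    and F: "sq_int PL F" and G: "sq_int PL G" and Z: "sq_int PL Z"
    and IG: "bwd.ito (\<lambda>x. indicator {a<..b} (snd x) *\<^sub>R G x) IG"
    and IZ: "fwd.ito (\<lambda>x. indicator {a<..b} (snd x) *\<^sub>R Z x) IZ"
    and eq: "AE \<omega> in M. \<delta>a \<omega> = \<delta>b \<omega> + drift_int F a b \<omega> + IG \<omega> - IZ \<omega>"
  shows "(\<integral>\<omega>. pos_cube (\<delta>a \<omega>) \<partial>M) \<le> (\<integral>\<omega>. pos_cube (\<delta>b \<omega>) \<partial>M)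
    + (\<integral>x. indicator {a<..b} (snd x) * (pos_cube' (\<delta>b (fst x)) * F x) \<partial>PL)
    + (1 + \<eta>) / 2 * (\<integral>x. indicator {a<..b} (snd x) * (pos_cube'' (\<delta>b (fst x)) * (norm (G x))\<^sup>2) \<partial>PL)
    - 1 / 2 * (\<integral>x. indicator {a<..b} (snd x) * (pos_cube'' (\<delta>a (fst x)) * (norm (Z x))\<^sup>2) \<partial>PL)
    + (25 + 1 / \<eta>) * ((b - a) * (\<integral>x. indicator {a<..b} (snd x) * (F x)\<^sup>2 \<partial>PL))
    + 6 * (\<integral>\<omega>. min_square_cube (IZ \<omega>) \<partial>M) + 48 * (\<integral>\<omega>. min_square_cube (IG \<omega>) \<partial>M)"
proof -
  have a: "0 \<le> a" "a \<le> T" and b: "0 \<le> b" "b \<le> T" and ab': "a \<le> b" using ab by auto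
  note [measurable] = bd_measurable(1)[OF da(1) a] bd_measurable(1)[OF db(1) b]
  have sG: "sq_int M IG" and sZ: "sq_int M IZ" using bwd.ito_sq_int(2)[OF IG] fwd.ito_sq_int(2)[OF IZ] by auto
  have supp: "snd x \<notin> {a<..b} \<Longrightarrow> indicator {a<..b} (snd x) *\<^sub>R v = 0" for x :: "'a \<times> real" and v :: "'v::real_vector"
    by simp
  define D where "D = drift_int F a b"
  have sD: "sq_int M D" unfolding D_def by (rule drift_int_sq_int[OF F ab'])
  have ind: "(norm (indicator {a<..b} s *\<^sub>R v))\<^sup>2 = indicator {a<..b} s * (norm v)\<^sup>2" for s :: real and v :: "'v::real_normed_vector"
    by (simp add: indicator_def)
  \<comment> \<open>\<open>pos_cube''\<close> is bounded, hence an admissible weight: at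
    \<open>\<delta>a\<close> for the forward noise, at \<open>\<delta>b\<close> for the backward
    one.\<close>
  have cb: "fwd.coef a b (\<lambda>\<omega>. pos_cube'' (\<delta>a \<omega>))" "bwd.coef a b (\<lambda>\<omega>. pos_cube'' (\<delta>b \<omega>))"
    unfolding fwd.coef_def bwd.coef_def
    using measurable_compose[OF bd_measurable(2)[OF da(1) a] pos_cube_measurable(3)]
      measurable_compose[OF bd_measurable(3)[OF db(1) b] pos_cube_measurable(3)] pos_cube''_bounds
    by (auto intro!: exI[of _ 2])
  \<comment> \<open>\<open>pos_cube'\<close> grows linearly, so bounded weights do not suffice and
    \<open>ito_orthogonal\<close> takes over.\<close>
  have m1: "(\<integral>\<omega>. pos_cube' (\<delta>b \<omega>) * IG \<omega> \<partial>M) = 0"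
    by (rule bwd.ito_orthogonal[OF ab IG supp _ sq_int_pos_cube'[OF db(2)]])
      (use measurable_compose[OF bd_measurable(3)[OF db(1) b] pos_cube_measurable(2)] in auto)
  have m2: "(\<integral>\<omega>. pos_cube' (\<delta>a \<omega>) * IZ \<omega> \<partial>M) = 0"
    by (rule fwd.ito_orthogonal[OF ab IZ supp _ sq_int_pos_cube'[OF da(2)]])
      (use measurable_compose[OF bd_measurable(2)[OF da(1) a] pos_cube_measurable(2)] in auto)
  have m3: "(\<integral>\<omega>. pos_cube'' (\<delta>b \<omega>) * (IG \<omega>)\<^sup>2 \<partial>M)
     = (\<integral>x. indicator {a<..b} (snd x) * (pos_cube'' (\<delta>b (fst x)) * (norm (G x))\<^sup>2) \<partial>PL)"
  proof -
    have "(\<integral>\<omega>. pos_cube'' (\<delta>b \<omega>) * (IG \<omega>)\<^sup>2 \<partial>M)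
      = (\<integral>x. pos_cube'' (\<delta>b (fst x)) * (norm (indicator {a<..b} (snd x) *\<^sub>R G x))\<^sup>2 \<partial>PL)"
      by (rule bwd.ito_weighted(2)[OF ab IG supp cb(2)])
    then show ?thesis by (simp only: ind mult.left_commute)
  qed
  have m4: "(\<integral>\<omega>. pos_cube'' (\<delta>a \<omega>) * (IZ \<omega>)\<^sup>2 \<partial>M)
     = (\<integral>x. indicator {a<..b} (snd x) * (pos_cube'' (\<delta>a (fst x)) * (norm (Z x))\<^sup>2) \<partial>PL)"
  proof -
    have "(\<integral>\<omega>. pos_cube'' (\<delta>a \<omega>) * (IZ \<omega>)\<^sup>2 \<partial>M)
      = (\<integral>x. pos_cube'' (\<delta>a (fst x)) * (norm (indicator {a<..b} (snd x) *\<^sub>R Z x))\<^sup>2 \<partial>PL)"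
      by (rule fwd.ito_weighted(2)[OF ab IZ supp cb(1)])
    then show ?thesis by (simp only: ind mult.left_commute)
  qed
  have m5: "(\<integral>\<omega>. pos_cube' (\<delta>b \<omega>) * D \<omega> \<partial>M) = (\<integral>x. indicator {a<..b} (snd x) * (pos_cube' (\<delta>b (fst x)) * F x) \<partial>PL)"
    unfolding D_def by (rule drift_int_weighted(2)[OF F sq_int_pos_cube'[OF db(2)] ab'])
  have m6: "(\<integral>\<omega>. (D \<omega>)\<^sup>2 \<partial>M) \<le> (b - a) * (\<integral>x. indicator {a<..b} (snd x) * (F x)\<^sup>2 \<partial>PL)"
    unfolding D_def by (rule drift_int_square[OF F ab'])
  note pc = sq_int_compose_le[where h=pos_cube, OF _ pos_cube_measurable(1) pos_cube_nonneg pos_cube_le_square]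
    and mc = sq_int_compose_le[where h=min_square_cube, OF _ min_square_cube_measurable min_square_cube_nonneg min_square_cube_le(1)]
  have sq: "integrable M (\<lambda>\<omega>. (IG \<omega>)\<^sup>2)" "integrable M (\<lambda>\<omega>. (IZ \<omega>)\<^sup>2)" "integrable M (\<lambda>\<omega>. (D \<omega>)\<^sup>2)"
    using sG sZ sD by (auto simp: sq_int_def)
  note ints = pc[OF db(2)] sq_int_mult[OF sq_int_pos_cube'[OF db(2)] sD] sq_int_mult[OF sq_int_pos_cube'[OF db(2)] sG]
    integrable_pos_cube''_mult[of \<delta>b, OF _ sq(1)] sq_int_mult[OF sq_int_pos_cube'[OF da(2)] sZ]
    integrable_pos_cube''_mult[of \<delta>a, OF _ sq(2)] sq(3) mc[OF sZ] mc[OF sG]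
  let ?H = "\<lambda>\<omega>. pos_cube (\<delta>b \<omega>) + pos_cube' (\<delta>b \<omega>) * D \<omega> + pos_cube' (\<delta>b \<omega>) * IG \<omega>
      + (1 + \<eta>) / 2 * (pos_cube'' (\<delta>b \<omega>) * (IG \<omega>)\<^sup>2) - pos_cube' (\<delta>a \<omega>) * IZ \<omega> - 1 / 2 * (pos_cube'' (\<delta>a \<omega>) * (IZ \<omega>)\<^sup>2)
      + (25 + 1 / \<eta>) * (D \<omega>)\<^sup>2 + 6 * min_square_cube (IZ \<omega>) + 48 * min_square_cube (IG \<omega>)"
  have "(\<integral>\<omega>. pos_cube (\<delta>a \<omega>) \<partial>M) \<le> (\<integral>\<omega>. ?H \<omega> \<partial>M)"
  proof (rule integral_mono_AE)
    show "integrable M (\<lambda>\<omega>. pos_cube (\<delta>a \<omega>))" by (rule pc[OF da(2)])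
    show "integrable M (\<lambda>\<omega>. ?H \<omega>)"
      using ints by (intro Bochner_Integration.integrable_add Bochner_Integration.integrable_diff integrable_mult_right) simp_all
    show "AE \<omega> in M. pos_cube (\<delta>a \<omega>) \<le> ?H \<omega>"
      using eq by eventually_elim (rule pos_cube_step[OF \<eta>], simp add: D_def)
  qed
  also have "\<dots> = (\<integral>\<omega>. pos_cube (\<delta>b \<omega>) \<partial>M) + (\<integral>\<omega>. pos_cube' (\<delta>b \<omega>) * D \<omega> \<partial>M) + (\<integral>\<omega>. pos_cube' (\<delta>b \<omega>) * IG \<omega> \<partial>M)
      + (1 + \<eta>) / 2 * (\<integral>\<omega>. pos_cube'' (\<delta>b \<omega>) * (IG \<omega>)\<^sup>2 \<partial>M) - (\<integral>\<omega>. pos_cube' (\<delta>a \<omega>) * IZ \<omega> \<partial>M)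
      - 1 / 2 * (\<integral>\<omega>. pos_cube'' (\<delta>a \<omega>) * (IZ \<omega>)\<^sup>2 \<partial>M) + (25 + 1 / \<eta>) * (\<integral>\<omega>. (D \<omega>)\<^sup>2 \<partial>M)
      + 6 * (\<integral>\<omega>. min_square_cube (IZ \<omega>) \<partial>M) + 48 * (\<integral>\<omega>. min_square_cube (IG \<omega>) \<partial>M)"
    using ints by (simp del: times_divide_eq_left)
  finally have calc: "(\<integral>\<omega>. pos_cube (\<delta>a \<omega>) \<partial>M) \<le> \<dots>" .
  show ?thesis
  proof -
    have "0 \<le> 25 + 1 / \<eta>" using \<eta> by simp
    from mult_left_mono[OF m6 this] calc show ?thesis unfolding m1 m2 m3 m4 m5 by linarith
  qed
qed

end

section \<open>Passage to the limit and Gronwall\<close>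

context brownian_pair
begin

text \<open>The limit also yields joint measurability of a process given as measurable at each time
  and continuous in time, since it is a pointwise limit of processes that are constant on the
  cells.\<close>

lemma grid_process_limit:
  fixes \<delta> :: "real \<Rightarrow> 'a \<Rightarrow> real"
  assumes t: "0 \<le> t" "t < T" and \<theta>: "\<theta> \<le> Suc 0"
    and \<delta>: "\<And>u. u \<in> {0..T} \<Longrightarrow> \<delta> u \<in> borel_measurable M"
    and cont: "\<And>\<omega>. \<omega> \<in> space M \<Longrightarrow> continuous_on {0..T} (\<lambda>u. \<delta> u \<omega>)"
    and \<psi>: "continuous_on UNIV (\<psi> :: real \<Rightarrow> real)" and [measurable]: "H \<in> borel_measurable PL"
  shows "(\<lambda>x. \<Sum>i<Suc n. indicator {grid t T n i<..grid t T n (Suc i)} (snd x) *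
      (\<psi> (\<delta> (grid t T n (i + \<theta>)) (fst x)) * H x)) \<in> borel_measurable PL"
    and "x \<in> space PL \<Longrightarrow> (\<lambda>n. \<Sum>i<Suc n. indicator {grid t T n i<..grid t T n (Suc i)} (snd x) *
      (\<psi> (\<delta> (grid t T n (i + \<theta>)) (fst x)) * H x)) \<longlonglongrightarrow> indicator {t<..T} (snd x) * (\<psi> (\<delta> (snd x) (fst x)) * H x)"
    and "(\<lambda>x. indicator {t<..T} (snd x) * (\<psi> (\<delta> (snd x) (fst x)) * H x)) \<in> borel_measurable PL"
proof -
  have [measurable]: "\<psi> \<in> borel_measurable borel" using \<psi> by (rule borel_measurable_continuous_onI)
  show m: "(\<lambda>x. \<Sum>i<Suc n. indicator {grid t T n i<..grid t T n (Suc i)} (snd x) *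
      (\<psi> (\<delta> (grid t T n (i + \<theta>)) (fst x)) * H x)) \<in> borel_measurable PL" for n
  proof (rule borel_measurable_sum)
    fix i assume "i \<in> {..<Suc n}"
    then have "grid t T n (i + \<theta>) \<in> {0..T}"
      using grid_simps(5)[OF t(2), of n "i + \<theta>"] grid_simps(6)[OF t(2), of "i + \<theta>" n] \<theta> t by auto
    note [measurable] = \<delta>[OF this]
    show "(\<lambda>x. indicator {grid t T n i<..grid t T n (Suc i)} (snd x) *
      (\<psi> (\<delta> (grid t T n (i + \<theta>)) (fst x)) * H x)) \<in> borel_measurable PL" by measurable
  qed
  show lim: "(\<lambda>n. \<Sum>i<Suc n. indicator {grid t T n i<..grid t T n (Suc i)} (snd x) *
      (\<psi> (\<delta> (grid t T n (i + \<theta>)) (fst x)) * H x)) \<longlonglongrightarrow> indicator {t<..T} (snd x) * (\<psi> (\<delta> (snd x) (fst x)) * H x)"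
    if "x \<in> space PL" for x
  proof -
    have "fst x \<in> space M" using that by (auto simp: space_pair_measure)
    then have "continuous_on {0..T} (\<lambda>u. \<psi> (\<delta> u (fst x)))"
      by (intro continuous_on_compose2[OF \<psi> cont]) auto
    from tendsto_mult_right[OF grid_sum_tendsto[OF t this \<theta>, of "snd x"], of "H x"]
    show ?thesis by (simp only: sum_distrib_right mult.assoc)
  qed
  show "(\<lambda>x. indicator {t<..T} (snd x) * (\<psi> (\<delta> (snd x) (fst x)) * H x)) \<in> borel_measurable PL"
    by (rule borel_measurable_LIMSEQ_real[OF lim m])
qed

text \<open>The majorant has to be uniform in the sampling time u, because \<delta> is evaluated at
  an end point of the cell that contains \<open>snd x\<close>, not at \<open>snd x\<close>
  itself.\<close>

lemma grid_integral_tendsto: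
  fixes \<delta> :: "real \<Rightarrow> 'a \<Rightarrow> real"
  assumes t: "0 \<le> t" "t < T" and \<theta>: "\<theta> \<le> Suc 0"
    and \<delta>: "\<And>u. u \<in> {0..T} \<Longrightarrow> \<delta> u \<in> borel_measurable M"
    and cont: "\<And>\<omega>. \<omega> \<in> space M \<Longrightarrow> continuous_on {0..T} (\<lambda>u. \<delta> u \<omega>)"
    and \<psi>: "continuous_on UNIV (\<psi> :: real \<Rightarrow> real)" and H: "H \<in> borel_measurable PL"
    and w: "integrable PL w" "\<And>x u. x \<in> space PL \<Longrightarrow> u \<in> {0..T} \<Longrightarrow> \<bar>\<psi> (\<delta> u (fst x)) * H x\<bar> \<le> w x"
  shows "(\<lambda>n. \<Sum>i<Suc n. \<integral>x. indicator {grid t T n i<..grid t T n (Suc i)} (snd x) *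
      (\<psi> (\<delta> (grid t T n (i + \<theta>)) (fst x)) * H x) \<partial>PL) \<longlonglongrightarrow>
      (\<integral>x. indicator {t<..T} (snd x) * (\<psi> (\<delta> (snd x) (fst x)) * H x) \<partial>PL)"
    and "integrable PL (\<lambda>x. indicator {t<..T} (snd x) * (\<psi> (\<delta> (snd x) (fst x)) * H x))"
proof -
  note g = grid_process_limit[OF t \<theta> \<delta> cont \<psi> H]
  have [measurable]: "\<psi> \<in> borel_measurable borel" "H \<in> borel_measurable PL"
    using \<psi> H by (auto intro: borel_measurable_continuous_onI)
  have dom: "grid t T n (i + \<theta>) \<in> {0..T}" if "i < Suc n" for n i
    using grid_simps(5)[OF t(2), of n "i + \<theta>"] grid_simps(6)[OF t(2), of "i + \<theta>" n] \<theta> t that by auto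
  have int: "integrable PL (\<lambda>x. indicator {grid t T n i<..grid t T n (Suc i)} (snd x) *
      (\<psi> (\<delta> (grid t T n (i + \<theta>)) (fst x)) * H x))" if "i < Suc n" for n i
  proof (rule integrable_indicator_snd, rule Bochner_Integration.integrable_bound[OF w(1)])
    note [measurable] = \<delta>[OF dom[OF that]]
    show "(\<lambda>x. \<psi> (\<delta> (grid t T n (i + \<theta>)) (fst x)) * H x) \<in> borel_measurable PL" by measurable
    show "AE x in PL. norm (\<psi> (\<delta> (grid t T n (i + \<theta>)) (fst x)) * H x) \<le> norm (w x)"
      using w(2)[OF _ dom[OF that]] by (intro AE_I2) (fastforce intro: order_trans[OF _ abs_ge_self])
  qed
  have bound: "norm (\<Sum>i<Suc n. indicator {grid t T n i<..grid t T n (Suc i)} (snd x) *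
      (\<psi> (\<delta> (grid t T n (i + \<theta>)) (fst x)) * H x)) \<le> w x" if x: "x \<in> space PL" for n x
  proof -
    have w0: "0 \<le> w x" using w(2)[OF x, of 0] t by (meson abs_ge_zero atLeastAtMost_iff le_less_trans less_imp_le order_refl order_trans)
    have "norm (\<Sum>i<Suc n. indicator {grid t T n i<..grid t T n (Suc i)} (snd x) *
      (\<psi> (\<delta> (grid t T n (i + \<theta>)) (fst x)) * H x))
      \<le> (\<Sum>i<Suc n. indicator {grid t T n i<..grid t T n (Suc i)} (snd x) * w x)"
    proof (rule sum_norm_le)
      fix i assume "i \<in> {..<Suc n}"
      then have "\<bar>\<psi> (\<delta> (grid t T n (i + \<theta>)) (fst x)) * H x\<bar> \<le> w x" by (intro w(2)[OF x dom]) simp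
      then show "norm (indicator {grid t T n i<..grid t T n (Suc i)} (snd x) *
        (\<psi> (\<delta> (grid t T n (i + \<theta>)) (fst x)) * H x)) \<le> indicator {grid t T n i<..grid t T n (Suc i)} (snd x) * w x"
        by (simp add: indicator_def)
    qed
    also have "\<dots> = (\<Sum>i<Suc n. indicator {grid t T n i<..grid t T n (Suc i)} (snd x)) * w x"
      by (simp only: sum_distrib_right)
    \<comment> \<open>At most one cell contains a given time, so the whole sum is dominated by a
      single w.\<close>
    also have "\<dots> \<le> 1 * w x"
    proof (rule mult_right_mono[OF _ w0])
      show "(\<Sum>i<Suc n. indicator {grid t T n i<..grid t T n (Suc i)} (snd x) :: real) \<le> 1"
        using sum_indicator_partition[of "Suc n" "grid t T n" "snd x"] grid_simps(4)[OF t(2), of n]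
        by (simp add: less_imp_le indicator_def del: sum.lessThan_Suc)
    qed
    finally show ?thesis by simp
  qed
  have "(\<lambda>n. \<integral>x. (\<Sum>i<Suc n. indicator {grid t T n i<..grid t T n (Suc i)} (snd x) *
      (\<psi> (\<delta> (grid t T n (i + \<theta>)) (fst x)) * H x)) \<partial>PL) \<longlonglongrightarrow>
      (\<integral>x. indicator {t<..T} (snd x) * (\<psi> (\<delta> (snd x) (fst x)) * H x) \<partial>PL)"
    by (rule integral_dominated_convergence[OF g(3) g(1) w(1)]) (assumption | (rule AE_I2, (rule g(2) | rule bound)))+
  moreover have "(\<integral>x. (\<Sum>i<Suc n. indicator {grid t T n i<..grid t T n (Suc i)} (snd x) *
      (\<psi> (\<delta> (grid t T n (i + \<theta>)) (fst x)) * H x)) \<partial>PL) = (\<Sum>i<Suc n. \<integral>x. indicator {grid t T n i<..grid t T n (Suc i)} (snd x) *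
      (\<psi> (\<delta> (grid t T n (i + \<theta>)) (fst x)) * H x) \<partial>PL)" for n
    by (rule Bochner_Integration.integral_sum) (use int in auto)
  ultimately show "(\<lambda>n. \<Sum>i<Suc n. \<integral>x. indicator {grid t T n i<..grid t T n (Suc i)} (snd x) *
      (\<psi> (\<delta> (grid t T n (i + \<theta>)) (fst x)) * H x) \<partial>PL) \<longlonglongrightarrow>
      (\<integral>x. indicator {t<..T} (snd x) * (\<psi> (\<delta> (snd x) (fst x)) * H x) \<partial>PL)" by (simp only:)
  show "integrable PL (\<lambda>x. indicator {t<..T} (snd x) * (\<psi> (\<delta> (snd x) (fst x)) * H x))"
    by (rule integrable_dominated_convergence[OF g(3) g(1) w(1)]) (assumption | (rule AE_I2, (rule g(2) | rule bound)))+
qed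

end

text \<open>The difference of two solutions, reduced to what the estimate uses. The drift is bounded
  from above only, and only where \<delta> is positive; this is all that the ordering of the
  generators yields. S dominates whole paths and provides the majorants for functions of
  \<delta>.\<close>

locale backward_inequality = brownian_pair M T W B
  for M :: "'a measure" and T and W :: "real \<Rightarrow> 'a \<Rightarrow> real ^ 'd" and B :: "real \<Rightarrow> 'a \<Rightarrow> real ^ 'l" +
  fixes \<delta> :: "real \<Rightarrow> 'a \<Rightarrow> real" and S :: "'a \<Rightarrow> real" and F :: "'a \<times> real \<Rightarrow> real"
    and G :: "'a \<times> real \<Rightarrow> real ^ 'l" and Z :: "'a \<times> real \<Rightarrow> real ^ 'd" and IB IW :: "real \<Rightarrow> 'a \<Rightarrow> real"
    and L C \<alpha> :: real
  assumes cont: "\<omega> \<in> space M \<Longrightarrow> continuous_on {0..T} (\<lambda>u. \<delta> u \<omega>)"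
    and adapted: "u \<in> {0..T} \<Longrightarrow> \<delta> u \<in> borel_measurable (bd_sigma M T W B u)"
    and S: "sq_int M S" "\<omega> \<in> space M \<Longrightarrow> u \<in> {0..T} \<Longrightarrow> \<bar>\<delta> u \<omega>\<bar> \<le> S \<omega>"
    and F: "sq_int PL F" and G: "sq_int PL G" and Z: "sq_int PL Z"
    and F_supp: "snd x \<notin> {0<..T} \<Longrightarrow> F x = 0"
    and IB: "u \<in> {0..T} \<Longrightarrow> bwd.ito (\<lambda>x. indicator {u<..T} (snd x) *\<^sub>R G x) (IB u)"
    and IW: "u \<in> {0..T} \<Longrightarrow> fwd.ito (\<lambda>x. indicator {u<..T} (snd x) *\<^sub>R Z x) (IW u)"
    and bsde: "u \<in> {0..T} \<Longrightarrow> AE \<omega> in M. \<delta> u \<omega> = \<delta> T \<omega> + drift_int F u T \<omega> + IB u \<omega> - IW u \<omega>"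
    and final_le: "AE \<omega> in M. \<delta> T \<omega> \<le> 0"
    and params: "0 \<le> L" "0 \<le> C" "0 < \<alpha>" "\<alpha> < 1"
    and drift: "AE x in PL. snd x \<in> {0<..T} \<longrightarrow> 0 < \<delta> (snd x) (fst x) \<longrightarrow>
      F x \<le> L * (\<bar>\<delta> (snd x) (fst x)\<bar> + norm (Z x)) \<and>
      (norm (G x))\<^sup>2 \<le> C * (\<delta> (snd x) (fst x))\<^sup>2 + \<alpha> * (norm (Z x))\<^sup>2"
begin

section \<open>The integral inequality for the difference process\<close>

lemma \<delta>_measurable: "u \<in> {0..T} \<Longrightarrow> \<delta> u \<in> borel_measurable M"
  using bd_measurable(1)[OF adapted] by auto

lemma \<delta>_sq_int: "u \<in> {0..T} \<Longrightarrow> sq_int M (\<delta> u)"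
proof (rule sq_int_bound[OF S(1) \<delta>_measurable], assumption, rule AE_I2)
  fix \<omega> assume "u \<in> {0..T}" "\<omega> \<in> space M"
  then show "norm (\<delta> u \<omega>) \<le> norm (S \<omega>)" using S(2)[of \<omega> u] by simp
qed

text \<open>The equation is given from u to T only. A cell (a, b] is reached by subtracting the
  equations at a and at b, and the integrals follow by linearity.\<close>

lemma increment_integrals:
  assumes ab: "0 \<le> a" "a < b" "b \<le> T"
  shows "bwd.ito (\<lambda>x. indicator {a<..b} (snd x) *\<^sub>R G x) (\<lambda>\<omega>. IB a \<omega> - IB b \<omega>)"
    "fwd.ito (\<lambda>x. indicator {a<..b} (snd x) *\<^sub>R Z x) (\<lambda>\<omega>. IW a \<omega> - IW b \<omega>)"
    "AE \<omega> in M. \<delta> a \<omega> = \<delta> b \<omega> + drift_int F a b \<omega> + (IB a \<omega> - IB b \<omega>) - (IW a \<omega> - IW b \<omega>)"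
proof -
  have T: "0 \<le> T" and mem: "a \<in> {0..T}" "b \<in> {0..T}" using ab by auto
  have e: "indicator {a<..T} (snd x) *\<^sub>R v - indicator {b<..T} (snd x) *\<^sub>R v = indicator {a<..b} (snd x) *\<^sub>R v"
    for x :: "'a \<times> real" and v :: "'v::real_vector"
    using ab by (auto simp: indicator_def)
  show "bwd.ito (\<lambda>x. indicator {a<..b} (snd x) *\<^sub>R G x) (\<lambda>\<omega>. IB a \<omega> - IB b \<omega>)"
    using bwd.ito_diff[OF T IB[OF mem(1)] IB[OF mem(2)]] by (simp only: e)
  show "fwd.ito (\<lambda>x. indicator {a<..b} (snd x) *\<^sub>R Z x) (\<lambda>\<omega>. IW a \<omega> - IW b \<omega>)"
    using fwd.ito_diff[OF T IW[OF mem(1)] IW[OF mem(2)]] by (simp only: e)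
  have "AE \<omega> in M. integrable lborel (\<lambda>s. indicator {a<..T} s * F (\<omega>, s))"
    "AE \<omega> in M. integrable lborel (\<lambda>s. indicator {b<..T} s * F (\<omega>, s))"
    using drift_int_section[OF F] ab by auto
  with bsde[OF mem(1)] bsde[OF mem(2)]
  show "AE \<omega> in M. \<delta> a \<omega> = \<delta> b \<omega> + drift_int F a b \<omega> + (IB a \<omega> - IB b \<omega>) - (IW a \<omega> - IW b \<omega>)"
  proof eventually_elim
    case (elim \<omega>)
    have "drift_int F a T \<omega> - drift_int F b T \<omega> = (\<integral>s. indicator {a<..T} s * F (\<omega>, s) - indicator {b<..T} s * F (\<omega>, s) \<partial>lborel)"
      unfolding drift_int_def using elim by (simp only: Bochner_Integration.integral_diff)
    also have "\<dots> = drift_int F a b \<omega>"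
      unfolding drift_int_def using ab by (intro Bochner_Integration.integral_cong) (auto simp: indicator_def)
    finally show ?case using elim by linarith
  qed
qed

lemma expectation_inequality:
  "\<exists>K>0. \<forall>t. 0 \<le> t \<and> t < T \<longrightarrow> integrable PL (\<lambda>x. indicator {t<..T} (snd x) * pos_cube (\<delta> (snd x) (fst x))) \<and>
    (\<integral>\<omega>. pos_cube (\<delta> t \<omega>) \<partial>M) \<le> K * (\<integral>x. indicator {t<..T} (snd x) * pos_cube (\<delta> (snd x) (fst x)) \<partial>PL)"
proof -
  \<comment> \<open>Chosen so that (1 + \<eta>) \<alpha> < 1: here 1 - (1 + \<eta>) \<alpha> equals
    (1 - \<alpha>)(1 - \<alpha>/2).\<close>
  define \<eta> where "\<eta> = (1 - \<alpha>) / 2"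
  define \<kappa> where "\<kappa> = (1 - (1 + \<eta>) * \<alpha>) / 2"
  have \<eta>: "0 < \<eta>" using params by (simp add: \<eta>_def)
  have "\<alpha> * (1 - \<alpha>) < 1 * (1 - \<alpha>)" using params by (intro mult_strict_right_mono) auto
  then have \<kappa>: "0 < \<kappa>" using params by (simp add: \<kappa>_def \<eta>_def field_simps)
  have \<kappa>2: "2 * \<kappa> = 1 - (1 + \<eta>) * \<alpha>" by (simp add: \<kappa>_def)
  define K where "K = 3 * L + 3 * (1 + \<eta>) * C + L\<^sup>2 / (2 * \<kappa>)"
  have K: "0 \<le> K" using params \<eta> \<kappa> by (simp add: K_def)
  have [measurable]: "F \<in> borel_measurable PL" "G \<in> borel_measurable PL" "Z \<in> borel_measurable PL" "S \<in> borel_measurable M"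
    using F G Z S by (auto simp: sq_int_def)
  have main: "integrable PL (\<lambda>x. indicator {t<..T} (snd x) * pos_cube (\<delta> (snd x) (fst x))) \<and>
    (\<integral>\<omega>. pos_cube (\<delta> t \<omega>) \<partial>M) \<le> K * (\<integral>x. indicator {t<..T} (snd x) * pos_cube (\<delta> (snd x) (fst x)) \<partial>PL)"
    if t: "0 \<le> t" "t < T" for t
  proof
    note gt = grid_integral_tendsto[OF t _ \<delta>_measurable cont]
    \<comment> \<open>The indicator makes S square integrable over the product with the whole time
      axis; it does no harm next to F, which vanishes outside (0, T].\<close>
    have SI: "sq_int PL (\<lambda>x. indicator {0<..T} (snd x) * S (fst x))"
      by (rule sq_int_PL_indicator[OF S(1)]) (use T_pos in simp)
    have S0: "0 \<le> S \<omega>" if "\<omega> \<in> space M" for \<omega>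
      using S(2)[OF that, of 0] t by (auto intro: order_trans[OF abs_ge_zero])
    have fst_space: "fst x \<in> space M" if "x \<in> space PL" for x using that by (auto simp: space_pair_measure)
    have c: "continuous_on UNIV pos_cube" "continuous_on UNIV pos_cube'" "continuous_on UNIV pos_cube''"
      by (rule continuous_pos_cube)+
    have A: "(\<lambda>n. \<Sum>i<Suc n. \<integral>x. indicator {grid t T n i<..grid t T n (Suc i)} (snd x) *
        (pos_cube' (\<delta> (grid t T n (i + Suc 0)) (fst x)) * F x) \<partial>PL) \<longlonglongrightarrow>
        (\<integral>x. indicator {t<..T} (snd x) * (pos_cube' (\<delta> (snd x) (fst x)) * F x) \<partial>PL)"
      "integrable PL (\<lambda>x. indicator {t<..T} (snd x) * (pos_cube' (\<delta> (snd x) (fst x)) * F x))"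
    proof -
      have w: "integrable PL (\<lambda>x. 2 * (norm (indicator {0<..T} (snd x) * S (fst x)) * norm (F x)))"
        using sq_int_mult_norm[OF SI F] by simp
      have le: "\<bar>pos_cube' (\<delta> u (fst x)) * F x\<bar> \<le> 2 * (norm (indicator {0<..T} (snd x) * S (fst x)) * norm (F x))"
        if "x \<in> space PL" "u \<in> {0..T}" for x u
      proof (cases "snd x \<in> {0<..T}")
        case True
        have "\<bar>pos_cube' (\<delta> u (fst x))\<bar> \<le> 2 * S (fst x)"
          using pos_cube'_le[of "\<delta> u (fst x)"] pos_cube'_nonneg[of "\<delta> u (fst x)"] S(2)[OF fst_space[OF that(1)] that(2)] by simp
        then have "\<bar>pos_cube' (\<delta> u (fst x))\<bar> * \<bar>F x\<bar> \<le> (2 * S (fst x)) * \<bar>F x\<bar>" by (intro mult_right_mono) auto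
        then show ?thesis using True S0[OF fst_space[OF that(1)]] by (simp add: abs_mult)
      qed (simp add: F_supp)
      show "(\<lambda>n. \<Sum>i<Suc n. \<integral>x. indicator {grid t T n i<..grid t T n (Suc i)} (snd x) *
        (pos_cube' (\<delta> (grid t T n (i + Suc 0)) (fst x)) * F x) \<partial>PL) \<longlonglongrightarrow>
        (\<integral>x. indicator {t<..T} (snd x) * (pos_cube' (\<delta> (snd x) (fst x)) * F x) \<partial>PL)"
        by (rule gt(1)[OF _ _ _ c(2) _ w le]) auto
      show "integrable PL (\<lambda>x. indicator {t<..T} (snd x) * (pos_cube' (\<delta> (snd x) (fst x)) * F x))"
        by (rule gt(2)[OF le0 _ _ c(2) _ w le]) auto
    qed
    have BC: "(\<lambda>n. \<Sum>i<Suc n. \<integral>x. indicator {grid t T n i<..grid t T n (Suc i)} (snd x) *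
        (pos_cube'' (\<delta> (grid t T n (i + \<theta>)) (fst x)) * (norm (V x))\<^sup>2) \<partial>PL) \<longlonglongrightarrow>
        (\<integral>x. indicator {t<..T} (snd x) * (pos_cube'' (\<delta> (snd x) (fst x)) * (norm (V x))\<^sup>2) \<partial>PL) \<and>
      integrable PL (\<lambda>x. indicator {t<..T} (snd x) * (pos_cube'' (\<delta> (snd x) (fst x)) * (norm (V x))\<^sup>2))"
      if V: "sq_int PL V" and \<theta>: "\<theta> \<le> Suc 0" for V :: "'a \<times> real \<Rightarrow> 'v::euclidean_space" and \<theta>
    proof -
      have w: "integrable PL (\<lambda>x. 2 * (norm (V x))\<^sup>2)" using sq_int_integrable[OF V] by simp
      have m: "(\<lambda>x. (norm (V x))\<^sup>2) \<in> borel_measurable PL" using sq_int_measurable[OF V] by measurable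
      have le: "\<bar>pos_cube'' (\<delta> u (fst x)) * (norm (V x))\<^sup>2\<bar> \<le> 2 * (norm (V x))\<^sup>2" for x u
        using pos_cube''_bounds[of "\<delta> u (fst x)"] by (simp add: abs_mult mult_right_mono)
      show ?thesis
        using gt(1)[OF \<theta> _ _ c(3) m w le] gt(2)[OF \<theta> _ _ c(3) m w le] by simp
    qed
    note A' = A(1)[unfolded add_Suc_right add_0_right]
      and Blim = BC[OF G order_refl, unfolded add_Suc_right add_0_right]
      and Clim = BC[OF Z le0, unfolded add_0_right]
    \<comment> \<open>A convergent sum multiplied by the mesh: the quadratic drift error
      vanishes.\<close>
    have D: "(\<lambda>n. (T - t) / real (Suc n) * (\<Sum>i<Suc n. \<integral>x. indicator {grid t T n i<..grid t T n (Suc i)} (snd x) * (F x)\<^sup>2 \<partial>PL)) \<longlonglongrightarrow> 0"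
    proof -
      have w: "integrable PL (\<lambda>x. (F x)\<^sup>2)" using sq_int_integrable[OF F] by simp
      have "(\<lambda>n. \<Sum>i<Suc n. \<integral>x. indicator {grid t T n i<..grid t T n (Suc i)} (snd x) * (1 * (F x)\<^sup>2) \<partial>PL) \<longlonglongrightarrow>
        (\<integral>x. indicator {t<..T} (snd x) * (1 * (F x)\<^sup>2) \<partial>PL)"
        by (rule gt(1)[of 0 "\<lambda>_. 1" "\<lambda>x. (F x)\<^sup>2", OF _ _ _ _ _ w]) auto
      moreover have "(\<lambda>n. (T - t) / real (Suc n)) \<longlonglongrightarrow> 0"
        by (rule real_tendsto_divide_at_top[OF tendsto_const])
          (rule filterlim_compose[OF filterlim_real_sequentially filterlim_Suc])
      ultimately show ?thesis
        using tendsto_mult[of "\<lambda>n. (T - t) / real (Suc n)" 0] by (simp only: mult_1 mult_zero_left)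
    qed
    have E: "(\<lambda>n. \<Sum>i<Suc n. \<integral>\<omega>. min_square_cube (IW (grid t T n i) \<omega> - IW (grid t T n (Suc i)) \<omega>) \<partial>M) \<longlonglongrightarrow> 0"
      using fwd.ito_remainder[OF Z increment_integrals(2) t] by (simp only:)
    have E': "(\<lambda>n. \<Sum>i<Suc n. \<integral>\<omega>. min_square_cube (IB (grid t T n i) \<omega> - IB (grid t T n (Suc i)) \<omega>) \<partial>M) \<longlonglongrightarrow> 0"
      using bwd.ito_remainder[OF G increment_integrals(1) t] by (simp only:)
    show iP: "integrable PL (\<lambda>x. indicator {t<..T} (snd x) * pos_cube (\<delta> (snd x) (fst x)))"
    proof -
      have w: "integrable PL (\<lambda>x. (norm (indicator {0<..T} (snd x) * S (fst x)))\<^sup>2)" by (rule sq_int_integrable[OF SI])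
      \<comment> \<open>The majorant must also serve at times outside (0, T]; hence the second
        indicator in the role of H, absorbed by the first one below.\<close>
      have "integrable PL (\<lambda>x. indicator {t<..T} (snd x) * (pos_cube (\<delta> (snd x) (fst x)) * indicator {0<..T} (snd x)))"
      proof (rule gt(2)[OF le0 _ _ c(1) _ w])
        fix x u assume x: "x \<in> space PL" "u \<in> {0..T}"
        have "pos_cube (\<delta> u (fst x)) \<le> \<bar>\<delta> u (fst x)\<bar>\<^sup>2" using pos_cube_le_square by simp
        also have "\<dots> \<le> (S (fst x))\<^sup>2" by (intro power_mono S(2) fst_space x) auto
        finally show "\<bar>pos_cube (\<delta> u (fst x)) * indicator {0<..T} (snd x)\<bar> \<le> (norm (indicator {0<..T} (snd x) * S (fst x)))\<^sup>2"
          using pos_cube_nonneg[of "\<delta> u (fst x)"] by (simp add: indicator_def)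
      qed auto
      moreover have "indicator {t<..T} s * (v * indicator {0<..T} s) = indicator {t<..T} s * v" for s v :: real
        using t by (auto simp: indicator_def)
      ultimately show ?thesis by (simp only:)
    qed
    let ?cell = "\<lambda>n i x. indicator {grid t T n i<..grid t T n (Suc i)} (snd x) :: real"
    let ?A = "\<lambda>n i. \<integral>x. ?cell n i x * (pos_cube' (\<delta> (grid t T n (Suc i)) (fst x)) * F x) \<partial>PL"
    let ?B = "\<lambda>n i. \<integral>x. ?cell n i x * (pos_cube'' (\<delta> (grid t T n (Suc i)) (fst x)) * (norm (G x))\<^sup>2) \<partial>PL"
    let ?C = "\<lambda>n i. \<integral>x. ?cell n i x * (pos_cube'' (\<delta> (grid t T n i) (fst x)) * (norm (Z x))\<^sup>2) \<partial>PL"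
    let ?D = "\<lambda>n i. \<integral>x. ?cell n i x * (F x)\<^sup>2 \<partial>PL"
    let ?E = "\<lambda>n i. \<integral>\<omega>. min_square_cube (IW (grid t T n i) \<omega> - IW (grid t T n (Suc i)) \<omega>) \<partial>M"
    let ?E' = "\<lambda>n i. \<integral>\<omega>. min_square_cube (IB (grid t T n i) \<omega> - IB (grid t T n (Suc i)) \<omega>) \<partial>M"
    let ?step = "\<lambda>n i. ?A n i + (1 + \<eta>) / 2 * ?B n i - 1 / 2 * ?C n i
      + (25 + 1 / \<eta>) * ((T - t) / real (Suc n) * ?D n i) + 6 * ?E n i + 48 * ?E' n i"
    define R where "R n = (\<Sum>i<Suc n. ?A n i) + (1 + \<eta>) / 2 * (\<Sum>i<Suc n. ?B n i) - 1 / 2 * (\<Sum>i<Suc n. ?C n i)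
      + (25 + 1 / \<eta>) * ((T - t) / real (Suc n) * (\<Sum>i<Suc n. ?D n i))
      + 6 * (\<Sum>i<Suc n. ?E n i) + 48 * (\<Sum>i<Suc n. ?E' n i)" for n
    have uT: "(\<integral>\<omega>. pos_cube (\<delta> T \<omega>) \<partial>M) = 0"
    proof -
      have "AE \<omega> in M. pos_cube (\<delta> T \<omega>) = 0" using final_le by eventually_elim (simp add: pos_cube_eq_0)
      then show ?thesis by (rule integral_eq_zero_AE)
    qed
    have le: "(\<integral>\<omega>. pos_cube (\<delta> t \<omega>) \<partial>M) \<le> R n" for n
    proof -
      define u where "u i = (\<integral>\<omega>. pos_cube (\<delta> (grid t T n i) \<omega>) \<partial>M)" for i
      \<comment> \<open>The expectation telescopes along the grid; its value at T is zero because
        \<delta> T \<le> 0.\<close>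
      have "(\<integral>\<omega>. pos_cube (\<delta> t \<omega>) \<partial>M) = u 0 - u (Suc n)"
        using uT by (simp add: u_def grid_simps[OF t(2)])
      also have "\<dots> = (\<Sum>i<Suc n. u i - u (Suc i))" by (rule sum_lessThan_telescope'[symmetric])
      also have "\<dots> \<le> (\<Sum>i<Suc n. ?step n i)"
      proof (rule sum_mono)
        fix i assume "i \<in> {..<Suc n}"
        then have i: "i < Suc n" by simp
        define a b where "a = grid t T n i" and "b = grid t T n (Suc i)"
        have ab: "0 \<le> a" "a < b" "b \<le> T" and step: "b - a = (T - t) / real (Suc n)"
          using grid_simps(3,4)[OF t(2), of n i] grid_simps(5)[OF t(2), of n i] grid_simps(6)[OF t(2), of "Suc i" n] i t
          by (auto simp: a_def b_def)
        have mem: "a \<in> {0..T}" "b \<in> {0..T}" using ab by auto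
        note one_step[OF ab \<eta> adapted[OF mem(1)] \<delta>_sq_int[OF mem(1)] adapted[OF mem(2)] \<delta>_sq_int[OF mem(2)] F G Z increment_integrals[OF ab]]
        then show "u i - u (Suc i) \<le> ?step n i"
          unfolding u_def a_def[symmetric] b_def[symmetric] step by linarith
      qed
      also have "\<dots> = R n"
        unfolding R_def by (simp only: sum.distrib sum_subtractf sum_distrib_left)
      finally show ?thesis .
    qed
    let ?a = "\<lambda>x. indicator {t<..T} (snd x) * (pos_cube' (\<delta> (snd x) (fst x)) * F x)"
    let ?b = "\<lambda>x. indicator {t<..T} (snd x) * (pos_cube'' (\<delta> (snd x) (fst x)) * (norm (G x))\<^sup>2)"
    let ?c = "\<lambda>x. indicator {t<..T} (snd x) * (pos_cube'' (\<delta> (snd x) (fst x)) * (norm (Z x))\<^sup>2)"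
    let ?p = "\<lambda>x. indicator {t<..T} (snd x) * pos_cube (\<delta> (snd x) (fst x))"
    have "R \<longlonglongrightarrow> (\<integral>x. ?a x \<partial>PL) + (1 + \<eta>) / 2 * (\<integral>x. ?b x \<partial>PL) - 1 / 2 * (\<integral>x. ?c x \<partial>PL)
      + (25 + 1 / \<eta>) * 0 + 6 * 0 + 48 * 0"
      unfolding R_def[abs_def]
      by (intro tendsto_add tendsto_diff tendsto_mult_left A' Blim[THEN conjunct1] Clim[THEN conjunct1] D E E')
    then have "(\<integral>\<omega>. pos_cube (\<delta> t \<omega>) \<partial>M) \<le> (\<integral>x. ?a x \<partial>PL) + (1 + \<eta>) / 2 * (\<integral>x. ?b x \<partial>PL) - 1 / 2 * (\<integral>x. ?c x \<partial>PL)
      + (25 + 1 / \<eta>) * 0 + 6 * 0 + 48 * 0"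
      using le by (intro LIMSEQ_le_const) auto
    also have "\<dots> = (\<integral>x. ?a x + (1 + \<eta>) / 2 * ?b x - 1 / 2 * ?c x \<partial>PL)"
      using A(2) Blim[THEN conjunct2] Clim[THEN conjunct2] by (simp del: times_divide_eq_left)
    also have "\<dots> \<le> (\<integral>x. K * ?p x \<partial>PL)"
    proof (rule integral_mono_AE)
      show "integrable PL (\<lambda>x. ?a x + (1 + \<eta>) / 2 * ?b x - 1 / 2 * ?c x)"
        using A(2) Blim[THEN conjunct2] Clim[THEN conjunct2]
        by (intro Bochner_Integration.integrable_add Bochner_Integration.integrable_diff integrable_mult_right) auto
      show "integrable PL (\<lambda>x. K * ?p x)" using iP by simp
      show "AE x in PL. ?a x + (1 + \<eta>) / 2 * ?b x - 1 / 2 * ?c x \<le> K * ?p x"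
        using drift
      proof eventually_elim
        case (elim x)
        show ?case
        proof (cases "snd x \<in> {t<..T}")
          case True
          then have "snd x \<in> {0<..T}" using t by auto
          then show ?thesis
            using pos_cube_drift_bound[OF params(1,2) less_imp_le[OF \<eta>] \<kappa> \<kappa>2, of "\<delta> (snd x) (fst x)" "F x" "norm (Z x)" "(norm (G x))\<^sup>2"]
              elim True by (simp add: K_def)
        qed simp
      qed
    qed
    also have "\<dots> = K * (\<integral>x. ?p x \<partial>PL)" by simp
    finally show "(\<integral>\<omega>. pos_cube (\<delta> t \<omega>) \<partial>M) \<le> K * (\<integral>x. ?p x \<partial>PL)" .
  qed
  show ?thesis
  \<comment> \<open>K itself may be 0; adding 1 keeps the rate of the Gronwall argument
    positive.\<close>
  proof (intro exI[of _ "K + 1"] conjI allI impI)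
    show "0 < K + 1" using K by simp
    fix t assume t: "0 \<le> t \<and> t < T"
    then show "integrable PL (\<lambda>x. indicator {t<..T} (snd x) * pos_cube (\<delta> (snd x) (fst x)))" using main by simp
    have "0 \<le> (\<integral>x. indicator {t<..T} (snd x) * pos_cube (\<delta> (snd x) (fst x)) \<partial>PL)"
      by (intro integral_nonneg_AE AE_I2) (simp add: pos_cube_nonneg)
    then show "(\<integral>\<omega>. pos_cube (\<delta> t \<omega>) \<partial>M) \<le> (K + 1) * (\<integral>x. indicator {t<..T} (snd x) * pos_cube (\<delta> (snd x) (fst x)) \<partial>PL)"
      using main[of t] t by (simp add: distrib_right)
  qed
qed

text \<open>Gronwall backward in time by iteration: each use of the integral inequality halves the
  constant in front of an exponential, so the expectation vanishes at each fixed time. Countably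
  many times and path continuity give a single exceptional set.\<close>

lemma nonpositive: "AE \<omega> in M. \<forall>u\<in>{0..T}. \<delta> u \<omega> \<le> 0"
proof -
  obtain K where K: "0 < K" "\<And>t. 0 \<le> t \<Longrightarrow> t < T \<Longrightarrow> integrable PL (\<lambda>x. indicator {t<..T} (snd x) * pos_cube (\<delta> (snd x) (fst x)))"
    "\<And>t. 0 \<le> t \<Longrightarrow> t < T \<Longrightarrow> (\<integral>\<omega>. pos_cube (\<delta> t \<omega>) \<partial>M) \<le> K * (\<integral>x. indicator {t<..T} (snd x) * pos_cube (\<delta> (snd x) (fst x)) \<partial>PL)"
    using expectation_inequality by blast
  define u where "u t = (\<integral>\<omega>. pos_cube (\<delta> t \<omega>) \<partial>M)" for t
  \<comment> \<open>A bound uniform in time, from which the iteration starts.\<close>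
  define U where "U = (\<integral>\<omega>. (S \<omega>)\<^sup>2 \<partial>M)"
  have U0: "0 \<le> U" by (simp add: U_def)
  have ip: "integrable M (\<lambda>\<omega>. pos_cube (\<delta> t \<omega>))" if "t \<in> {0..T}" for t
    by (rule sq_int_compose_le[where h=pos_cube, OF \<delta>_sq_int[OF that] pos_cube_measurable(1) pos_cube_nonneg pos_cube_le_square])
  have uU: "u t \<le> U" if t: "t \<in> {0..T}" for t
    unfolding u_def U_def
  proof (rule integral_mono[OF ip[OF t]])
    show "integrable M (\<lambda>\<omega>. (S \<omega>)\<^sup>2)" using sq_int_integrable[OF S(1)] by simp
    fix \<omega> assume \<omega>: "\<omega> \<in> space M"
    have "pos_cube (\<delta> t \<omega>) \<le> \<bar>\<delta> t \<omega>\<bar>\<^sup>2" using pos_cube_le_square by simp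
    also have "\<dots> \<le> (S \<omega>)\<^sup>2" by (intro power_mono S(2) \<omega> t) auto
    finally show "pos_cube (\<delta> t \<omega>) \<le> (S \<omega>)\<^sup>2" .
  qed
  have uT: "u T = 0"
  proof -
    have "AE \<omega> in M. pos_cube (\<delta> T \<omega>) = 0" using final_le by eventually_elim (simp add: pos_cube_eq_0)
    then show ?thesis unfolding u_def by (rule integral_eq_zero_AE)
  qed
  have u_int: "u t \<le> K * (\<integral>s. indicator {t<..T} s * u s \<partial>lborel)" "integrable lborel (\<lambda>s. indicator {t<..T} s * u s)"
    if t: "0 \<le> t" "t < T" for t
  proof -
    have i: "integrable PL (case_prod (\<lambda>\<omega> s. indicator {t<..T} s * pos_cube (\<delta> s \<omega>)))"
      using K(2)[OF t] by (simp add: case_prod_beta')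
    show "integrable lborel (\<lambda>s. indicator {t<..T} s * u s)"
      using fwd.P.integrable_snd[OF i] by (simp add: u_def)
    show "u t \<le> K * (\<integral>s. indicator {t<..T} s * u s \<partial>lborel)"
      using K(3)[OF t] fwd.P.integral_snd[OF i] by (simp add: u_def case_prod_beta')
  qed
  \<comment> \<open>With this rate the factor K / r in each iteration is 1/2.\<close>
  define r where "r = 2 * K"
  have r: "0 < r" using K by (simp add: r_def)
  have bound: "u t \<le> U / 2 ^ n * exp (r * (T - t))" if "t \<in> {0..T}" for t n
    using that
  proof (induction n arbitrary: t)
    case 0
    have "U * 1 \<le> U * exp (r * (T - t))" using U0 r 0 by (intro mult_left_mono) auto
    then show ?case using uU[OF 0] by simp
  next
    case (Suc n)
    show ?case
    proof (cases "t < T")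
      case True
      then have t: "0 \<le> t" "t < T" using Suc.prems by auto
      have e: "has_bochner_integral lborel (\<lambda>s. indicator {t<..T} s * exp (r * (T - s))) ((exp (r * (T - t)) - 1) / r)"
        by (rule exp_gronwall_integral) (use r t in auto)
      then have ie: "integrable lborel (\<lambda>s. U / 2 ^ n * (indicator {t<..T} s * exp (r * (T - s))))"
        by (simp add: has_bochner_integral_iff)
      have "(\<integral>s. indicator {t<..T} s * u s \<partial>lborel) \<le> (\<integral>s. U / 2 ^ n * (indicator {t<..T} s * exp (r * (T - s))) \<partial>lborel)"
      proof (rule integral_mono[OF u_int(2)[OF t] ie])
        fix s
        show "indicator {t<..T} s * u s \<le> U / 2 ^ n * (indicator {t<..T} s * exp (r * (T - s)))"
          using Suc.IH[of s] t by (auto simp: indicator_def)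
      qed
      also have "\<dots> = U / 2 ^ n * ((exp (r * (T - t)) - 1) / r)"
        using e by (simp add: has_bochner_integral_iff)
      finally have "K * (\<integral>s. indicator {t<..T} s * u s \<partial>lborel) \<le> K * (U / 2 ^ n * ((exp (r * (T - t)) - 1) / r))"
        using K(1) by (intro mult_left_mono) auto
      also have "\<dots> = U / 2 ^ Suc n * (exp (r * (T - t)) - 1)"
        using K(1) by (simp add: r_def field_simps)
      also have "\<dots> \<le> U / 2 ^ Suc n * exp (r * (T - t))" using U0 by (intro mult_left_mono) auto
      finally show ?thesis using u_int(1)[OF t] by linarith
    next
      case False
      then have "t = T" using Suc.prems by simp
      then show ?thesis using uT U0 by simp
    qed
  qed
  have u0: "u t = 0" if t: "t \<in> {0..T}" for t
  proof -
    have "(\<lambda>n. U * exp (r * (T - t)) * (1 / 2) ^ n) \<longlonglongrightarrow> U * exp (r * (T - t)) * 0"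
      by (intro tendsto_intros) auto
    then have "u t \<le> U * exp (r * (T - t)) * 0"
      using bound[OF t] by (intro LIMSEQ_le_const) (auto simp: power_one_over field_simps)
    moreover have "0 \<le> u t" unfolding u_def by (intro integral_nonneg_AE) (simp add: pos_cube_nonneg)
    ultimately show ?thesis by simp
  qed
  have "AE \<omega> in M. \<delta> (max 0 (min T q)) \<omega> \<le> 0" for q
  proof -
    have q: "max 0 (min T q) \<in> {0..T}" using T_pos by auto
    have "AE \<omega> in M. pos_cube (\<delta> (max 0 (min T q)) \<omega>) = 0"
      using u0[OF q] integral_nonneg_eq_0_iff_AE[OF ip[OF q]] by (simp add: u_def pos_cube_nonneg)
    then show ?thesis by eventually_elim (simp add: pos_cube_eq_0)
  qed
  then have "AE \<omega> in M. \<forall>q\<in>\<rat>. \<delta> (max 0 (min T q)) \<omega> \<le> 0"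
    by (subst AE_ball_countable) (auto simp: countable_rat)
  then show ?thesis using AE_space
  proof eventually_elim
    case (elim \<omega>)
    show ?case
    proof
      fix u assume "u \<in> {0..T}"
      then show "\<delta> u \<omega> \<le> 0"
        by (rule clamp_rational_bound[OF _ cont[OF elim(2)], rotated -1]) (use elim(1) T_pos in auto)
    qed
  qed
qed

end

section \<open>Regular versions of solutions\<close>

lemma has_backward_ito_integral_cong:
  assumes "has_backward_ito_integral M H X \<phi> a b I"
    and eq: "AE \<omega> in M. \<forall>s\<in>{a..b}. \<phi> s \<omega> = \<phi>' s \<omega>"
  shows "has_backward_ito_integral M H X \<phi>' a b I"
proof -
  have "(\<integral>\<^sup>+\<omega>. (\<integral>\<^sup>+s\<in>{a..b}. ennreal ((norm (\<phi> s \<omega> - step_process (n k) (p k) (\<zeta> k) s \<omega>))\<^sup>2) \<partial>lborel) \<partial>M)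
    = (\<integral>\<^sup>+\<omega>. (\<integral>\<^sup>+s\<in>{a..b}. ennreal ((norm (\<phi>' s \<omega> - step_process (n k) (p k) (\<zeta> k) s \<omega>))\<^sup>2) \<partial>lborel) \<partial>M)" for n :: "nat \<Rightarrow> nat" and p :: "nat \<Rightarrow> nat \<Rightarrow> real" and \<zeta> k
  proof (rule nn_integral_cong_AE)
    show "AE \<omega> in M. (\<integral>\<^sup>+s\<in>{a..b}. ennreal ((norm (\<phi> s \<omega> - step_process (n k) (p k) (\<zeta> k) s \<omega>))\<^sup>2) \<partial>lborel)
      = (\<integral>\<^sup>+s\<in>{a..b}. ennreal ((norm (\<phi>' s \<omega> - step_process (n k) (p k) (\<zeta> k) s \<omega>))\<^sup>2) \<partial>lborel)"
      using eq by eventually_elim (intro nn_integral_cong, auto simp: indicator_def)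
  qed
  then show ?thesis using assms(1) by (simp add: has_backward_ito_integral_def L2_limit_of_step_integrals_def)
qed

text \<open>The squared hypothesis is a Lipschitz bound in the Euclidean metric of the product, with
  constant \<open>sqrt C\<close>; that metric is at most the sum of the two distances.\<close>

lemma lipschitz_square_root:
  fixes h :: "real \<times> 'b::euclidean_space \<Rightarrow> real"
  assumes "0 \<le> C" "\<And>y1 y2 z1 z2. \<bar>h (y1, z1) - h (y2, z2)\<bar>\<^sup>2 \<le> C * (\<bar>y1 - y2\<bar>\<^sup>2 + (norm (z1 - z2))\<^sup>2)"
  shows "\<bar>h (y1, z1) - h (y2, z2)\<bar> \<le> sqrt C * (\<bar>y1 - y2\<bar> + norm (z1 - z2))" and "continuous_on UNIV h"
proof -
  have 1: "\<bar>h p - h q\<bar> \<le> sqrt C * dist p q" for p q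
  proof -
    have "sqrt (\<bar>h p - h q\<bar>\<^sup>2) \<le> sqrt (C * (\<bar>fst p - fst q\<bar>\<^sup>2 + (norm (snd p - snd q))\<^sup>2))"
      using assms(2)[of "fst p" "snd p" "fst q" "snd q"] by (intro real_sqrt_le_mono) simp
    then show ?thesis by (simp add: dist_prod_def dist_norm real_sqrt_mult)
  qed
  have "dist (y1, z1) (y2, z2) \<le> dist y1 y2 + dist z1 z2"
    unfolding dist_prod_def by (simp add: sqrt_sum_squares_le_sum)
  then have "sqrt C * dist (y1, z1) (y2, z2) \<le> sqrt C * (\<bar>y1 - y2\<bar> + norm (z1 - z2))"
    using assms(1) by (intro mult_left_mono) (auto simp: dist_norm)
  then show "\<bar>h (y1, z1) - h (y2, z2)\<bar> \<le> sqrt C * (\<bar>y1 - y2\<bar> + norm (z1 - z2))"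
    using 1[of "(y1, z1)" "(y2, z2)"] by linarith
  show "continuous_on UNIV h"
    by (rule lipschitz_on_continuous_on[of "sqrt C"], rule lipschitz_onI)
      (use 1 assms(1) in \<open>auto simp: dist_real_def\<close>)
qed

section \<open>Joint measurability and square integrability along a solution\<close>

context brownian_pair
begin

text \<open>Coefficients are measurable over times restricted to [0, T], whereas the product measure
  uses the whole line. Clamping maps one into the other and changes nothing under the indicator of
  (0, T].\<close>

lemma measurable_clamp: "(\<lambda>x. max 0 (min T (snd x))) \<in> measurable PL (restrict_space borel {0..T})"
  by (rule measurable_restrict_space2) (use T_pos in auto)

text \<open>Measurability of y and z is given only after multiplication by the indicator. They are
  inserted in that form, and the outer indicator hides the values altered outside (0, T].\<close>

lemma coefficient_measurable:
  fixes f :: "'a \<Rightarrow> real \<Rightarrow> real \<Rightarrow> real ^ 'd \<Rightarrow> 'v::euclidean_space"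
  assumes f: "jointly_measurable_coeff M T f"
    and y: "(\<lambda>x. indicator {0<..T} (snd x) * y x) \<in> borel_measurable PL"
    and z: "(\<lambda>x. indicator {0<..T} (snd x) *\<^sub>R z x) \<in> borel_measurable PL"
  shows "(\<lambda>x. indicator {0<..T} (snd x) *\<^sub>R f (fst x) (snd x) (y x) (z x)) \<in> borel_measurable PL"
proof -
  define \<Psi> where "\<Psi> x = (fst x, max 0 (min T (snd x)), indicator {0<..T} (snd x) * y x, indicator {0<..T} (snd x) *\<^sub>R z x)" for x
  have "\<Psi> \<in> measurable PL (M \<Otimes>\<^sub>M restrict_space borel {0..T} \<Otimes>\<^sub>M borel \<Otimes>\<^sub>M borel)"
    unfolding \<Psi>_def[abs_def] by (intro measurable_Pair measurable_clamp y z measurable_fst)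
  from measurable_compose[OF this f[unfolded jointly_measurable_coeff_def]]
  have m: "(\<lambda>x. case \<Psi> x of (\<omega>, t, y, z) \<Rightarrow> f \<omega> t y z) \<in> borel_measurable PL" .
  have "(\<lambda>x. indicator {0<..T} (snd x) *\<^sub>R (case \<Psi> x of (\<omega>, t, y, z) \<Rightarrow> f \<omega> t y z)) \<in> borel_measurable PL"
    using m by measurable
  also have "(\<lambda>x. indicator {0<..T} (snd x) *\<^sub>R (case \<Psi> x of (\<omega>, t, y, z) \<Rightarrow> f \<omega> t y z))
     = (\<lambda>x. indicator {0<..T} (snd x) *\<^sub>R f (fst x) (snd x) (y x) (z x))"
    by (auto simp: fun_eq_iff \<Psi>_def indicator_def)
  finally show ?thesis .
qed

lemma sq_int_PL_iterated:
  fixes \<phi> :: "real \<Rightarrow> 'a \<Rightarrow> 'v::euclidean_space"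
  assumes m: "(\<lambda>x. indicator {0<..T} (snd x) *\<^sub>R \<phi> (snd x) (fst x)) \<in> borel_measurable PL"
    and fin: "(\<integral>\<^sup>+\<omega>. (\<integral>\<^sup>+t\<in>{0..T}. ennreal ((norm (\<phi> t \<omega>))\<^sup>2) \<partial>lborel) \<partial>M) < \<infinity>"
  shows "sq_int PL (\<lambda>x. indicator {0<..T} (snd x) *\<^sub>R \<phi> (snd x) (fst x))"
proof -
  have "(\<integral>\<^sup>+x. ennreal ((norm (indicator {0<..T} (snd x) *\<^sub>R \<phi> (snd x) (fst x)))\<^sup>2) \<partial>PL)
    = (\<integral>\<^sup>+\<omega>. (\<integral>\<^sup>+s. ennreal ((norm (indicator {0<..T} s *\<^sub>R \<phi> s \<omega>))\<^sup>2) \<partial>lborel) \<partial>M)"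
  proof -
    have "(\<lambda>x. ennreal ((norm (indicator {0<..T} (snd x) *\<^sub>R \<phi> (snd x) (fst x)))\<^sup>2)) \<in> borel_measurable PL"
      using m by measurable
    from lborel.nn_integral_fst[OF this] show ?thesis by simp
  qed
  also have "\<dots> \<le> (\<integral>\<^sup>+\<omega>. (\<integral>\<^sup>+t\<in>{0..T}. ennreal ((norm (\<phi> t \<omega>))\<^sup>2) \<partial>lborel) \<partial>M)"
    by (intro nn_integral_mono) (auto simp: indicator_def)
  also note fin
  finally show ?thesis using m by (subst sq_int_nn) auto
qed

lemma M2_sq_int:
  fixes \<phi> :: "real \<Rightarrow> 'a \<Rightarrow> 'v::euclidean_space"
  assumes "\<phi> \<in> M2_space M T G"
  shows "sq_int PL (\<lambda>x. indicator {0<..T} (snd x) *\<^sub>R \<phi> (snd x) (fst x))"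
proof (rule sq_int_PL_iterated)
  have "(\<lambda>(\<omega>, t). \<phi> t \<omega>) \<in> borel_measurable (M \<Otimes>\<^sub>M restrict_space borel {0..T})"
    using assms by (simp add: M2_space_def)
  from measurable_compose[OF measurable_Pair[OF measurable_fst measurable_clamp] this]
  have [measurable]: "(\<lambda>x. \<phi> (max 0 (min T (snd x))) (fst x)) \<in> borel_measurable PL" by simp
  have "(\<lambda>x. indicator {0<..T} (snd x) *\<^sub>R \<phi> (max 0 (min T (snd x))) (fst x)) \<in> borel_measurable PL"
    by measurable
  also have "(\<lambda>x. indicator {0<..T} (snd x) *\<^sub>R \<phi> (max 0 (min T (snd x))) (fst x))
     = (\<lambda>x. indicator {0<..T} (snd x) *\<^sub>R \<phi> (snd x) (fst x))"
    by (auto simp: fun_eq_iff indicator_def)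
  finally show "(\<lambda>x. indicator {0<..T} (snd x) *\<^sub>R \<phi> (snd x) (fst x)) \<in> borel_measurable PL" .
qed (use assms in \<open>simp add: M2_space_def\<close>)

lemma null_sets_bd_sigma: "null_sets M \<subseteq> sets (bd_sigma M T W B t)"
  unfolding bd_sigma_def using null_sets_incr_sigma[of M W 0 t] sets_sigma_join_ge(1)[of "incr_sigma M W 0 t" "incr_sigma M B t T"]
  by auto

text \<open>The exceptional null set of discontinuous paths belongs to every \<open>bd_sigma\<close>, so it can be removed
  without losing adaptedness.\<close>

lemma S2_regular_version:
  fixes Y :: "real \<Rightarrow> 'a \<Rightarrow> real"
  assumes Y: "Y \<in> S2_space M T (bd_sigma M T W B)"
  obtains Y' S where "\<And>\<omega>. \<omega> \<in> space M \<Longrightarrow> continuous_on {0..T} (\<lambda>t. Y' t \<omega>)"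
    "\<And>t. t \<in> {0..T} \<Longrightarrow> Y' t \<in> borel_measurable (bd_sigma M T W B t)"
    "AE \<omega> in M. \<forall>t. Y' t \<omega> = Y t \<omega>"
    "sq_int M (S :: 'a \<Rightarrow> real)" "\<And>\<omega> t. \<omega> \<in> space M \<Longrightarrow> t \<in> {0..T} \<Longrightarrow> \<bar>Y' t \<omega>\<bar> \<le> S \<omega>"
proof -
  have "AE \<omega> in M. continuous_on {0..T} (\<lambda>t. Y t \<omega>)" using Y by (simp add: S2_space_def)
  then obtain N where N: "N \<in> null_sets M" "{\<omega> \<in> space M. \<not> continuous_on {0..T} (\<lambda>t. Y t \<omega>)} \<subseteq> N"
    by (auto elim!: AE_E simp: null_sets_def)
  define Y' where "Y' t \<omega> = (if \<omega> \<in> N then 0 else Y t \<omega>)" for t \<omega>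
  have cont: "continuous_on {0..T} (\<lambda>t. Y' t \<omega>)" if "\<omega> \<in> space M" for \<omega>
    using N(2) that by (cases "\<omega> \<in> N") (auto simp: Y'_def)
  have ad: "Y' t \<in> borel_measurable (bd_sigma M T W B t)" if t: "t \<in> {0..T}" for t
  proof -
    have "Y t \<in> borel_measurable (bd_sigma M T W B t)" using Y t by (simp add: S2_space_def)
    moreover have "N \<inter> space (bd_sigma M T W B t) \<in> sets (bd_sigma M T W B t)"
      using N(1) null_sets_bd_sigma[of t] by (intro sets.Int) auto
    ultimately show ?thesis unfolding Y'_def[abs_def] by (intro measurable_If_set) auto
  qed
  have ae: "AE \<omega> in M. \<forall>t. Y' t \<omega> = Y t \<omega>"
    using AE_not_in[OF N(1)] by eventually_elim (simp add: Y'_def)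
  \<comment> \<open>A supremum over countably many clamped rationals is measurable; by continuity of
    \<open>Y'\<close> it still bounds all times of [0, T].\<close>
  define h where "h \<omega> = (SUP q\<in>\<rat>. ennreal ((norm (Y' (max 0 (min T q)) \<omega>))\<^sup>2))" for \<omega>
  have cl: "max 0 (min T q) \<in> {0..T}" for q using T_pos by auto
  have mY: "Y' (max 0 (min T q)) \<in> borel_measurable M" for q
    using bd_measurable(1)[OF ad[OF cl]] T_pos by auto
  have hm: "h \<in> borel_measurable M"
    unfolding h_def[abs_def] using mY by (intro borel_measurable_SUP) (auto simp: countable_rat)
  \<comment> \<open>Finiteness at every \<omega>: \<open>enn2real\<close> would send an infinite
    value to 0 and destroy the bound.\<close>
  have hfin: "h \<omega> < \<infinity>" if \<omega>: "\<omega> \<in> space M" for \<omega>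
  proof -
    have "compact ((\<lambda>t. Y' t \<omega>) ` {0..T})" by (intro compact_continuous_image cont \<omega>) simp
    then obtain b where b: "\<forall>t\<in>{0..T}. norm (Y' t \<omega>) \<le> b"
      using compact_imp_bounded[of "(\<lambda>t. Y' t \<omega>) ` {0..T}"] by (auto simp: bounded_iff)
    have "h \<omega> \<le> ennreal (b\<^sup>2)"
      unfolding h_def using b cl by (intro SUP_least ennreal_leI power_mono) auto
    then show ?thesis by (rule order_le_less_trans) simp
  qed
  define S where "S \<omega> = sqrt (enn2real (h \<omega>))" for \<omega>
  have bound: "\<bar>Y' t \<omega>\<bar> \<le> S \<omega>" if \<omega>: "\<omega> \<in> space M" and t: "t \<in> {0..T}" for \<omega> t
  proof -
    have "(norm (Y' t \<omega>))\<^sup>2 \<le> enn2real (h \<omega>)"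
    proof (rule clamp_rational_bound[OF _ _ _ t, where f="\<lambda>t. (norm (Y' t \<omega>))\<^sup>2"])
      show "continuous_on {0..T} (\<lambda>t. (norm (Y' t \<omega>))\<^sup>2)" by (intro continuous_intros cont \<omega>)
      fix q :: real assume "q \<in> \<rat>"
      then have "ennreal ((norm (Y' (max 0 (min T q)) \<omega>))\<^sup>2) \<le> h \<omega>" unfolding h_def by (rule SUP_upper)
      from enn2real_mono[OF this hfin[OF \<omega>, unfolded infinity_ennreal_def]] show "(norm (Y' (max 0 (min T q)) \<omega>))\<^sup>2 \<le> enn2real (h \<omega>)" by simp
    qed (use T_pos in simp)
    then have "sqrt ((norm (Y' t \<omega>))\<^sup>2) \<le> S \<omega>" unfolding S_def by (rule real_sqrt_le_mono)
    then show ?thesis by simp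
  qed
  have Sm: "S \<in> borel_measurable M" unfolding S_def[abs_def] using hm by measurable
  have "sq_int M S"
  proof (subst sq_int_nn[OF Sm])
    have "(\<integral>\<^sup>+\<omega>. ennreal ((norm (S \<omega>))\<^sup>2) \<partial>M) = (\<integral>\<^sup>+\<omega>. h \<omega> \<partial>M)"
      by (intro nn_integral_cong) (use hfin in \<open>simp add: S_def ennreal_enn2real\<close>)
    also have "\<dots> \<le> (\<integral>\<^sup>+\<omega>. (SUP t\<in>{0..T}. ennreal ((norm (Y t \<omega>))\<^sup>2)) \<partial>M)"
    proof (rule nn_integral_mono)
      fix \<omega>
      have "ennreal ((norm (Y' (max 0 (min T q)) \<omega>))\<^sup>2) \<le> (SUP t\<in>{0..T}. ennreal ((norm (Y t \<omega>))\<^sup>2))" for q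
        using cl[of q] by (intro SUP_upper2[of "max 0 (min T q)"]) (auto simp: Y'_def)
      then show "h \<omega> \<le> (SUP t\<in>{0..T}. ennreal ((norm (Y t \<omega>))\<^sup>2))" unfolding h_def by (intro SUP_least)
    qed
    also have "\<dots> < \<infinity>" using Y by (simp add: S2_space_def)
    finally show "(\<integral>\<^sup>+\<omega>. ennreal ((norm (S \<omega>))\<^sup>2) \<partial>M) < \<infinity>" .
  qed
  from that[of Y' S, OF cont ad ae this bound] show thesis .
qed

lemma continuous_adapted_joint:
  fixes Y :: "real \<Rightarrow> 'a \<Rightarrow> real"
  assumes "\<And>\<omega>. \<omega> \<in> space M \<Longrightarrow> continuous_on {0..T} (\<lambda>t. Y t \<omega>)"
    and "\<And>t. t \<in> {0..T} \<Longrightarrow> Y t \<in> borel_measurable M"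
  shows "(\<lambda>x. indicator {0<..T} (snd x) * Y (snd x) (fst x)) \<in> borel_measurable PL"
proof -
  have "(\<lambda>x. indicator {0<..T} (snd x) * (id (Y (snd x) (fst x)) * 1)) \<in> borel_measurable PL"
    by (rule grid_process_limit(3)[OF order_refl T_pos le0 assms(2,1)]) (auto intro: continuous_on_id)
  then show ?thesis by simp
qed

lemma fwd_ito_of:
  assumes "has_forward_ito_integral M (fwd_sigma M T W B) W \<phi> t T I" and t: "t \<in> {0..T}"
    and m: "(\<lambda>x. indicator {0<..T} (snd x) *\<^sub>R \<phi> (snd x) (fst x)) \<in> borel_measurable PL"
  shows "fwd.ito (\<lambda>x. indicator {t<..T} (snd x) *\<^sub>R (indicator {0<..T} (snd x) *\<^sub>R \<phi> (snd x) (fst x))) I"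
proof -
  obtain n p \<zeta> where s: "\<And>k. strict_partition t T (n k) (p k)"
    "\<And>k i. i < n k \<Longrightarrow> bounded_rv M (fwd_sigma M T W B (p k i)) (\<zeta> k i)"
    "L2_limit_of_step_integrals M W \<phi> t T n p \<zeta> I"
    using assms(1) unfolding has_forward_ito_integral_def by blast
  note [measurable] = m
  show ?thesis
  proof (rule fwd.itoI[where n=n and p=p and \<zeta>=\<zeta> and \<phi>=\<phi> and t=t])
    show "(\<lambda>x. indicator {t<..T} (snd x) *\<^sub>R (indicator {0<..T} (snd x) *\<^sub>R \<phi> (snd x) (fst x))) \<in> borel_measurable PL"
      by measurable
    show "fwd.coef (p k i) (p k (Suc i)) (\<zeta> k i)" if "i < n k" for k i
      using s(2)[OF that] by (simp add: bounded_rv_def fwd.coef_def)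
    show "L2_limit_of_step_integrals M W \<phi> t T n p \<zeta> I" by (rule s(3))
  qed (use t s(1) in auto)
qed

lemma bwd_ito_of:
  assumes "has_backward_ito_integral M (bwd_sigma M T W B) B \<phi> t T I" and t: "t \<in> {0..T}"
    and m: "(\<lambda>x. indicator {0<..T} (snd x) *\<^sub>R \<phi> (snd x) (fst x)) \<in> borel_measurable PL"
  shows "bwd.ito (\<lambda>x. indicator {t<..T} (snd x) *\<^sub>R (indicator {0<..T} (snd x) *\<^sub>R \<phi> (snd x) (fst x))) I"
proof -
  obtain n p \<zeta> where s: "\<And>k. strict_partition t T (n k) (p k)"
    "\<And>k i. i < n k \<Longrightarrow> bounded_rv M (bwd_sigma M T W B (p k (Suc i))) (\<zeta> k i)"
    "L2_limit_of_step_integrals M B \<phi> t T n p \<zeta> I"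
    using assms(1) unfolding has_backward_ito_integral_def by blast
  note [measurable] = m
  show ?thesis
  proof (rule bwd.itoI[where n=n and p=p and \<zeta>=\<zeta> and \<phi>=\<phi> and t=t])
    show "(\<lambda>x. indicator {t<..T} (snd x) *\<^sub>R (indicator {0<..T} (snd x) *\<^sub>R \<phi> (snd x) (fst x))) \<in> borel_measurable PL"
      by measurable
    show "bwd.coef (p k i) (p k (Suc i)) (\<zeta> k i)" if "i < n k" for k i
      using s(2)[OF that] by (simp add: bounded_rv_def bwd.coef_def)
    show "L2_limit_of_step_integrals M B \<phi> t T n p \<zeta> I" by (rule s(3))
  qed (use t s(1) in auto)
qed

text \<open>The given exceptional set depends on (t, y, z). Fubini moves the time into the almost
  everywhere quantifier; a countable dense set of (y, z) together with continuity of both generators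
  then leaves one null set of the product for all (y, z).\<close>

lemma coefficients_le_AE:
  fixes f1 f2 :: "'a \<Rightarrow> real \<Rightarrow> real \<Rightarrow> real ^ 'd \<Rightarrow> real"
  assumes m: "jointly_measurable_coeff M T f1" "jointly_measurable_coeff M T f2"
    and c1: "\<And>\<omega> t. \<omega> \<in> space M \<Longrightarrow> t \<in> {0..T} \<Longrightarrow> continuous_on UNIV (\<lambda>(y, z). f1 \<omega> t y z)"
    and c2: "\<And>\<omega> t. \<omega> \<in> space M \<Longrightarrow> t \<in> {0..T} \<Longrightarrow> continuous_on UNIV (\<lambda>(y, z). f2 \<omega> t y z)"
    and le: "\<And>t y z. t \<in> {0..T} \<Longrightarrow> AE \<omega> in M. f1 \<omega> t y z \<ge> f2 \<omega> t y z"
  shows "AE x in PL. snd x \<in> {0<..T} \<longrightarrow> (\<forall>y z. f2 (fst x) (snd x) y z \<le> f1 (fst x) (snd x) y z)"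
proof -
  obtain D :: "(real \<times> (real ^ 'd)) set" where D: "countable D" "\<And>U. open U \<Longrightarrow> U \<noteq> {} \<Longrightarrow> \<exists>d\<in>D. d \<in> U"
    by (rule countable_dense_setE) blast
  have cl: "closure D = UNIV"
  proof -
    have "p \<in> closure D" for p
      unfolding closure_iff_nhds_not_empty using D(2) by (metis Int_iff empty_iff interior_subset open_interior subsetD)
    then show ?thesis by auto
  qed
  have "AE x in PL. indicator {0<..T} (snd x) *\<^sub>R f2 (fst x) (snd x) (fst d) (snd d)
      \<le> indicator {0<..T} (snd x) *\<^sub>R f1 (fst x) (snd x) (fst d) (snd d)" for d
  proof -
    have [measurable]: "(\<lambda>x. indicator {0<..T} (snd x) *\<^sub>R f1 (fst x) (snd x) (fst d) (snd d)) \<in> borel_measurable PL"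
      "(\<lambda>x. indicator {0<..T} (snd x) *\<^sub>R f2 (fst x) (snd x) (fst d) (snd d)) \<in> borel_measurable PL"
      using coefficient_measurable[OF m(1), of "\<lambda>_. fst d" "\<lambda>_. snd d"] coefficient_measurable[OF m(2), of "\<lambda>_. fst d" "\<lambda>_. snd d"]
      by auto
    define P where "P \<omega> t \<longleftrightarrow> indicator {0<..T} t *\<^sub>R f2 \<omega> t (fst d) (snd d) \<le> indicator {0<..T} t *\<^sub>R f1 \<omega> t (fst d) (snd d)" for \<omega> t
    have Pm: "{x \<in> space PL. P (fst x) (snd x)} \<in> sets PL" unfolding P_def by measurable
    have "AE t in lborel. AE \<omega> in M. P \<omega> t"
    proof (rule AE_I2)
      fix t show "AE \<omega> in M. P \<omega> t"
      proof (cases "t \<in> {0<..T}")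
        case True
        then show ?thesis using le[of t "fst d" "snd d"] by (auto simp: P_def)
      qed (simp add: P_def)
    qed
    \<comment> \<open>Fubini turns "for almost every time, almost surely" into "for almost every
      pair".\<close>
    then have "AE x in PL. P (fst x) (snd x)"
      using fwd.P.AE_commute[OF Pm] fwd.P.AE_pair_iff[OF Pm] by simp
    then show ?thesis by (simp add: P_def)
  qed
  then have "AE x in PL. \<forall>d\<in>D. indicator {0<..T} (snd x) *\<^sub>R f2 (fst x) (snd x) (fst d) (snd d)
      \<le> indicator {0<..T} (snd x) *\<^sub>R f1 (fst x) (snd x) (fst d) (snd d)"
    by (subst AE_ball_countable[OF D(1)]) auto
  then show ?thesis using AE_space
  proof eventually_elim
    case (elim x)
    show ?case
    proof (intro impI allI)
      fix y z assume s: "snd x \<in> {0<..T}"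
      have \<omega>: "fst x \<in> space M" using elim(2) by (auto simp: space_pair_measure)
      have s': "snd x \<in> {0..T}" using s by auto
      have "continuous_on UNIV (\<lambda>p. (case p of (y, z) \<Rightarrow> f2 (fst x) (snd x) y z) - (case p of (y, z) \<Rightarrow> f1 (fst x) (snd x) y z))"
        by (intro continuous_on_diff c1 c2 \<omega> s')
      then have "(case (y, z) of (y, z) \<Rightarrow> f2 (fst x) (snd x) y z) - (case (y, z) of (y, z) \<Rightarrow> f1 (fst x) (snd x) y z) \<le> 0"
        using continuous_le_on_closure[of D "\<lambda>p. (case p of (y, z) \<Rightarrow> f2 (fst x) (snd x) y z) - (case p of (y, z) \<Rightarrow> f1 (fst x) (snd x) y z)" "(y, z)" 0]
          elim(1) s by (simp add: cl case_prod_beta')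
      then show "f2 (fst x) (snd x) y z \<le> f1 (fst x) (snd x) y z" by simp
    qed
  qed
qed

end

section \<open>Solutions with everywhere continuous paths and selected integrals\<close>

lemma set_integral_half_open:
  fixes h :: "real \<Rightarrow> real"
  assumes h: "set_integrable lborel {0..T} h" and t: "0 \<le> t"
  shows "integrable lborel (\<lambda>s. indicator {t<..T} s * h s)"
    and "(LBINT s:{t..T}. h s) = (\<integral>s. indicator {t<..T} s * h s \<partial>lborel)"
proof -
  have "set_integrable lborel {t<..T} h" and 1: "set_integrable lborel {t..T} h"
    using t by (auto intro: set_integrable_subset[OF h])
  then show i: "integrable lborel (\<lambda>s. indicator {t<..T} s * h s)"
    by (simp add: set_integrable_def)
  show "(LBINT s:{t..T}. h s) = (\<integral>s. indicator {t<..T} s * h s \<partial>lborel)"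
    unfolding set_lebesgue_integral_def
  proof (rule integral_cong_AE)
    show "(\<lambda>s. indicator {t..T} s *\<^sub>R h s) \<in> borel_measurable lborel"
      using 1 by (auto simp: set_integrable_def)
    show "(\<lambda>s. indicator {t<..T} s * h s) \<in> borel_measurable lborel" using i by auto
    show "AE s in lborel. indicator {t..T} s *\<^sub>R h s = indicator {t<..T} s * h s"
      using AE_lborel_singleton[of t] by eventually_elim (auto simp: indicator_def)
  qed
qed

text \<open>At t = T both stochastic integrals run over an empty interval; their vanishing
  identifies the terminal value of a solution with \<xi>.\<close>

lemma (in ito_noise) ito_zero:
  assumes "0 < T" "ito (\<lambda>x. 0) J"
  shows "AE \<omega> in M. J \<omega> = 0"
proof -
  have "(\<integral>\<omega>. (J \<omega>)\<^sup>2 \<partial>M) = 0" using ito_isometry[OF assms] by simp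
  moreover have "integrable M (\<lambda>\<omega>. (J \<omega>)\<^sup>2)" using sq_int_integrable[OF ito_sq_int(2)[OF assms(2)]] by simp
  ultimately have "AE \<omega> in M. (J \<omega>)\<^sup>2 = 0" by (subst (asm) integral_nonneg_eq_0_iff_AE) auto
  then show ?thesis by eventually_elim simp
qed

text \<open>Continuity and the bound by S hold at every \<omega>, so pathwise arguments carry no
  exceptional set. IB and IW are versions of the integrals picked separately at each t, with no
  regularity in t.\<close>

locale regular_solution = brownian_pair M T W B
  for M :: "'a measure" and T and W :: "real \<Rightarrow> 'a \<Rightarrow> real ^ 'd" and B :: "real \<Rightarrow> 'a \<Rightarrow> real ^ 'l" +
  fixes \<xi> :: "'a \<Rightarrow> real" and f :: "'a \<Rightarrow> real \<Rightarrow> real \<Rightarrow> real ^ 'd \<Rightarrow> real"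
    and g :: "'a \<Rightarrow> real \<Rightarrow> real \<Rightarrow> real ^ 'd \<Rightarrow> real ^ 'l"
    and Y :: "real \<Rightarrow> 'a \<Rightarrow> real" and Z :: "real \<Rightarrow> 'a \<Rightarrow> real ^ 'd"
    and S :: "'a \<Rightarrow> real" and IB IW :: "real \<Rightarrow> 'a \<Rightarrow> real"
  assumes cont: "\<omega> \<in> space M \<Longrightarrow> continuous_on {0..T} (\<lambda>t. Y t \<omega>)"
    and adapted: "t \<in> {0..T} \<Longrightarrow> Y t \<in> borel_measurable (bd_sigma M T W B t)"
    and S: "sq_int M S" "\<omega> \<in> space M \<Longrightarrow> t \<in> {0..T} \<Longrightarrow> \<bar>Y t \<omega>\<bar> \<le> S \<omega>"
    and Z_M2: "Z \<in> M2_space M T (bd_sigma M T W B)"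
    and g_meas: "jointly_measurable_coeff M T g"
    and backward: "t \<in> {0..T} \<Longrightarrow> has_backward_ito_integral M (bwd_sigma M T W B) B (\<lambda>s \<omega>. g \<omega> s (Y s \<omega>) (Z s \<omega>)) t T (IB t)"
    and forward: "t \<in> {0..T} \<Longrightarrow> has_forward_ito_integral M (fwd_sigma M T W B) W Z t T (IW t)"
    and solution: "t \<in> {0..T} \<Longrightarrow> AE \<omega> in M. integrable lborel (\<lambda>s. indicator {t<..T} s * f \<omega> s (Y s \<omega>) (Z s \<omega>)) \<and>
      Y t \<omega> = \<xi> \<omega> + (\<integral>s. indicator {t<..T} s * f \<omega> s (Y s \<omega>) (Z s \<omega>) \<partial>lborel) + IB t \<omega> - IW t \<omega>"
begin

definition drift_proc :: "'a \<times> real \<Rightarrow> real" where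
  "drift_proc x = indicator {0<..T} (snd x) *\<^sub>R f (fst x) (snd x) (Y (snd x) (fst x)) (Z (snd x) (fst x))"

definition bwd_proc :: "'a \<times> real \<Rightarrow> real ^ 'l" where
  "bwd_proc x = indicator {0<..T} (snd x) *\<^sub>R g (fst x) (snd x) (Y (snd x) (fst x)) (Z (snd x) (fst x))"

definition fwd_proc :: "'a \<times> real \<Rightarrow> real ^ 'd" where
  "fwd_proc x = indicator {0<..T} (snd x) *\<^sub>R Z (snd x) (fst x)"

lemma Y_joint: "(\<lambda>x. indicator {0<..T} (snd x) * Y (snd x) (fst x)) \<in> borel_measurable PL"
  by (rule continuous_adapted_joint[OF cont]) (use bd_measurable(1)[OF adapted] in auto)

lemma fwd_proc_sq_int: "sq_int PL fwd_proc"
  unfolding fwd_proc_def[abs_def] by (rule M2_sq_int[OF Z_M2])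

lemma coefficient_joint:
  assumes "jointly_measurable_coeff M T h"
  shows "(\<lambda>x. indicator {0<..T} (snd x) *\<^sub>R h (fst x) (snd x) (Y (snd x) (fst x)) (Z (snd x) (fst x))) \<in> borel_measurable PL"
  by (rule coefficient_measurable[OF assms Y_joint sq_int_measurable[OF fwd_proc_sq_int[unfolded fwd_proc_def[abs_def]]]])

lemma bwd_ito: "t \<in> {0..T} \<Longrightarrow> bwd.ito (\<lambda>x. indicator {t<..T} (snd x) *\<^sub>R bwd_proc x) (IB t)"
  unfolding bwd_proc_def
  by (rule bwd_ito_of[where \<phi>="\<lambda>s \<omega>. g \<omega> s (Y s \<omega>) (Z s \<omega>)", OF backward _ coefficient_joint[OF g_meas]]) auto

lemma fwd_ito: "t \<in> {0..T} \<Longrightarrow> fwd.ito (\<lambda>x. indicator {t<..T} (snd x) *\<^sub>R fwd_proc x) (IW t)"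
  unfolding fwd_proc_def
  by (rule fwd_ito_of[OF forward _ sq_int_measurable[OF fwd_proc_sq_int[unfolded fwd_proc_def[abs_def]]]]) auto

text \<open>Read off from the existence of the integral from 0 to T: an L2 limit of step processes
  is itself square integrable.\<close>

lemma bwd_proc_sq_int: "sq_int PL bwd_proc"
proof -
  have "(\<lambda>x. indicator {0<..T} (snd x) *\<^sub>R bwd_proc x) = bwd_proc"
    by (auto simp: fun_eq_iff bwd_proc_def indicator_def)
  then show ?thesis using bwd.ito_sq_int(1)[OF bwd_ito[of 0]] T_pos by simp
qed

lemma final_integrals: "AE \<omega> in M. IB T \<omega> = 0" "AE \<omega> in M. IW T \<omega> = 0"
  using bwd.ito_zero[OF T_pos, of "IB T"] fwd.ito_zero[OF T_pos, of "IW T"] bwd_ito[of T] fwd_ito[of T] T_pos by simp_all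

text \<open>Linear growth is what the two generators have in common: for f1 it follows from the
  Lipschitz bound, for f2 it is assumed.\<close>

lemma drift_proc_sq_int:
  assumes f: "jointly_measurable_coeff M T f"
    and f0: "sq_int PL (\<lambda>x. indicator {0<..T} (snd x) *\<^sub>R f (fst x) (snd x) 0 0)"
    and growth: "0 \<le> c" "\<And>\<omega> t y z. \<omega> \<in> space M \<Longrightarrow> t \<in> {0..T} \<Longrightarrow> \<bar>f \<omega> t y z\<bar> \<le> \<bar>f \<omega> t 0 0\<bar> + c * \<bar>y\<bar> + c * norm z"
  shows "sq_int PL drift_proc"
proof -
  have SI: "sq_int PL (\<lambda>x. indicator {0<..T} (snd x) * S (fst x))"
    by (rule sq_int_PL_indicator[OF S(1)]) (use T_pos in simp)
  define w where "w x = norm (indicator {0<..T} (snd x) *\<^sub>R f (fst x) (snd x) 0 0)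
    + (c *\<^sub>R (indicator {0<..T} (snd x) * S (fst x)) + c *\<^sub>R norm (fwd_proc x))" for x
  have "sq_int PL w"
    unfolding w_def[abs_def] by (intro sq_int_add sq_int_scaleR sq_int_norm f0 SI fwd_proc_sq_int)
  then show ?thesis
  proof (rule sq_int_bound)
    show "drift_proc \<in> borel_measurable PL" unfolding drift_proc_def[abs_def] by (rule coefficient_joint[OF f])
    show "AE x in PL. norm (drift_proc x) \<le> norm (w x)"
    proof (rule AE_I2)
      fix x assume "x \<in> space PL"
      then have \<omega>: "fst x \<in> space M" by (auto simp: space_pair_measure)
      show "norm (drift_proc x) \<le> norm (w x)"
      proof (cases "snd x \<in> {0<..T}")
        case True
        then have s: "snd x \<in> {0..T}" by auto
        have "c * \<bar>Y (snd x) (fst x)\<bar> \<le> c * S (fst x)" using S(2)[OF \<omega> s] growth(1) by (rule mult_left_mono)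
        then have "norm (f (fst x) (snd x) (Y (snd x) (fst x)) (Z (snd x) (fst x))) \<le> w x"
          using growth(2)[OF \<omega> s, of "Y (snd x) (fst x)" "Z (snd x) (fst x)"] True by (simp add: w_def fwd_proc_def)
        then show ?thesis using True by (simp add: drift_proc_def)
      qed (simp add: drift_proc_def)
    qed
  qed
qed

end

lemma (in brownian_pair) solution_regular:
  fixes f :: "'a \<Rightarrow> real \<Rightarrow> real \<Rightarrow> real ^ 'd \<Rightarrow> real" and g :: "'a \<Rightarrow> real \<Rightarrow> real \<Rightarrow> real ^ 'd \<Rightarrow> real ^ 'l"
  assumes sol: "bdsde_solution M T W B \<xi> f g Y Z" and g: "jointly_measurable_coeff M T g"
  obtains Y' S IB IW where "regular_solution M T W B \<xi> f g Y' Z S IB IW" "AE \<omega> in M. \<forall>t. Y' t \<omega> = Y t \<omega>"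
proof -
  have Y: "Y \<in> S2_space M T (bd_sigma M T W B)" and Z: "Z \<in> M2_space M T (bd_sigma M T W B)"
    and fi: "AE \<omega> in M. set_integrable lborel {0..T} (\<lambda>s. f \<omega> s (Y s \<omega>) (Z s \<omega>))"
    and eq: "\<forall>t\<in>{0..T}. \<exists>IB IW.
        has_backward_ito_integral M (bwd_sigma M T W B) B (\<lambda>s \<omega>. g \<omega> s (Y s \<omega>) (Z s \<omega>)) t T IB \<and>
        has_forward_ito_integral M (fwd_sigma M T W B) W Z t T IW \<and>
        (AE \<omega> in M. Y t \<omega> = \<xi> \<omega> + (LBINT s:{t..T}. f \<omega> s (Y s \<omega>) (Z s \<omega>)) + IB \<omega> - IW \<omega>)"
    using sol by (auto simp: bdsde_solution_def)
  \<comment> \<open>Versions of the two integrals are selected for all times simultaneously.\<close>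
  from bchoice[OF eq] obtain IB where "\<forall>t\<in>{0..T}. \<exists>IW.
        has_backward_ito_integral M (bwd_sigma M T W B) B (\<lambda>s \<omega>. g \<omega> s (Y s \<omega>) (Z s \<omega>)) t T (IB t) \<and>
        has_forward_ito_integral M (fwd_sigma M T W B) W Z t T IW \<and>
        (AE \<omega> in M. Y t \<omega> = \<xi> \<omega> + (LBINT s:{t..T}. f \<omega> s (Y s \<omega>) (Z s \<omega>)) + IB t \<omega> - IW \<omega>)"
    by blast
  from bchoice[OF this] obtain IW where I: "\<And>t. t \<in> {0..T} \<Longrightarrow> has_backward_ito_integral M (bwd_sigma M T W B) B (\<lambda>s \<omega>. g \<omega> s (Y s \<omega>) (Z s \<omega>)) t T (IB t)"
    "\<And>t. t \<in> {0..T} \<Longrightarrow> has_forward_ito_integral M (fwd_sigma M T W B) W Z t T (IW t)"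
    "\<And>t. t \<in> {0..T} \<Longrightarrow> AE \<omega> in M. Y t \<omega> = \<xi> \<omega> + (LBINT s:{t..T}. f \<omega> s (Y s \<omega>) (Z s \<omega>)) + IB t \<omega> - IW t \<omega>"
    by blast
  obtain Y' S where Y': "\<And>\<omega>. \<omega> \<in> space M \<Longrightarrow> continuous_on {0..T} (\<lambda>t. Y' t \<omega>)"
    "\<And>t. t \<in> {0..T} \<Longrightarrow> Y' t \<in> borel_measurable (bd_sigma M T W B t)"
    "AE \<omega> in M. \<forall>t. Y' t \<omega> = Y t \<omega>"
    "sq_int M (S :: 'a \<Rightarrow> real)" "\<And>\<omega> t. \<omega> \<in> space M \<Longrightarrow> t \<in> {0..T} \<Longrightarrow> \<bar>Y' t \<omega>\<bar> \<le> S \<omega>"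
    by (rule S2_regular_version[OF Y]) (rule that)
  have "regular_solution M T W B \<xi> f g Y' Z S IB IW"
  proof (intro regular_solution.intro brownian_pair_axioms regular_solution_axioms.intro Y' Z g I(2))
    fix t assume t: "t \<in> {0..T}"
    have "AE \<omega> in M. \<forall>s\<in>{t..T}. g \<omega> s (Y s \<omega>) (Z s \<omega>) = g \<omega> s (Y' s \<omega>) (Z s \<omega>)"
      using Y'(3) by eventually_elim simp
    from has_backward_ito_integral_cong[OF I(1)[OF t] this]
    show "has_backward_ito_integral M (bwd_sigma M T W B) B (\<lambda>s \<omega>. g \<omega> s (Y' s \<omega>) (Z s \<omega>)) t T (IB t)" .
    show "AE \<omega> in M. integrable lborel (\<lambda>s. indicator {t<..T} s * f \<omega> s (Y' s \<omega>) (Z s \<omega>)) \<and>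
      Y' t \<omega> = \<xi> \<omega> + (\<integral>s. indicator {t<..T} s * f \<omega> s (Y' s \<omega>) (Z s \<omega>) \<partial>lborel) + IB t \<omega> - IW t \<omega>"
      using Y'(3) fi I(3)[OF t]
    proof eventually_elim
      case (elim \<omega>)
      then show ?case using set_integral_half_open[OF elim(2), of t] t by simp
    qed
  qed
  then show thesis using that Y'(3) by blast
qed

theorem theorem3p1:
  fixes M :: "'a measure" and T :: real
    and W :: "real \<Rightarrow> 'a \<Rightarrow> real ^ 'd" and B :: "real \<Rightarrow> 'a \<Rightarrow> real ^ 'l"
    and \<xi>1 \<xi>2 :: "'a \<Rightarrow> real"
    and f1 f2 :: "'a \<Rightarrow> real \<Rightarrow> real \<Rightarrow> real ^ 'd \<Rightarrow> real"
    and g :: "'a \<Rightarrow> real \<Rightarrow> real \<Rightarrow> real ^ 'd \<Rightarrow> real ^ 'l"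
    and Y1 Y2 :: "real \<Rightarrow> 'a \<Rightarrow> real" and Z1 Z2 :: "real \<Rightarrow> 'a \<Rightarrow> real ^ 'd"
  assumes "prob_space M" and "T > 0"
    and "std_brownian_motion M T W" and "std_brownian_motion M T B"
    and "indep_processes M T W B"
    and "\<xi>1 \<in> L2_space M (bd_sigma M T W B T)" and "\<xi>2 \<in> L2_space M (bd_sigma M T W B T)"
    and f1_meas: "jointly_measurable_coeff M T f1"
    and f1_M2: "\<And>y z. (\<lambda>t \<omega>. f1 \<omega> t y z) \<in> M2_space M T (bd_sigma M T W B)"
    and f1_lip: "\<exists>C>0. \<forall>\<omega>\<in>space M. \<forall>t\<in>{0..T}. \<forall>y1 y2 z1 z2.
           \<bar>f1 \<omega> t y1 z1 - f1 \<omega> t y2 z2\<bar>\<^sup>2 \<le> C * (\<bar>y1 - y2\<bar>\<^sup>2 + (norm (z1 - z2))\<^sup>2)"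
    and g_meas: "jointly_measurable_coeff M T g"
    and g_M2: "\<And>y z. (\<lambda>t \<omega>. g \<omega> t y z) \<in> M2_space M T (bd_sigma M T W B)"
    and g_lip: "\<exists>C>0. \<exists>\<alpha>>0. \<alpha> < 1 \<and> (\<forall>\<omega>\<in>space M. \<forall>t\<in>{0..T}. \<forall>y1 y2 z1 z2.
           (norm (g \<omega> t y1 z1 - g \<omega> t y2 z2))\<^sup>2 \<le> C * \<bar>y1 - y2\<bar>\<^sup>2 + \<alpha> * (norm (z1 - z2))\<^sup>2)"
    and f2_meas: "jointly_measurable_coeff M T f2"
    and f2_adapted: "\<And>t y z. t \<in> {0..T} \<Longrightarrow> (\<lambda>\<omega>. f2 \<omega> t y z) \<in> borel_measurable (bd_sigma M T W B t)"
    and f2_cont: "\<And>\<omega> t. \<omega> \<in> space M \<Longrightarrow> t \<in> {0..T} \<Longrightarrow> continuous_on UNIV (\<lambda>(y, z). f2 \<omega> t y z)"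
    and f2_growth: "\<exists>K>0. \<forall>\<omega>\<in>space M. \<forall>t\<in>{0..T}. \<forall>y z.
           \<bar>f2 \<omega> t y z\<bar> \<le> \<bar>f2 \<omega> t 0 0\<bar> + K * \<bar>y\<bar> + K * norm z"
    and f2_sq: "(\<integral>\<^sup>+\<omega>. (\<integral>\<^sup>+t\<in>{0..T}. ennreal (\<bar>f2 \<omega> t 0 0\<bar>\<^sup>2) \<partial>lborel) \<partial>M) < \<infinity>"
    and \<xi>_le: "AE \<omega> in M. \<xi>1 \<omega> \<ge> \<xi>2 \<omega>"
    and f_le: "\<And>t y z. t \<in> {0..T} \<Longrightarrow> AE \<omega> in M. f1 \<omega> t y z \<ge> f2 \<omega> t y z"
    and sol1: "bdsde_solution M T W B \<xi>1 f1 g Y1 Z1"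
    and sol2: "bdsde_solution M T W B \<xi>2 f2 g Y2 Z2"
  shows "AE \<omega> in M. \<forall>t\<in>{0..T}. Y1 t \<omega> \<ge> Y2 t \<omega>"
proof -
  interpret brownian_pair M T W B
    using assms(1-5) by (auto simp: brownian_pair_def brownian_pair_axioms_def)
  obtain C1 where C1: "0 < C1" "\<And>\<omega> t y1 y2 z1 z2. \<omega> \<in> space M \<Longrightarrow> t \<in> {0..T} \<Longrightarrow>
      \<bar>f1 \<omega> t y1 z1 - f1 \<omega> t y2 z2\<bar>\<^sup>2 \<le> C1 * (\<bar>y1 - y2\<bar>\<^sup>2 + (norm (z1 - z2))\<^sup>2)"
    using f1_lip by blast
  obtain C \<alpha> where C: "0 < C" and \<alpha>: "0 < \<alpha>" "\<alpha> < 1" and g_le: "\<And>\<omega> t y1 y2 z1 z2. \<omega> \<in> space M \<Longrightarrow> t \<in> {0..T} \<Longrightarrow>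
      (norm (g \<omega> t y1 z1 - g \<omega> t y2 z2))\<^sup>2 \<le> C * \<bar>y1 - y2\<bar>\<^sup>2 + \<alpha> * (norm (z1 - z2))\<^sup>2"
    using g_lip by blast
  obtain K where K: "0 < K" "\<And>\<omega> t y z. \<omega> \<in> space M \<Longrightarrow> t \<in> {0..T} \<Longrightarrow>
      \<bar>f2 \<omega> t y z\<bar> \<le> \<bar>f2 \<omega> t 0 0\<bar> + K * \<bar>y\<bar> + K * norm z"
    using f2_growth by blast
  define L where "L = sqrt C1"
  have f1_lip': "\<bar>f1 \<omega> t y1 z1 - f1 \<omega> t y2 z2\<bar> \<le> L * (\<bar>y1 - y2\<bar> + norm (z1 - z2))"
    and f1_cont: "continuous_on UNIV (\<lambda>(y, z). f1 \<omega> t y z)" if "\<omega> \<in> space M" "t \<in> {0..T}" for \<omega> t y1 y2 z1 z2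
    using lipschitz_square_root[of C1 "\<lambda>(y, z). f1 \<omega> t y z"] C1(1) C1(2)[OF that] by (auto simp: L_def)
  have f1_growth: "\<bar>f1 \<omega> t y z\<bar> \<le> \<bar>f1 \<omega> t 0 0\<bar> + L * \<bar>y\<bar> + L * norm z" if "\<omega> \<in> space M" "t \<in> {0..T}" for \<omega> t y z
    using f1_lip'[OF that, of y z 0 0] by (simp add: distrib_left)
  have L0: "0 \<le> L" using C1(1) by (simp add: L_def)
  obtain Y1' S1 IB1 IW1 where r1: "regular_solution M T W B \<xi>1 f1 g Y1' Z1 S1 IB1 IW1" and Y1': "AE \<omega> in M. \<forall>t. Y1' t \<omega> = Y1 t \<omega>"
    by (rule solution_regular[OF sol1 g_meas])
  obtain Y2' S2 IB2 IW2 where r2: "regular_solution M T W B \<xi>2 f2 g Y2' Z2 S2 IB2 IW2" and Y2': "AE \<omega> in M. \<forall>t. Y2' t \<omega> = Y2 t \<omega>"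
    by (rule solution_regular[OF sol2 g_meas])
  interpret s1: regular_solution M T W B \<xi>1 f1 g Y1' Z1 S1 IB1 IW1 by (rule r1)
  interpret s2: regular_solution M T W B \<xi>2 f2 g Y2' Z2 S2 IB2 IW2 by (rule r2)
  define \<delta> where "\<delta> t \<omega> = Y2' t \<omega> - Y1' t \<omega>" for t \<omega>
  have F1: "sq_int PL s1.drift_proc"
    by (rule s1.drift_proc_sq_int[OF f1_meas M2_sq_int[OF f1_M2] L0 f1_growth])
  have z2: "sq_int PL (\<lambda>x. indicator {0<..T} (snd x) *\<^sub>R f2 (fst x) (snd x) 0 0)"
    by (rule sq_int_PL_iterated[where \<phi>="\<lambda>t \<omega>. f2 \<omega> t 0 0"])
      (use coefficient_measurable[OF f2_meas, of "\<lambda>_. 0" "\<lambda>_. 0"] f2_sq in auto)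
  have F2: "sq_int PL s2.drift_proc"
    by (rule s2.drift_proc_sq_int[OF f2_meas z2 less_imp_le[OF K(1)] K(2)])
  have T0: "T \<in> {0..T}" using T_pos by auto
  have f_le_AE: "AE x in PL. snd x \<in> {0<..T} \<longrightarrow> (\<forall>y z. f2 (fst x) (snd x) y z \<le> f1 (fst x) (snd x) y z)"
    by (rule coefficients_le_AE[OF f1_meas f2_meas f1_cont f2_cont f_le])
  interpret backward_inequality M T W B \<delta> "\<lambda>\<omega>. S2 \<omega> + S1 \<omega>" "\<lambda>x. s2.drift_proc x - s1.drift_proc x" "\<lambda>x. s2.bwd_proc x - s1.bwd_proc x" "\<lambda>x. s2.fwd_proc x - s1.fwd_proc x"
    "\<lambda>t \<omega>. IB2 t \<omega> - IB1 t \<omega>" "\<lambda>t \<omega>. IW2 t \<omega> - IW1 t \<omega>" L C \<alpha>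
  proof unfold_locales
    show "continuous_on {0..T} (\<lambda>u. \<delta> u \<omega>)" if "\<omega> \<in> space M" for \<omega>
      unfolding \<delta>_def using s1.cont s2.cont that by (intro continuous_intros)
    show "\<delta> u \<in> borel_measurable (bd_sigma M T W B u)" if "u \<in> {0..T}" for u
      unfolding \<delta>_def[abs_def] using s1.adapted s2.adapted that by (intro borel_measurable_diff)
    show "sq_int M (\<lambda>\<omega>. S2 \<omega> + S1 \<omega>)" by (intro sq_int_add s1.S s2.S)
    show "\<bar>\<delta> u \<omega>\<bar> \<le> S2 \<omega> + S1 \<omega>" if "\<omega> \<in> space M" "u \<in> {0..T}" for u \<omega>
      using s1.S(2)[OF that] s2.S(2)[OF that] by (simp add: \<delta>_def)
    show "sq_int PL (\<lambda>x. s2.drift_proc x - s1.drift_proc x)" by (rule sq_int_diff[OF F2 F1])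
    show "sq_int PL (\<lambda>x. s2.bwd_proc x - s1.bwd_proc x)" by (rule sq_int_diff[OF s2.bwd_proc_sq_int s1.bwd_proc_sq_int])
    show "sq_int PL (\<lambda>x. s2.fwd_proc x - s1.fwd_proc x)" by (rule sq_int_diff[OF s2.fwd_proc_sq_int s1.fwd_proc_sq_int])
    show "s2.drift_proc x - s1.drift_proc x = 0" if "snd x \<notin> {0<..T}" for x using that by (simp add: s1.drift_proc_def s2.drift_proc_def)
    show "bwd.ito (\<lambda>x. indicator {u<..T} (snd x) *\<^sub>R (s2.bwd_proc x - s1.bwd_proc x)) (\<lambda>\<omega>. IB2 u \<omega> - IB1 u \<omega>)" if "u \<in> {0..T}" for u
      using bwd.ito_diff[OF less_imp_le[OF T_pos] s2.bwd_ito[OF that] s1.bwd_ito[OF that]] by (simp only: scaleR_diff_right)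
    show "fwd.ito (\<lambda>x. indicator {u<..T} (snd x) *\<^sub>R (s2.fwd_proc x - s1.fwd_proc x)) (\<lambda>\<omega>. IW2 u \<omega> - IW1 u \<omega>)" if "u \<in> {0..T}" for u
      using fwd.ito_diff[OF less_imp_le[OF T_pos] s2.fwd_ito[OF that] s1.fwd_ito[OF that]] by (simp only: scaleR_diff_right)
    \<comment> \<open>The equations at T are used as well: there all integrals vanish, so \<delta> T
      stands for \<xi>2 - \<xi>1.\<close>
    show "AE \<omega> in M. \<delta> u \<omega> = \<delta> T \<omega> + drift_int (\<lambda>x. s2.drift_proc x - s1.drift_proc x) u T \<omega> + (IB2 u \<omega> - IB1 u \<omega>) - (IW2 u \<omega> - IW1 u \<omega>)"
      if u: "u \<in> {0..T}" for u
      using s1.solution[OF u] s2.solution[OF u] s1.solution[OF T0] s2.solution[OF T0] s1.final_integrals s2.final_integrals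
    proof eventually_elim
      case (elim \<omega>)
      have "drift_int (\<lambda>x. s2.drift_proc x - s1.drift_proc x) u T \<omega>
        = (\<integral>s. indicator {u<..T} s * f2 \<omega> s (Y2' s \<omega>) (Z2 s \<omega>) - indicator {u<..T} s * f1 \<omega> s (Y1' s \<omega>) (Z1 s \<omega>) \<partial>lborel)"
        unfolding drift_int_def using u
        by (intro Bochner_Integration.integral_cong) (auto simp: s1.drift_proc_def s2.drift_proc_def indicator_def)
      also have "\<dots> = (\<integral>s. indicator {u<..T} s * f2 \<omega> s (Y2' s \<omega>) (Z2 s \<omega>) \<partial>lborel)
          - (\<integral>s. indicator {u<..T} s * f1 \<omega> s (Y1' s \<omega>) (Z1 s \<omega>) \<partial>lborel)"
        using elim by (intro Bochner_Integration.integral_diff) auto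
      finally show ?case using elim by (simp add: \<delta>_def)
    qed
    show "AE \<omega> in M. \<delta> T \<omega> \<le> 0"
      using s1.solution[OF T0] s2.solution[OF T0] s1.final_integrals s2.final_integrals \<xi>_le by eventually_elim (simp add: \<delta>_def)
    show "0 \<le> L" "0 \<le> C" "0 < \<alpha>" "\<alpha> < 1" using L0 C \<alpha> by auto
    show "AE x in PL. snd x \<in> {0<..T} \<longrightarrow> 0 < \<delta> (snd x) (fst x) \<longrightarrow>
      s2.drift_proc x - s1.drift_proc x \<le> L * (\<bar>\<delta> (snd x) (fst x)\<bar> + norm (s2.fwd_proc x - s1.fwd_proc x)) \<and>
      (norm (s2.bwd_proc x - s1.bwd_proc x))\<^sup>2 \<le> C * (\<delta> (snd x) (fst x))\<^sup>2 + \<alpha> * (norm (s2.fwd_proc x - s1.fwd_proc x))\<^sup>2"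
      using f_le_AE AE_space
    proof eventually_elim
      case (elim x)
      show ?case
      proof (intro impI conjI)
        assume s: "snd x \<in> {0<..T}"
        have \<omega>: "fst x \<in> space M" using elim(2) by (auto simp: space_pair_measure)
        have s': "snd x \<in> {0..T}" using s by auto
        \<comment> \<open>f2 is exchanged for f1 at the arguments of the second solution; what
          remains is a difference of values of f1, to which the Lipschitz bound applies.\<close>
        have "f2 (fst x) (snd x) (Y2' (snd x) (fst x)) (Z2 (snd x) (fst x))
            \<le> f1 (fst x) (snd x) (Y2' (snd x) (fst x)) (Z2 (snd x) (fst x))"
          using elim(1) s by blast
        moreover note f1_lip'[OF \<omega> s', of "Y2' (snd x) (fst x)" "Z2 (snd x) (fst x)" "Y1' (snd x) (fst x)" "Z1 (snd x) (fst x)"]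
        ultimately show "s2.drift_proc x - s1.drift_proc x \<le> L * (\<bar>\<delta> (snd x) (fst x)\<bar> + norm (s2.fwd_proc x - s1.fwd_proc x))"
          using s by (simp add: s1.drift_proc_def s2.drift_proc_def s1.fwd_proc_def s2.fwd_proc_def \<delta>_def)
        show "(norm (s2.bwd_proc x - s1.bwd_proc x))\<^sup>2 \<le> C * (\<delta> (snd x) (fst x))\<^sup>2 + \<alpha> * (norm (s2.fwd_proc x - s1.fwd_proc x))\<^sup>2"
          using g_le[OF \<omega> s', of "Y2' (snd x) (fst x)" "Z2 (snd x) (fst x)" "Y1' (snd x) (fst x)" "Z1 (snd x) (fst x)"] s
          by (simp add: s1.bwd_proc_def s2.bwd_proc_def s1.fwd_proc_def s2.fwd_proc_def \<delta>_def)
      qed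
    qed
  qed
  show ?thesis
    using nonpositive Y1' Y2' by eventually_elim (auto simp: \<delta>_def)
qed

end
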